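(* $Z$ is an orbit of $\overline B_l$ in $\mathbf f+\mathfrak b_l$ (under the action $a\cdot y=P(ay)$), and hence $Z$ has a symplectic structure, given by $$\omega_Z=\sum_{i=1}^n\ \sum_{j+s\le l}t_{i;j,s}\,d\rho_{i,j}\wedge d\gamma_{i,s},$$ where $T_i=(t_{i;j,s})_{0\le j,s\le l}$ is the inverse of the $(l+1)\times(l+1)$ matrix $\left[t'_{i;j,s}=\gamma_{i,j+s-l}\right]_{0\le j,s\le l}$ (with $\gamma_{i,r}=0$ for $r<0$). Moreover, for any $I\in S(\mathfrak g_l)^{G_l}$, if $\chi_{I|_Z}$ is the Hamiltonian vector field on $Z$ corresponding to $I|_Z\in C^\infty(Z)$, then $\chi_{I|_Z}=\chi_I$ on $Z$.
   Context: The ground field is $\mathbb R$. Let $\mathfrak g$ be a real split simple Lie algebra of rank $n$, $\kappa$ a positive multiple of its Killing form, $\mathfrak h$ a split Cartan subalgebra with simple roots $\alpha_1,\dots,\alpha_n$ and positive roots $\Delta_+$. Root vectors are chosen so that $\kappa(e_\alpha,e_\beta)=\delta_{\alpha,-\beta}$; put $h_i=[e_{\alpha_i},e_{-\alpha_i}]$, normalized (standing convention of the paper) so that $\kappa(h_i,h_i)=2$ for all $i$. Let $\omega_i\in\mathfrak h$ satisfy $\alpha_j(\omega_i)=\delta_{i,j}$ (and $\kappa(h_i,\omega_j)=\delta_{i,j}$). Put $\mathfrak n=\sum_{\alpha\in\Delta_+}\mathbb R e_\alpha$, $\overline{\mathfrak n}=\sum_{\alpha\in\Delta_+}\mathbb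 R e_{-\alpha}$, $\mathfrak b=\mathfrak h+\mathfrak n$, $\overline{\mathfrak b}=\mathfrak h+\overline{\mathfrak n}$. Fix a positive integer $l$; $\mathfrak g_l=\mathfrak g\otimes\mathbb R[t]/(t^{l+1})$, $x(k)=x\otimes t^k$, $S_l=S\otimes\mathbb R[t]/(t^{l+1})$ for a subspace $S\subseteq\mathfrak g$, and $Q(x(i),y(j))=\delta_{i+j,l}\kappa(x,y)$. $G_l$ is the adjoint group of $\mathfrak g_l$ and $\overline B_l\subseteq G_l$ the Lie subgroup corresponding to $\overline{\mathfrak b}_l$. Let $\mathbf f=\sum_{j=0}^l\mathfrak f_j(j)$, where each $\mathfrak f_j$ is a linear combination of $e_{-\alpha_1},\dots,e_{-\alpha_n}$ with all coefficients nonzero (principal nilpotent). The manifold of normalized Jacobi elements is $$Z=\mathbf f+\sum_{1\le i\le n,\,0\le j\le l}\mathbb R\,h_i(j)+\sum_{1\le i\le n,\,0\le j\le l}\mathbb R^+e_{\alpha_i}(j),$$ with global coordinates $\rho_{i,j},\gamma_{i,j}$ defined by $y=\mathbf f+\sum\rho_{i,j}(y)h_i(j)+\sum\gamma_{i,j}(y)e_{\alpha_i}(j)$, $\rho_{i,j}(y)\in\mathbb R$, $\gamma_{i,j}(y)\in\mathbb R^+$. Every element of $\mathfrak g_l$ is uniquely a sum of an element of $\overline{\mathfrak n}_l$ and an element of $\mathbf f+\mathfrak b_l$; $P:\mathfrak g_l\to\mathbf f+\mathfrak b_l$ is the corresponding projection. $\overline B_l$ acts on $\mathbf f+\mathfrak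 b_l$ by $a\cdot y=P(ay)$; under the translation $\mathfrak b_l\to\mathbf f+\mathfrak b_l$, $x\mapsto\mathbf f+x$, and the identification $\mathfrak b_l\cong(\overline{\mathfrak b}_l)^*$ via $Q$, this is the coadjoint action, so orbits carry the coadjoint-orbit (Kirillov–Kostant–Souriau) symplectic structure. Explicitly, each $u\in S(\overline{\mathfrak b}_l)$, viewed as a polynomial function via $Q$, restricts to $\psi^u=u|_Z$, and the Poisson bracket on $C^\infty(Z)$ satisfies $[\psi^u,\psi^v]=\psi^{[u,v]}$, where $[u,v]$ is the Lie–Poisson bracket of $S(\overline{\mathfrak b}_l)$ extending the Lie bracket. Sign convention: the Hamiltonian vector field $\chi_\varphi$ of $\varphi\in C^\infty(Z)$ satisfies $\chi_\varphi\psi=[\varphi,\psi]$ and $\omega_Z(\chi_\varphi,\cdot)=d\varphi$. For $I\in S(\mathfrak g_l)^{G_l}$ (a polynomial function on $\mathfrak g_l$ via $Q$), $(\delta I)(y)\in\mathfrak g_l$ is the differential at $y$ (identified with an element of $\mathfrak g_l$ via $Q$), $(\delta_{\overline{\mathfrak b}_l}I)(y)$ is the component of $(\delta I)(y)$ in $\overline{\mathfrak b}_l$ relative to $\mathfrak g_l=\overline{\mathfrak b}_l\oplus\mathfrak n_l$, and $\chi_I$ is the vector field on $\mathbf f+\mathfrak b_l$ given by $(\chi_I)_y=[y,(\delta_{\overline{\mathfrak b}_l}I)(y)]\in\mathfrak b_l$.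
   Formalization: In Z only the coefficients γ_{i,0} are required to be positive, the other γ_{i,j} being arbitrary reals: with all γ_{i,j}>0, Z is not an orbit, since exp(s ad h_i(1)) sends γ_{i,1} to γ_{i,1}+2sγ_{i,0}; the other claims restrict to the smaller set. *)

theory Defs
  imports "HOL-Analysis.Analysis"
begin

section \<open>Split simple real Lie algebras\<close>

text \<open>
  A finite-dimensional real Lie algebra is an arbitrary bracket on a Euclidean space; the inner
  product of the Euclidean space is auxiliary (it supplies the topology and a basis) and plays no
  role in the algebra.
\<close>

definition lie_bracket :: "('v::euclidean_space \<Rightarrow> 'v \<Rightarrow> 'v) \<Rightarrow> bool" where
  "lie_bracket br \<longleftrightarrow> bilinear br \<and> (\<forall>x. br x x = 0) \<and>
     (\<forall>x y z. br x (br y z) + br y (br z x) + br z (br x y) = 0)"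

definition simple_lie :: "('v::euclidean_space \<Rightarrow> 'v \<Rightarrow> 'v) \<Rightarrow> bool" where
  "simple_lie br \<longleftrightarrow> lie_bracket br \<and> (\<exists>x y. br x y \<noteq> 0) \<and>
     (\<forall>J. subspace J \<and> (\<forall>x. \<forall>y\<in>J. br x y \<in> J) \<longrightarrow> J = {0} \<or> J = UNIV)"

text \<open>The trace of \<open>ad x \<circ> ad y\<close>, computed in the standard basis.\<close>

definition killing :: "('v::euclidean_space \<Rightarrow> 'v \<Rightarrow> 'v) \<Rightarrow> 'v \<Rightarrow> 'v \<Rightarrow> real" where
  "killing br x y = (\<Sum>b\<in>Basis. br x (br y b) \<bullet> b)"

primrec lower_central ::
  "('v::euclidean_space \<Rightarrow> 'v \<Rightarrow> 'v) \<Rightarrow> 'v set \<Rightarrow> nat \<Rightarrow> 'v set" where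
  "lower_central br S 0 = S"
| "lower_central br S (Suc k) = span {br x y | x y. x \<in> S \<and> y \<in> lower_central br S k}"

definition cartan_subalgebra :: "('v::euclidean_space \<Rightarrow> 'v \<Rightarrow> 'v) \<Rightarrow> 'v set \<Rightarrow> bool" where
  "cartan_subalgebra br \<hh> \<longleftrightarrow> subspace \<hh> \<and> (\<forall>x\<in>\<hh>. \<forall>y\<in>\<hh>. br x y \<in> \<hh>) \<and>
     (\<exists>k. lower_central br \<hh> k = {0}) \<and>
     {x. \<forall>y\<in>\<hh>. br x y \<in> \<hh>} = \<hh>"

text \<open>Split: every \<open>ad H\<close> with \<open>H\<close> in the Cartan subalgebra is diagonalizable over the reals.\<close>

definition split_cartan :: "('v::euclidean_space \<Rightarrow> 'v \<Rightarrow> 'v) \<Rightarrow> 'v set \<Rightarrow> bool" where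
  "split_cartan br \<hh> \<longleftrightarrow> cartan_subalgebra br \<hh> \<and>
     (\<forall>H\<in>\<hh>. span {x. \<exists>c. br H x = c *\<^sub>R x} = UNIV)"

definition root_space ::
  "('v::euclidean_space \<Rightarrow> 'v \<Rightarrow> 'v) \<Rightarrow> 'v set \<Rightarrow> ('v \<Rightarrow> real) \<Rightarrow> 'v set" where
  "root_space br \<hh> \<beta> = {x. \<forall>H\<in>\<hh>. br H x = \<beta> H *\<^sub>R x}"

text \<open>
  A root is a nonzero functional on \<open>\<hh>\<close> with nonzero root space. Functionals on \<open>\<hh>\<close> are
  represented by functions on the whole space that vanish outside \<open>\<hh>\<close>, so that equal functionals
  are equal functions. Linearity on \<open>\<hh>\<close> is automatic from the existence of a root vector.
\<close>

definition roots :: "('v::euclidean_space \<Rightarrow> 'v \<Rightarrow> 'v) \<Rightarrow> 'v set \<Rightarrow> ('v \<Rightarrow> real) set" where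
  "roots br \<hh> = {\<beta>. (\<forall>x. x \<notin> \<hh> \<longrightarrow> \<beta> x = 0) \<and> (\<exists>H\<in>\<hh>. \<beta> H \<noteq> 0) \<and> root_space br \<hh> \<beta> \<noteq> {0}}"

definition neg_root :: "('v \<Rightarrow> real) \<Rightarrow> 'v \<Rightarrow> real" where
  "neg_root \<beta> = (\<lambda>H. - \<beta> H)"

definition nonneg_combination ::
  "'v set \<Rightarrow> nat \<Rightarrow> (nat \<Rightarrow> 'v \<Rightarrow> real) \<Rightarrow> ('v \<Rightarrow> real) \<Rightarrow> bool" where
  "nonneg_combination \<hh> n \<alpha> \<beta> \<longleftrightarrow>
     (\<exists>m :: nat \<Rightarrow> nat. \<forall>H\<in>\<hh>. \<beta> H = (\<Sum>i=1..n. real (m i) * \<alpha> i H))"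

definition positive_roots ::
  "('v::euclidean_space \<Rightarrow> 'v \<Rightarrow> 'v) \<Rightarrow> 'v set \<Rightarrow> nat \<Rightarrow> (nat \<Rightarrow> 'v \<Rightarrow> real) \<Rightarrow> ('v \<Rightarrow> real) set" where
  "positive_roots br \<hh> n \<alpha> = {\<beta> \<in> roots br \<hh>. nonneg_combination \<hh> n \<alpha> \<beta>}"

text \<open>With \<open>n = dim \<hh>\<close>, the linear independence makes \<open>\<alpha> 1, \<dots>, \<alpha> n\<close> a basis of the dual of \<open>\<hh>\<close>.\<close>

definition simple_roots ::
  "('v::euclidean_space \<Rightarrow> 'v \<Rightarrow> 'v) \<Rightarrow> 'v set \<Rightarrow> nat \<Rightarrow> (nat \<Rightarrow> 'v \<Rightarrow> real) \<Rightarrow> bool" where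
  "simple_roots br \<hh> n \<alpha> \<longleftrightarrow>
     (\<forall>i\<in>{1..n}. \<alpha> i \<in> roots br \<hh>) \<and>
     (\<forall>c. (\<forall>H\<in>\<hh>. (\<Sum>i=1..n. c i * \<alpha> i H) = 0) \<longrightarrow> (\<forall>i\<in>{1..n}. c i = 0)) \<and>
     (\<forall>\<beta>\<in>roots br \<hh>. nonneg_combination \<hh> n \<alpha> \<beta> \<or> nonneg_combination \<hh> n \<alpha> (neg_root \<beta>))"

section \<open>The truncated current algebra\<close>

text \<open>
  \<open>\<gg> \<otimes> \<real>[t]/(t^(l+1))\<close> is the type \<open>'g ^ 'k\<close>, where \<open>deg\<close> is a bijection of the index type \<open>'k\<close>
  onto \<open>{0..l}\<close>: the component \<open>X $ k\<close> is the coefficient of \<open>t ^ deg k\<close>.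
\<close>

definition monomial :: "('k::finite \<Rightarrow> nat) \<Rightarrow> 'g::euclidean_space \<Rightarrow> nat \<Rightarrow> 'g ^ 'k" where
  "monomial deg x j = (\<chi> k. if deg k = j then x else 0)"

definition current_bracket ::
  "('k::finite \<Rightarrow> nat) \<Rightarrow> ('g::euclidean_space \<Rightarrow> 'g \<Rightarrow> 'g) \<Rightarrow> 'g ^ 'k \<Rightarrow> 'g ^ 'k \<Rightarrow> 'g ^ 'k" where
  "current_bracket deg br X Y =
     (\<chi> m. \<Sum>(a, b) \<in> {(a, b). deg a + deg b = deg m}. br (X $ a) (Y $ b))"

definition current_form ::
  "('k::finite \<Rightarrow> nat) \<Rightarrow> nat \<Rightarrow> ('g::euclidean_space \<Rightarrow> 'g \<Rightarrow> real) \<Rightarrow> 'g ^ 'k \<Rightarrow> 'g ^ 'k \<Rightarrow> real" where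
  "current_form deg l \<kappa> X Y =
     (\<Sum>(a, b) \<in> {(a, b). deg a + deg b = l}. \<kappa> (X $ a) (Y $ b))"

definition current_subspace :: "'g set \<Rightarrow> ('g ^ 'k) set" where
  "current_subspace S = {X. \<forall>k. X $ k \<in> S}"

section \<open>Groups and orbits\<close>

definition exp_ad :: "('v::euclidean_space \<Rightarrow> 'v \<Rightarrow> 'v) \<Rightarrow> 'v \<Rightarrow> 'v \<Rightarrow> 'v" where
  "exp_ad br x y = (\<Sum>k. ((br x ^^ k) y) /\<^sub>R fact k)"

text \<open>
  The connected Lie subgroup of the adjoint group with Lie algebra \<open>S\<close> is the group generated by
  the \<open>exp (ad x)\<close>, \<open>x \<in> S\<close> (inverses are covered since \<open>S\<close> is closed under negation); the adjoint
  group itself is the case \<open>S = UNIV\<close>.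
\<close>

inductive_set adjoint_group ::
  "('v::euclidean_space \<Rightarrow> 'v \<Rightarrow> 'v) \<Rightarrow> 'v set \<Rightarrow> ('v \<Rightarrow> 'v) set"
  for br S where
  one: "id \<in> adjoint_group br S"
| step: "a \<in> adjoint_group br S \<Longrightarrow> x \<in> S \<Longrightarrow> exp_ad br x \<circ> a \<in> adjoint_group br S"

text \<open>The component of \<open>y\<close> in \<open>A\<close>, when every vector is uniquely a sum of one in \<open>A\<close> and one in \<open>N\<close>.\<close>

definition component :: "'v::euclidean_space set \<Rightarrow> 'v set \<Rightarrow> 'v \<Rightarrow> 'v" where
  "component A N y = (THE z. z \<in> A \<and> y - z \<in> N)"

definition proj_action :: "'v::euclidean_space set \<Rightarrow> 'v set \<Rightarrow> ('v \<Rightarrow> 'v) \<Rightarrow> 'v \<Rightarrow> 'v" where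
  "proj_action A N a y = component A N (a y)"

definition proj_orbit :: "'v::euclidean_space set \<Rightarrow> 'v set \<Rightarrow> ('v \<Rightarrow> 'v) set \<Rightarrow> 'v \<Rightarrow> 'v set" where
  "proj_orbit A N G y = (\<lambda>a. proj_action A N a y) ` G"

definition infinitesimal_action ::
  "('v::euclidean_space \<Rightarrow> 'v \<Rightarrow> 'v) \<Rightarrow> 'v set \<Rightarrow> 'v set \<Rightarrow> 'v \<Rightarrow> 'v \<Rightarrow> 'v" where
  "infinitesimal_action br A N u y =
     vector_derivative (\<lambda>s. proj_action A N (exp_ad br (s *\<^sub>R u)) y) (at 0)"

definition orbit_tangent ::
  "('v::euclidean_space \<Rightarrow> 'v \<Rightarrow> 'v) \<Rightarrow> 'v set \<Rightarrow> 'v set \<Rightarrow> 'v set \<Rightarrow> 'v \<Rightarrow> 'v set" where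
  "orbit_tangent br A N S y = (\<lambda>u. infinitesimal_action br A N u y) ` S"

text \<open>
  The Kirillov--Kostant--Souriau form: on the tangent vectors \<open>\<xi> u\<close>, \<open>\<xi> v\<close> of the orbit generated
  by \<open>u, v \<in> S\<close> its value at \<open>y\<close> is \<open>- Q y [u, v]\<close>. The sign is forced by the conventions
  \<open>{\<psi> u, \<psi> v} = \<psi> [u, v]\<close> for \<open>\<psi> u = Q u\<close>, \<open>\<chi> \<phi> \<psi> = {\<phi>, \<psi>}\<close> and \<open>\<omega> (\<chi> \<phi>) = d\<phi>\<close>:
  \<open>Q v (\<chi> (\<psi> u)) = Q [u, v] y = - Q v [u, y]\<close> for all \<open>v \<in> S\<close> gives \<open>\<chi> (\<psi> u) = - \<xi> u\<close>, and then
  \<open>\<omega> (\<xi> u, \<xi> v) = \<omega> (\<chi> (\<psi> u), \<chi> (\<psi> v)) = {\<psi> v, \<psi> u} = - Q y [u, v]\<close>.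
\<close>

definition kks_form ::
  "('v::euclidean_space \<Rightarrow> 'v \<Rightarrow> 'v) \<Rightarrow> ('v \<Rightarrow> 'v \<Rightarrow> real) \<Rightarrow> 'v set \<Rightarrow> 'v set \<Rightarrow> 'v set \<Rightarrow>
   'v \<Rightarrow> 'v \<Rightarrow> 'v \<Rightarrow> real" where
  "kks_form br Q A N S y w w' =
     (THE r. \<exists>u\<in>S. \<exists>v\<in>S. infinitesimal_action br A N u y = w \<and>
                         infinitesimal_action br A N v y = w' \<and> r = - Q y (br u v))"

section \<open>Calculus on relatively open subsets of an affine subspace\<close>

text \<open>
  In this section \<open>Z\<close> is thought of as a relatively open subset of a translate of the subspace \<open>V\<close>,
  so that \<open>V\<close> is the tangent space of \<open>Z\<close> at each of its points. The differential at \<open>y\<close> of a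
  smooth function on \<open>Z\<close> is evaluated at \<open>v \<in> V\<close> along the straight line \<open>y + s v\<close>, which stays in
  \<open>Z\<close> for small \<open>s\<close>.
\<close>

definition differential :: "('v::real_normed_vector \<Rightarrow> real) \<Rightarrow> 'v \<Rightarrow> 'v \<Rightarrow> real" where
  "differential \<phi> y v = deriv (\<lambda>s. \<phi> (y + s *\<^sub>R v)) 0"

definition wedge :: "('v \<Rightarrow> real) \<Rightarrow> ('v \<Rightarrow> real) \<Rightarrow> 'v \<Rightarrow> 'v \<Rightarrow> real" where
  "wedge \<theta> \<eta> v w = \<theta> v * \<eta> w - \<theta> w * \<eta> v"

primrec Ck_on :: "nat \<Rightarrow> 'v::real_normed_vector set \<Rightarrow> 'v set \<Rightarrow> ('v \<Rightarrow> real) \<Rightarrow> bool" where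
  "Ck_on 0 V Z \<phi> = continuous_on Z \<phi>"
| "Ck_on (Suc k) V Z \<phi> =
     (\<phi> differentiable_on Z \<and> (\<forall>v\<in>V. Ck_on k V Z (\<lambda>y. differential \<phi> y v)))"

definition symplectic_form ::
  "'v::real_normed_vector set \<Rightarrow> 'v set \<Rightarrow> ('v \<Rightarrow> 'v \<Rightarrow> 'v \<Rightarrow> real) \<Rightarrow> bool" where
  "symplectic_form V Z \<omega> \<longleftrightarrow>
     (\<forall>y\<in>Z. \<forall>u\<in>V. \<forall>v\<in>V. \<forall>w\<in>V. \<forall>c.
        \<omega> y (u + v) w = \<omega> y u w + \<omega> y v w \<and> \<omega> y (c *\<^sub>R v) w = c * \<omega> y v w \<and>
        \<omega> y v w = - \<omega> y w v) \<and>
     (\<forall>v\<in>V. \<forall>w\<in>V. \<forall>k. Ck_on k V Z (\<lambda>y. \<omega> y v w)) \<and>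
     (\<forall>y\<in>Z. \<forall>u\<in>V. \<forall>v\<in>V. \<forall>w\<in>V.
        differential (\<lambda>z. \<omega> z v w) y u + differential (\<lambda>z. \<omega> z w u) y v +
        differential (\<lambda>z. \<omega> z u v) y w = 0) \<and>
     (\<forall>y\<in>Z. \<forall>v\<in>V. (\<forall>w\<in>V. \<omega> y v w = 0) \<longrightarrow> v = 0)"

definition hamiltonian_vector ::
  "'v::real_normed_vector set \<Rightarrow> ('v \<Rightarrow> 'v \<Rightarrow> 'v \<Rightarrow> real) \<Rightarrow> ('v \<Rightarrow> real) \<Rightarrow> 'v \<Rightarrow> 'v \<Rightarrow> bool" where
  "hamiltonian_vector V \<omega> \<phi> y v \<longleftrightarrow> v \<in> V \<and> (\<forall>w\<in>V. \<omega> y v w = differential \<phi> y w)"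

section \<open>Invariants\<close>

text \<open>
  Elements of \<open>S(\<gg>_l)\<close> are identified through \<open>Q\<close> with the real polynomial functions on \<open>\<gg>_l\<close>.
\<close>

definition invariant_polynomial ::
  "('v::euclidean_space \<Rightarrow> 'v \<Rightarrow> 'v) \<Rightarrow> ('v \<Rightarrow> real) \<Rightarrow> bool" where
  "invariant_polynomial br I \<longleftrightarrow>
     real_polynomial_function I \<and> (\<forall>a\<in>adjoint_group br UNIV. \<forall>y. I (a y) = I y)"

definition gradient :: "('v::euclidean_space \<Rightarrow> 'v \<Rightarrow> real) \<Rightarrow> ('v \<Rightarrow> real) \<Rightarrow> 'v \<Rightarrow> 'v" where
  "gradient Q I y = (THE X. (I has_derivative (\<lambda>w. Q X w)) (at y))"

text \<open>\<open>y \<mapsto> [y, X]\<close> with \<open>X\<close> the component of the gradient in \<open>S\<close> along \<open>N\<close>.\<close>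

definition invariant_field ::
  "('v::euclidean_space \<Rightarrow> 'v \<Rightarrow> 'v) \<Rightarrow> ('v \<Rightarrow> 'v \<Rightarrow> real) \<Rightarrow> 'v set \<Rightarrow> 'v set \<Rightarrow>
   ('v \<Rightarrow> real) \<Rightarrow> 'v \<Rightarrow> 'v" where
  "invariant_field br Q S N I y = br y (component S N (gradient Q I y))"

section \<open>Normalized Jacobi elements\<close>

text \<open>
  The families \<open>h\<close> and \<open>e\<close> stand for \<open>h_i\<close> and \<open>e_(\<alpha>_i)\<close>, and \<open>f\<close> for the base point.
\<close>

definition jacobi_element ::
  "('k::finite \<Rightarrow> nat) \<Rightarrow> nat \<Rightarrow> nat \<Rightarrow> 'g::euclidean_space ^ 'k \<Rightarrow> (nat \<Rightarrow> 'g) \<Rightarrow> (nat \<Rightarrow> 'g) \<Rightarrow>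
   (nat \<Rightarrow> nat \<Rightarrow> real) \<Rightarrow> (nat \<Rightarrow> nat \<Rightarrow> real) \<Rightarrow> 'g ^ 'k" where
  "jacobi_element deg n l f h e r g =
     f + (\<Sum>i=1..n. \<Sum>j=0..l. r i j *\<^sub>R monomial deg (h i) j)
       + (\<Sum>i=1..n. \<Sum>j=0..l. g i j *\<^sub>R monomial deg (e i) j)"

text \<open>
  Only the degree-zero coefficients \<open>g i 0\<close> are required to be positive. For \<open>j \<ge> 1\<close> positivity of
  \<open>g i j\<close> is not preserved by the group: \<open>exp (s ad h_i(1))\<close> adds \<open>\<alpha>_i(h_i) s g i 0\<close> to \<open>g i 1\<close>, so
  the set with all \<open>g i j > 0\<close> is a proper open subset of an orbit when \<open>l \<ge> 1\<close>.
\<close>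

definition jacobi_manifold ::
  "('k::finite \<Rightarrow> nat) \<Rightarrow> nat \<Rightarrow> nat \<Rightarrow> 'g::euclidean_space ^ 'k \<Rightarrow> (nat \<Rightarrow> 'g) \<Rightarrow> (nat \<Rightarrow> 'g) \<Rightarrow>
   ('g ^ 'k) set" where
  "jacobi_manifold deg n l f h e =
     {jacobi_element deg n l f h e r g | r g. \<forall>i\<in>{1..n}. g i 0 > 0}"

definition jacobi_tangent ::
  "('k::finite \<Rightarrow> nat) \<Rightarrow> nat \<Rightarrow> nat \<Rightarrow> (nat \<Rightarrow> 'g::euclidean_space) \<Rightarrow> (nat \<Rightarrow> 'g) \<Rightarrow> ('g ^ 'k) set"
  where
  "jacobi_tangent deg n l h e = span {monomial deg x j | x j. x \<in> h ` {1..n} \<union> e ` {1..n} \<and> j \<le> l}"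

definition rho_coord ::
  "('k::finite \<Rightarrow> nat) \<Rightarrow> nat \<Rightarrow> nat \<Rightarrow> 'g::euclidean_space ^ 'k \<Rightarrow> (nat \<Rightarrow> 'g) \<Rightarrow> (nat \<Rightarrow> 'g) \<Rightarrow>
   nat \<Rightarrow> nat \<Rightarrow> 'g ^ 'k \<Rightarrow> real" where
  "rho_coord deg n l f h e i j y = (THE c. \<exists>r g. y = jacobi_element deg n l f h e r g \<and> c = r i j)"

definition gamma_coord ::
  "('k::finite \<Rightarrow> nat) \<Rightarrow> nat \<Rightarrow> nat \<Rightarrow> 'g::euclidean_space ^ 'k \<Rightarrow> (nat \<Rightarrow> 'g) \<Rightarrow> (nat \<Rightarrow> 'g) \<Rightarrow>
   nat \<Rightarrow> nat \<Rightarrow> 'g ^ 'k \<Rightarrow> real" where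
  "gamma_coord deg n l f h e i j y = (THE c. \<exists>r g. y = jacobi_element deg n l f h e r g \<and> c = g i j)"

definition gamma_matrix ::
  "('k::finite \<Rightarrow> nat) \<Rightarrow> nat \<Rightarrow> (nat \<Rightarrow> real) \<Rightarrow> real ^ 'k ^ 'k" where
  "gamma_matrix deg l g =
     (\<chi> j s. if l \<le> deg j + deg s then g (deg j + deg s - l) else 0)"

end

theory Submission
  imports Defs "HOL-Computational_Algebra.Formal_Power_Series"
begin

text \<open>
  Write \<open>R\<close> for \<open>\<real>[t]/(t^(l+1))\<close>. The base point \<open>f\<close> lies in \<open>Nbar\<close>, and \<open>Nbar\<close> is stable under \<open>Bbar\<close>.
  So the projected action of \<open>Bbar\<close> on \<open>f + Bl\<close> is a translate of its linear action on the quotient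
  of the current algebra by \<open>Nbar\<close>. A point of \<open>Z\<close> is given by series \<open>\<rho>_i\<close> and \<open>\<gamma>_i\<close> in \<open>R\<close>, where
  \<open>\<gamma>_i\<close> is a unit with positive leading coefficient. An element of \<open>Bbar\<close> acts on it only through
  \<open>a_i = \<alpha>_i\<close> of its Cartan part and through its coefficient \<open>x_i\<close> at \<open>e_(-\<alpha>_i)\<close>, both in \<open>R\<close>; the
  infinitesimal action is \<open>d\<gamma>_i = a_i \<gamma>_i\<close>, \<open>d\<rho>_i = - x_i \<gamma>_i\<close> (\<open>brl_J_mod_Nbar\<close>). Everything about the
  orbit follows from this.

  The group multiplies leading coefficients of the \<open>\<gamma>_i\<close> by positive numbers, and it reaches every
  point of \<open>Z\<close>: exponentials of the \<open>\<omega>_i(k)\<close> adjust the \<open>\<gamma>_i\<close> degree by degree, an exponential of a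
  combination of the \<open>e_(-\<alpha>_i)(k)\<close> then adjusts the \<open>\<rho>_i\<close> (\<open>Z_orbit\<close>). As the \<open>\<gamma>_i\<close> are units, the
  infinitesimal action is onto and can be inverted: \<open>a_i = \<gamma>_i^(-1) d\<gamma>_i\<close>, \<open>x_i = - \<gamma>_i^(-1) d\<rho>_i\<close>.
  Substituting in \<open>Q\<close> gives the form as the sum over \<open>i\<close> of the coefficient of \<open>t^l\<close> in
  \<open>\<gamma>_i^(-1) d\<rho>_i \<and> d\<gamma>_i\<close> (\<open>omega_eq_W\<close>), and the matrix \<open>T_i\<close> is the matrix of coefficients of
  \<open>\<gamma>_i^(-1)\<close> (\<open>matrix_inv_gamma_matrix\<close>). Closedness is \<open>d(\<gamma>^(-1)) = - \<gamma>^(-2) d\<gamma>\<close>; nondegeneracy comes from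
  that of \<open>Q\<close> between \<open>Bl\<close> and \<open>Bbar\<close>.

  For an invariant polynomial, constancy on adjoint orbits says that its gradient commutes with the
  point \<open>y\<close> (\<open>gradient_commutes\<close>). Splitting the gradient as \<open>X + N\<close> along \<open>Bbar + Nl\<close>, the vector
  \<open>[y, X] = - [y, N]\<close> has no component in \<open>Nbar\<close>, so it is the tangent vector of the orbit generated
  by \<open>- X\<close>, and its contraction with the form is the differential (\<open>hamiltonian_invariant\<close>).

  The structure theory behind this is derived from the given axioms. Simplicity and the normalization
  of the coroots make \<open>\<kappa>\<close> nondegenerate; \<open>\<hh>\<close> is abelian because \<open>ad H\<close> is both nilpotent and
  diagonalizable on it; a lowest weight argument shows that root spaces are lines
  (\<open>root_space_one_dimensional\<close>), and the height of a root decides on which side of the triangular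
  decomposition its vectors lie.
\<close>

section \<open>Eigenvectors of linear maps\<close>

lemma eigenvectors_sum_zero:
  fixes A :: "'v::real_vector \<Rightarrow> 'v"
  assumes "linear A" and "finite C"
    and "\<And>c. c \<in> C \<Longrightarrow> A (x c) = c *\<^sub>R x c" and "(\<Sum>c\<in>C. x c) = 0" and "c \<in> C"
  shows "x c = 0"
  using assms(2-5)
proof (induction C arbitrary: x c rule: finite_induct)
  case (insert d C)
  interpret A: linear A by (rule assms(1))
  have xd: "x d = - (\<Sum>c\<in>C. x c)"
    using insert by (simp add: eq_neg_iff_add_eq_0)
  have "A (\<Sum>c\<in>insert d C. x c) = (\<Sum>c\<in>insert d C. c *\<^sub>R x c)"
    unfolding A.sum using insert.prems by (intro sum.cong) auto
  then have "(\<Sum>c\<in>insert d C. (c - d) *\<^sub>R x c) = 0"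
    using insert.prems by (simp only: A.zero scaleR_left_diff_distrib sum_subtractf)
      (simp only: scaleR_sum_right[symmetric] scaleR_zero_right diff_zero)
  then have s: "(\<Sum>c\<in>C. (c - d) *\<^sub>R x c) = 0"
    using insert.hyps by simp
  have z: "x c = 0" if "c \<in> C" for c
  proof -
    have "(c - d) *\<^sub>R x c = 0"
      using insert.IH[of "\<lambda>c. (c - d) *\<^sub>R x c", OF _ s that] insert.prems
      by (simp add: A.scaleR)
    then show ?thesis using insert that by auto
  qed
  then have "x d = 0" using xd by simp
  then show ?case using z insert by auto
qed simp

text \<open>
  This is how finite dimension enters: a sequence of eigenvectors produced by a raising or lowering
  operator has pairwise distinct eigenvalues, so it must reach \<open>0\<close>.
\<close>

lemma eigenvectors_distinct_eigenvalues:
  fixes A :: "'v::euclidean_space \<Rightarrow> 'v"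
  assumes "linear A" and ev: "\<And>k::nat. A (x k) = \<mu> k *\<^sub>R x k" and "inj \<mu>"
  shows "\<exists>k. x k = 0"
proof (rule ccontr)
  assume "\<nexists>k. x k = 0"
  then have nz: "\<And>k. x k \<noteq> 0" by blast
  have injx: "inj x"
  proof (rule injI)
    fix j k assume eq: "x j = x k"
    then have "\<mu> j *\<^sub>R x k = \<mu> k *\<^sub>R x k" using ev by metis
    then show "j = k" using nz assms(3) by (auto dest: injD)
  qed
  define K where "K = {..DIM('v)}"
  have "independent (x ` K)"
  proof (rule independent_if_scalars_zero)
    show "finite (x ` K)" by (simp add: K_def)
    fix g v assume s: "(\<Sum>v\<in>x ` K. g v *\<^sub>R v) = 0" and v: "v \<in> x ` K"
    then obtain k where k: "k \<in> K" "v = x k" by auto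
    have s': "(\<Sum>k\<in>K. g (x k) *\<^sub>R x k) = 0"
      using s injx by (subst (asm) sum.reindex) (auto simp: inj_on_def)
    define y where "y c = g (x (inv \<mu> c)) *\<^sub>R x (inv \<mu> c)" for c
    have "(\<Sum>c\<in>\<mu> ` K. y c) = 0"
      using s' assms(3) by (subst sum.reindex) (auto simp: y_def inj_on_def)
    moreover have "A (y c) = c *\<^sub>R y c" if "c \<in> \<mu> ` K" for c
      using that assms(3) linear_scale[OF assms(1)] by (auto simp: y_def ev)
    ultimately have "y (\<mu> k) = 0"
      using eigenvectors_sum_zero[OF assms(1), of "\<mu> ` K" y "\<mu> k"] k by (simp add: K_def)
    then show "g v = 0" using k nz assms(3) by (simp add: y_def)
  qed
  then have "card (x ` K) \<le> DIM('v)" using independent_bound by blast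
  then show False using injx by (simp add: K_def card_image inj_on_subset)
qed

lemma eigenvector_decomposition:
  fixes A :: "'v::real_vector \<Rightarrow> 'v"
  assumes "linear A" and "y \<in> span {x. \<exists>c. A x = c *\<^sub>R x}"
  shows "\<exists>C z. finite C \<and> (\<forall>c. A (z c) = c *\<^sub>R z c) \<and> y = (\<Sum>c\<in>C. z c)"
  using assms(2)
proof (induction rule: span_induct_alt)
  case base
  show ?case by (rule exI[of _ "{}"], rule exI[of _ "\<lambda>_. 0"]) (simp add: linear_0[OF assms(1)])
next
  case (step a x y)
  obtain d where d: "A x = d *\<^sub>R x" using step by auto
  obtain C z where Cz: "finite C" "\<And>c. A (z c) = c *\<^sub>R z c" "y = (\<Sum>c\<in>C. z c)" using step by auto
  define z1 where "z1 c = (if c = d then a *\<^sub>R x else 0)" for c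
  define z2 where "z2 c = (if c \<in> C then z c else 0)" for c
  have "(\<Sum>c\<in>insert d C. z1 c + z2 c) = (\<Sum>c\<in>insert d C. z1 c) + (\<Sum>c\<in>insert d C. z2 c)"
    by (simp add: sum.distrib)
  also have "(\<Sum>c\<in>insert d C. z1 c) = a *\<^sub>R x"
    using Cz(1) by (simp add: z1_def)
  also have "(\<Sum>c\<in>insert d C. z2 c) = y"
    unfolding Cz(3) by (rule sum.mono_neutral_cong_right) (use Cz(1) in \<open>auto simp: z2_def\<close>)
  finally have "a *\<^sub>R x + y = (\<Sum>c\<in>insert d C. z1 c + z2 c)" by simp
  moreover have "A (z1 c + z2 c) = c *\<^sub>R (z1 c + z2 c)" for c
    using d Cz(2) linear_0[OF assms(1)]
    by (auto simp: z1_def z2_def linear_add[OF assms(1)] linear_scale[OF assms(1)] scaleR_add_right)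
  ultimately show ?case using Cz(1) by (intro exI[of _ "insert d C"] exI[of _ "\<lambda>c. z1 c + z2 c"]) auto
qed

text \<open>
  A joint eigenvector of \<open>\<A>\<close> splits into eigenvectors of a further map \<open>A\<close>. Each \<open>B \<in> \<A>\<close> preserves the
  eigenspaces of \<open>A\<close>, so the eigenvalue equation for \<open>B\<close> can be compared part by part, and the parts
  are eigenvectors of \<open>B\<close> as well.
\<close>

lemma joint_eigenvectors_span:
  fixes \<A> :: "('v::real_vector \<Rightarrow> 'v) set"
  assumes "finite \<A>" and "\<And>A. A \<in> \<A> \<Longrightarrow> linear A"
    and "\<And>A. A \<in> \<A> \<Longrightarrow> span {x. \<exists>c. A x = c *\<^sub>R x} = UNIV"
    and "\<And>A B x. A \<in> \<A> \<Longrightarrow> B \<in> \<A> \<Longrightarrow> A (B x) = B (A x)"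
  shows "span {x. \<forall>A\<in>\<A>. \<exists>c. A x = c *\<^sub>R x} = UNIV"
  using assms
proof (induction \<A> rule: finite_induct)
  case (insert A \<A>)
  let ?J = "{x. \<forall>B\<in>insert A \<A>. \<exists>c. B x = c *\<^sub>R x}"
  have linA: "linear A" using insert by blast
  have "x \<in> span ?J" if x: "\<forall>B\<in>\<A>. \<exists>c. B x = c *\<^sub>R x" for x
  proof -
    have "x \<in> span {x. \<exists>c. A x = c *\<^sub>R x}" using insert.prems(2)[of A] by simp
    then obtain C z where Cz: "finite C" "\<And>c. A (z c) = c *\<^sub>R z c" "x = (\<Sum>c\<in>C. z c)"
      using eigenvector_decomposition[OF linA] by blast
    have "z c \<in> ?J" if c: "c \<in> C" for c
    proof -
      have "\<exists>d. B (z c) = d *\<^sub>R z c" if B: "B \<in> \<A>" for B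
      proof -
        have linB: "linear B" using insert.prems(1)[of B] B by simp
        obtain d where d: "B x = d *\<^sub>R x" using x B by blast
        have comm: "A (B v) = B (A v)" for v using insert.prems(3)[of A B v] B by simp
        have sum0: "(\<Sum>c\<in>C. B (z c) - d *\<^sub>R z c) = 0"
          using d by (simp add: Cz(3) linear_sum[OF linB] sum_subtractf scaleR_sum_right)
        have "A (B (z c) - d *\<^sub>R z c) = c *\<^sub>R (B (z c) - d *\<^sub>R z c)" for c
          by (simp add: linear_diff[OF linA] linear_scale[OF linA] comm Cz(2) linear_scale[OF linB]
              scaleR_diff_right mult.commute)
        then have "B (z c) - d *\<^sub>R z c = 0"
          by (rule eigenvectors_sum_zero[OF linA Cz(1) _ sum0 c])
        then show ?thesis by auto
      qed
      then show ?thesis using Cz(2) by auto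
    qed
    then show ?thesis unfolding Cz(3) by (intro span_sum span_base) auto
  qed
  then have "{x. \<forall>B\<in>\<A>. \<exists>c. B x = c *\<^sub>R x} \<subseteq> span ?J" by blast
  then have "span {x. \<forall>B\<in>\<A>. \<exists>c. B x = c *\<^sub>R x} \<subseteq> span ?J" by (rule span_minimal) simp
  moreover have "span {x. \<forall>B\<in>\<A>. \<exists>c. B x = c *\<^sub>R x} = UNIV"
    by (rule insert.IH) (use insert.prems in blast)+
  ultimately show ?case by blast
qed simp

section \<open>The Killing form\<close>

lemma trace_commute:
  fixes A B :: "'v::euclidean_space \<Rightarrow> 'v"
  assumes "linear A" "linear B"
  shows "(\<Sum>b\<in>Basis. A (B b) \<bullet> b) = (\<Sum>b\<in>Basis. B (A b) \<bullet> b)"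
proof -
  have exp: "F (G b) \<bullet> b = (\<Sum>d\<in>Basis. (G b \<bullet> d) * (F d \<bullet> b))"
    if "linear F" for F G :: "'v \<Rightarrow> 'v" and b
  proof -
    have "F (G b) = F (\<Sum>d\<in>Basis. (G b \<bullet> d) *\<^sub>R d)" by (simp add: euclidean_representation)
    also have "\<dots> = (\<Sum>d\<in>Basis. (G b \<bullet> d) *\<^sub>R F d)"
      by (simp add: linear_sum[OF that] linear_scale[OF that])
    finally show ?thesis by (simp add: inner_sum_left)
  qed
  show ?thesis
    unfolding exp[OF assms(1), of B] exp[OF assms(2), of A]
    by (subst sum.swap) (simp add: mult.commute)
qed

locale lie_algebra =
  fixes br :: "'g::euclidean_space \<Rightarrow> 'g \<Rightarrow> 'g"
  assumes lie: "lie_bracket br"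
begin

lemma bilinear_br: "bilinear br" and br_self [simp]: "br x x = 0"
  and jacobi: "br x (br y z) + br y (br z x) + br z (br x y) = 0"
  using lie by (auto simp: lie_bracket_def)

lemmas br_simps = bilinear_ladd[OF bilinear_br] bilinear_radd[OF bilinear_br]
  bilinear_lmul[OF bilinear_br] bilinear_rmul[OF bilinear_br]
  bilinear_lneg[OF bilinear_br] bilinear_rneg[OF bilinear_br]
  bilinear_lsub[OF bilinear_br] bilinear_rsub[OF bilinear_br]
  bilinear_lzero[OF bilinear_br] bilinear_rzero[OF bilinear_br]

lemma linear_ad [intro]: "linear (br x)"
  using bilinear_br by (auto simp: bilinear_def)

lemma br_skew: "br x y = - br y x"
proof -
  have "br (x + y) (x + y) = 0" by (rule br_self)
  then have "br x y + br y x = 0"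
    by (simp only: br_simps br_self[of x] br_self[of y] add_0_left add_0_right add.commute)
  then show ?thesis by (simp add: eq_neg_iff_add_eq_0)
qed

lemma ad_br: "br (br x y) z = br x (br y z) - br y (br x z)"
  using jacobi[of x y z] br_skew[of z "br x y"] br_skew[of z x]
  by (simp add: br_simps algebra_simps)

lemma killing_sym: "killing br x y = killing br y x"
  unfolding killing_def by (rule trace_commute) auto

lemma killing_invariant: "killing br (br x y) z = killing br x (br y z)"
proof -
  have "killing br (br x y) z =
      (\<Sum>b\<in>Basis. br x (br y (br z b)) \<bullet> b) - (\<Sum>b\<in>Basis. br y (br x (br z b)) \<bullet> b)"
    by (simp add: killing_def ad_br inner_diff_left sum_subtractf)
  moreover have "killing br x (br y z) =
      (\<Sum>b\<in>Basis. br x (br y (br z b)) \<bullet> b) - (\<Sum>b\<in>Basis. br x (br z (br y b)) \<bullet> b)"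
    by (simp add: killing_def ad_br br_simps inner_diff_left sum_subtractf)
  moreover have "(\<Sum>b\<in>Basis. br y (br x (br z b)) \<bullet> b) = (\<Sum>b\<in>Basis. br x (br z (br y b)) \<bullet> b)"
    using trace_commute[OF linear_ad[of y] linear_compose[OF linear_ad[of z] linear_ad[of x]]] by simp
  ultimately show ?thesis by simp
qed

lemma linear_killing: "linear (killing br x)"
  by (rule linearI)
    (simp_all add: killing_def br_simps inner_add_left sum.distrib sum_distrib_left)

lemma killing_central:
  assumes "\<And>z. br x z = 0" shows "killing br x y = 0"
  by (simp add: killing_def assms)

end

section \<open>Root space decomposition of a split simple Lie algebra\<close>

text \<open>
  For a simple bracket a nonzero invariant form is nondegenerate, because its radical is an ideal. The
  last hypothesis, which follows from the normalization of the coroots, therefore takes the place of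
  Cartan's criterion. That the rank is not \<open>0\<close> is a consequence: a Cartan subalgebra \<open>{0}\<close> would be
  normalized by everything.
\<close>

locale split_simple_lie =
  fixes br :: "'g::euclidean_space \<Rightarrow> 'g \<Rightarrow> 'g" and \<kappa> :: "'g \<Rightarrow> 'g \<Rightarrow> real"
    and \<hh> :: "'g set" and n :: nat and \<alpha> :: "nat \<Rightarrow> 'g \<Rightarrow> real" and e :: "('g \<Rightarrow> real) \<Rightarrow> 'g"
  assumes simple: "simple_lie br"
    and kappa: "\<exists>q>0. \<forall>x y. \<kappa> x y = q * killing br x y"
    and cartan: "split_cartan br \<hh>"
    and rank: "n = dim \<hh>"
    and simple_roots: "simple_roots br \<hh> n \<alpha>"
    and root_vectors: "\<And>\<beta>. \<beta> \<in> roots br \<hh> \<Longrightarrow> e \<beta> \<in> root_space br \<hh> \<beta>"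
    and root_vectors_kappa: "\<And>\<beta> \<beta>'. \<beta> \<in> roots br \<hh> \<Longrightarrow> \<beta>' \<in> roots br \<hh> \<Longrightarrow>
          \<kappa> (e \<beta>) (e \<beta>') = (if \<beta> = neg_root \<beta>' then 1 else 0)"
    and kappa_nonzero: "n \<noteq> 0 \<Longrightarrow> \<exists>x y. \<kappa> x y \<noteq> 0"
begin

sublocale lie_algebra br
  using simple by unfold_locales (simp add: simple_lie_def)

lemma kappa_sym: "\<kappa> x y = \<kappa> y x"
  and kappa_invariant: "\<kappa> (br x y) z = \<kappa> x (br y z)"
  using kappa killing_sym[of x y] killing_invariant[of x y z] by auto

lemma linear_kappa: "linear (\<kappa> x)"
proof -
  obtain q where "\<And>x y. \<kappa> x y = q * killing br x y" using kappa by blast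
  then show ?thesis
    using linear_killing[of x] by (auto simp: linear_iff algebra_simps)
qed

lemma bilinear_kappa: "bilinear \<kappa>"
proof -
  have "(\<lambda>x. \<kappa> x y) = \<kappa> y" for y using kappa_sym by auto
  then show ?thesis by (simp add: bilinear_def linear_kappa)
qed

lemmas kappa_simps = bilinear_ladd[OF bilinear_kappa] bilinear_radd[OF bilinear_kappa]
  bilinear_lmul[OF bilinear_kappa] bilinear_rmul[OF bilinear_kappa]
  bilinear_lneg[OF bilinear_kappa] bilinear_rneg[OF bilinear_kappa]
  bilinear_lsub[OF bilinear_kappa] bilinear_rsub[OF bilinear_kappa]
  bilinear_lzero[OF bilinear_kappa] bilinear_rzero[OF bilinear_kappa]

lemma subspace_cartan: "subspace \<hh>"
  and normalizer_cartan: "(\<And>H. H \<in> \<hh> \<Longrightarrow> br x H \<in> \<hh>) \<Longrightarrow> x \<in> \<hh>"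
  and ad_cartan_diagonalizable: "H \<in> \<hh> \<Longrightarrow> span {x. \<exists>c. br H x = c *\<^sub>R x} = UNIV"
  using cartan unfolding split_cartan_def cartan_subalgebra_def by blast+

lemma rank_nonzero: "n \<noteq> 0"
proof
  assume "n = 0"
  then have h0: "\<hh> \<subseteq> {0}" using rank by (metis dim_eq_0)
  have "x = 0" for x :: 'g
  proof -
    have "br x H \<in> \<hh>" if "H \<in> \<hh>" for H
      using that h0 subspace_0[OF subspace_cartan] by (auto simp: br_simps)
    then show ?thesis using normalizer_cartan h0 by blast
  qed
  then have "br x y = 0" for x y by (metis bilinear_lzero[OF bilinear_br])
  then show False using simple by (auto simp: simple_lie_def)
qed

lemma kappa_nondegenerate:
  assumes "\<And>y. \<kappa> x y = 0" shows "x = 0"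
proof -
  let ?R = "{x. \<forall>y. \<kappa> x y = 0}"
  have "subspace ?R" by (auto simp: subspace_def kappa_simps)
  moreover have "br z x \<in> ?R" if "x \<in> ?R" for x z
    using that br_skew[of z x] by (auto simp: kappa_invariant kappa_simps)
  moreover have "?R \<noteq> UNIV" using kappa_nonzero[OF rank_nonzero] by auto
  ultimately have "?R = {0}" using simple unfolding simple_lie_def by blast
  then show ?thesis using assms by blast
qed

text \<open>
  On \<open>\<hh>\<close> the map \<open>ad H\<close> is both nilpotent and diagonalizable, hence zero.
\<close>

lemma cartan_abelian:
  assumes H: "H \<in> \<hh>" and H': "H' \<in> \<hh>" shows "br H H' = 0"
proof -
  obtain k where k: "lower_central br \<hh> k = {0}"
    using cartan unfolding split_cartan_def cartan_subalgebra_def by blast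
  have lc: "(br H ^^ j) H' \<in> lower_central br \<hh> j" for j
  proof (induction j)
    case (Suc j)
    show ?case using Suc H by (auto intro!: span_base)
  qed (simp add: H')
  have nil: "(br H ^^ k) H' = 0" using lc[of k] k by simp
  have "H' \<in> span {x. \<exists>c. br H x = c *\<^sub>R x}" using ad_cartan_diagonalizable[OF H] by simp
  then obtain C z where Cz: "finite C" "\<And>c. br H (z c) = c *\<^sub>R z c" "H' = (\<Sum>c\<in>C. z c)"
    using eigenvector_decomposition[OF linear_ad] by blast
  have pow: "(br H ^^ j) (\<Sum>c\<in>C. z c) = (\<Sum>c\<in>C. c ^ j *\<^sub>R z c)" for j
    by (induction j) (simp_all add: linear_sum[OF linear_ad] Cz(2) br_simps mult.commute)
  have "c ^ k *\<^sub>R z c = 0" if "c \<in> C" for c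
  proof (rule eigenvectors_sum_zero[OF linear_ad[of H] Cz(1) _ _ that])
    show "(\<Sum>c\<in>C. c ^ k *\<^sub>R z c) = 0" using nil pow[of k] Cz(3) by simp
  qed (simp add: br_simps Cz(2))
  then have "c *\<^sub>R z c = 0" if "c \<in> C" for c using that by fastforce
  then have "(\<Sum>c\<in>C. c *\<^sub>R z c) = 0" by (intro sum.neutral) blast
  then show ?thesis using pow[of 1] Cz(3) by simp
qed

lemma centralizer_cartan:
  assumes "\<And>H. H \<in> \<hh> \<Longrightarrow> br H x = 0" shows "x \<in> \<hh>"
proof (rule normalizer_cartan)
  fix H assume "H \<in> \<hh>"
  then show "br x H \<in> \<hh>" using assms br_skew[of x H] subspace_0[OF subspace_cartan] by simp
qed

abbreviation weight_space :: "('g \<Rightarrow> real) \<Rightarrow> 'g set" where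
  "weight_space \<equiv> root_space br \<hh>"

lemma weight_spaceD: "x \<in> weight_space \<beta> \<Longrightarrow> H \<in> \<hh> \<Longrightarrow> br H x = \<beta> H *\<^sub>R x"
  by (simp add: root_space_def)

lemma weight_space_zero: "x \<in> weight_space \<beta> \<Longrightarrow> (\<And>H. H \<in> \<hh> \<Longrightarrow> \<beta> H = 0) \<Longrightarrow> x \<in> \<hh>"
  by (rule centralizer_cartan) (simp add: root_space_def)

lemma cartan_weight: "x \<in> \<hh> \<Longrightarrow> x \<in> weight_space (\<lambda>_. 0)"
  by (simp add: root_space_def cartan_abelian)

lemma weight_space_br:
  assumes "x \<in> weight_space \<beta>" "y \<in> weight_space \<delta>"
  shows "br x y \<in> weight_space (\<lambda>H. \<beta> H + \<delta> H)"
proof -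
  have "br H (br x y) = (\<beta> H + \<delta> H) *\<^sub>R br x y" if "H \<in> \<hh>" for H
    using ad_br[of H x y] weight_spaceD[OF assms(1) that] weight_spaceD[OF assms(2) that]
    by (simp add: br_simps algebra_simps)
  then show ?thesis by (simp add: root_space_def)
qed

lemma weight_space_root:
  assumes "x \<in> weight_space \<beta>" "x \<noteq> 0" "H \<in> \<hh>" "\<beta> H \<noteq> 0"
  shows "(\<lambda>H. if H \<in> \<hh> then \<beta> H else 0) \<in> roots br \<hh>"
proof -
  have "x \<in> weight_space (\<lambda>H. if H \<in> \<hh> then \<beta> H else 0)"
    using assms(1) by (simp add: root_space_def)
  then show ?thesis using assms by (auto simp: roots_def)
qed

text \<open>
  The condition to be an eigenvector of \<open>ad H\<close> is linear in \<open>H\<close>, so it suffices to diagonalize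
  \<open>ad H\<close> simultaneously for the finitely many \<open>H\<close> in a basis of \<open>\<hh>\<close>.
\<close>

lemma weight_vectors_span: "span {x. \<exists>\<beta>. x \<in> weight_space \<beta>} = UNIV"
proof -
  obtain B where B: "B \<subseteq> \<hh>" "independent B" "\<hh> \<subseteq> span B" by (rule basis_exists[of "\<hh>"])
  have fin: "finite B" using B(2) by (rule independent_imp_finite)
  have "span {x. \<forall>A\<in>br ` B. \<exists>c. A x = c *\<^sub>R x} = UNIV"
  proof (rule joint_eigenvectors_span)
    fix A A' x assume "A \<in> br ` B" "A' \<in> br ` B"
    then obtain H H' where H: "H \<in> \<hh>" "H' \<in> \<hh>" "A = br H" "A' = br H'" using B(1) by auto
    show "A (A' x) = A' (A x)"
      using ad_br[of H H' x] cartan_abelian[OF H(1,2)] H by (simp add: br_simps)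
  next
    fix A assume "A \<in> br ` B"
    then obtain H where H: "H \<in> \<hh>" "A = br H" using B(1) by auto
    show "linear A" unfolding H(2) by (rule linear_ad)
    show "span {x. \<exists>c. A x = c *\<^sub>R x} = UNIV" unfolding H(2) by (rule ad_cartan_diagonalizable[OF H(1)])
  qed (simp add: fin)
  moreover have "{x. \<forall>A\<in>br ` B. \<exists>c. A x = c *\<^sub>R x} \<subseteq> {x. \<exists>\<beta>. x \<in> weight_space \<beta>}"
  proof safe
    fix x assume x: "\<forall>A\<in>br ` B. \<exists>c. A x = c *\<^sub>R x"
    have "subspace {H. \<exists>c. br H x = c *\<^sub>R x}"
      unfolding subspace_def by (auto simp: br_simps; metis scaleR_zero_left scaleR_add_left scaleR_scaleR)
    then have "span B \<subseteq> {H. \<exists>c. br H x = c *\<^sub>R x}" using x by (intro span_minimal) auto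
    then have "\<forall>H\<in>\<hh>. \<exists>c. br H x = c *\<^sub>R x" using B(3) by blast
    then obtain \<beta> where "\<forall>H\<in>\<hh>. br H x = \<beta> H *\<^sub>R x" by metis
    then show "\<exists>\<beta>. x \<in> weight_space \<beta>" by (auto simp: root_space_def)
  qed
  ultimately show ?thesis using span_mono by blast
qed

lemma kappa_weight_orthogonal:
  assumes "x \<in> weight_space \<beta>" "y \<in> weight_space \<delta>" "H \<in> \<hh>" "\<beta> H + \<delta> H \<noteq> 0"
  shows "\<kappa> x y = 0"
proof -
  have "\<kappa> (br x H) y = \<kappa> x (br H y)" by (rule kappa_invariant)
  then have "(\<beta> H + \<delta> H) * \<kappa> x y = 0"
    using br_skew[of x H] weight_spaceD[OF assms(1,3)] weight_spaceD[OF assms(2,3)]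
    by (simp add: kappa_simps algebra_simps)
  then show ?thesis using assms by simp
qed

lemma kappa_eq_zero_if_span:
  assumes "span S = UNIV" "\<And>y. y \<in> S \<Longrightarrow> \<kappa> x y = 0" shows "x = 0"
proof (rule kappa_nondegenerate)
  fix y
  have "subspace {y. \<kappa> x y = 0}" by (auto simp: subspace_def kappa_simps)
  then have "span S \<subseteq> {y. \<kappa> x y = 0}" using assms(2) by (intro span_minimal) auto
  then show "\<kappa> x y = 0" using assms(1) by blast
qed

lemma cartan_kappa_nondegenerate:
  assumes H: "H \<in> \<hh>" and orth: "\<And>H'. H' \<in> \<hh> \<Longrightarrow> \<kappa> H H' = 0" shows "H = 0"
proof (rule kappa_eq_zero_if_span[OF weight_vectors_span], safe)
  fix y \<beta> assume y: "y \<in> weight_space \<beta>"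
  show "\<kappa> H y = 0"
  proof (cases "\<forall>H\<in>\<hh>. \<beta> H = 0")
    case True
    then show ?thesis using orth weight_space_zero[OF y] by blast
  next
    case False
    then obtain H0 where "H0 \<in> \<hh>" "\<beta> H0 \<noteq> 0" by blast
    then show ?thesis using kappa_weight_orthogonal[OF cartan_weight[OF H] y] by simp
  qed
qed

lemma rootsD:
  assumes "\<beta> \<in> roots br \<hh>"
  shows "x \<notin> \<hh> \<Longrightarrow> \<beta> x = 0" "\<exists>H\<in>\<hh>. \<beta> H \<noteq> 0"
  using assms by (auto simp: roots_def)

text \<open>
  By nondegeneracy a root vector pairs nontrivially with some weight vector, and invariance leaves only
  the opposite weight.
\<close>

lemma neg_root_root:
  assumes \<beta>: "\<beta> \<in> roots br \<hh>" shows "neg_root \<beta> \<in> roots br \<hh>"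
proof -
  have "0 \<in> weight_space \<beta>" by (simp add: root_space_def br_simps)
  then obtain x where x: "x \<in> weight_space \<beta>" "x \<noteq> 0" using \<beta> by (auto simp: roots_def)
  obtain y \<delta> where y: "y \<in> weight_space \<delta>" "\<kappa> x y \<noteq> 0"
    using kappa_eq_zero_if_span[OF weight_vectors_span, of x] x(2) by blast
  have "\<delta> H = - \<beta> H" if "H \<in> \<hh>" for H
    using kappa_weight_orthogonal[OF x(1) y(1) that] y(2) by linarith
  then have "y \<in> weight_space (neg_root \<beta>)"
    using y(1) by (simp add: root_space_def neg_root_def)
  moreover have "y \<noteq> 0" using y(2) by (auto simp: kappa_simps)
  ultimately show ?thesis using \<beta> by (auto simp: roots_def neg_root_def)
qed

lemma neg_root_neg_root [simp]: "neg_root (neg_root \<beta>) = \<beta>"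
  by (simp add: neg_root_def)

lemma kappa_root_vector: "\<beta> \<in> roots br \<hh> \<Longrightarrow> \<kappa> (e \<beta>) (e (neg_root \<beta>)) = 1"
  by (simp add: root_vectors_kappa neg_root_root)

definition coroot :: "('g \<Rightarrow> real) \<Rightarrow> 'g" where
  "coroot \<beta> = br (e \<beta>) (e (neg_root \<beta>))"

lemma coroot_cartan: "\<beta> \<in> roots br \<hh> \<Longrightarrow> coroot \<beta> \<in> \<hh>"
  unfolding coroot_def
  by (rule weight_space_zero[OF weight_space_br[OF root_vectors root_vectors[OF neg_root_root]]])
     (auto simp: neg_root_def)

lemma kappa_coroot: "\<beta> \<in> roots br \<hh> \<Longrightarrow> H \<in> \<hh> \<Longrightarrow> \<kappa> (coroot \<beta>) H = \<beta> H"
proof -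
  assume \<beta>: "\<beta> \<in> roots br \<hh>" and H: "H \<in> \<hh>"
  have "\<kappa> (coroot \<beta>) H = \<kappa> (e \<beta>) (br (e (neg_root \<beta>)) H)"
    by (simp add: coroot_def kappa_invariant)
  also have "br (e (neg_root \<beta>)) H = \<beta> H *\<^sub>R e (neg_root \<beta>)"
    using br_skew[of "e (neg_root \<beta>)" H] weight_spaceD[OF root_vectors[OF neg_root_root[OF \<beta>]] H]
    by (simp add: neg_root_def)
  finally show ?thesis using kappa_root_vector[OF \<beta>] by (simp add: kappa_simps)
qed

lemma ad_power_weight:
  assumes "x \<in> weight_space \<beta>" "y \<in> weight_space \<delta>"
  shows "(br x ^^ k) y \<in> weight_space (\<lambda>H. real k * \<beta> H + \<delta> H)"
proof (induction k)
  case (Suc k)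
  show ?case using weight_space_br[OF assms(1) Suc] by (simp add: algebra_simps)
qed (simp add: assms)

lemma ad_power_eventually_zero:
  assumes "x \<in> weight_space \<beta>" "y \<in> weight_space \<delta>" and H: "H \<in> \<hh>" "\<beta> H \<noteq> 0"
  shows "\<exists>k. (br x ^^ k) y = 0"
proof (rule eigenvectors_distinct_eigenvalues[OF linear_ad[of H]])
  show "br H ((br x ^^ k) y) = (real k * \<beta> H + \<delta> H) *\<^sub>R (br x ^^ k) y" for k
    using weight_spaceD[OF ad_power_weight[OF assms(1,2)] H(1)] .
  show "inj (\<lambda>k. real k * \<beta> H + \<delta> H)" using H(2) by (auto simp: inj_on_def)
qed

text \<open>
  The representation theory of rank one in the form needed here. If \<open>E'\<close> kills \<open>x\<close>, then
  \<open>E' (E^(k+1) x)\<close> is a multiple of \<open>E^k x\<close> with the coefficient of the last hypothesis. If none of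
  these coefficients vanishes, all \<open>E^k x\<close> are nonzero, which finite dimension forbids. The case
  \<open>c = 0\<close> concerns a Heisenberg triple, the case \<open>c = d\<close> an \<open>sl_2\<close> triple acting on a second vector of
  the same weight as \<open>E\<close>.
\<close>

lemma lowest_weight_vector_zero:
  assumes E: "E \<in> weight_space \<beta>" and Tdef: "br E' E = - T"
    and TE: "br T E = c *\<^sub>R E" and H: "H \<in> \<hh>" "\<beta> H \<noteq> 0"
    and x: "x \<in> weight_space \<delta>" "br E' x = 0" "br T x = d *\<^sub>R x"
    and nz: "\<And>k. real (Suc k) * d + c * (real (Suc k) * real k / 2) \<noteq> 0"
  shows "x = 0"
proof (rule ccontr)
  assume "x \<noteq> 0"
  have T: "br T ((br E ^^ k) x) = (d + real k * c) *\<^sub>R (br E ^^ k) x" for k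
  proof (induction k)
    case (Suc k)
    have "br T ((br E ^^ Suc k) x) = br (br T E) ((br E ^^ k) x) + br E (br T ((br E ^^ k) x))"
      using ad_br[of T E "(br E ^^ k) x"] by simp
    also have "\<dots> = (d + real (Suc k) * c) *\<^sub>R (br E ^^ Suc k) x"
      unfolding TE Suc by (simp add: br_simps algebra_simps)
    finally show ?case .
  qed (simp add: x(3))
  have low: "br E' ((br E ^^ Suc k) x) =
      - (real (Suc k) * d + c * (real (Suc k) * real k / 2)) *\<^sub>R (br E ^^ k) x" for k
  proof (induction k)
    case 0
    show ?case using ad_br[of E' E x] Tdef x by (simp add: br_simps)
  next
    case (Suc k)
    have "br E' ((br E ^^ Suc (Suc k)) x) =
        - br T ((br E ^^ Suc k) x) + br E (br E' ((br E ^^ Suc k) x))"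
      using ad_br[of E' E "(br E ^^ Suc k) x"] Tdef by (simp add: br_simps algebra_simps)
    also have "\<dots> = - ((d + real (Suc k) * c) +
        (real (Suc k) * d + c * (real (Suc k) * real k / 2))) *\<^sub>R (br E ^^ Suc k) x"
    proof -
      have "- (a *\<^sub>R z) + (- b) *\<^sub>R z = - (a + b) *\<^sub>R z" for a b :: real and z :: 'g
        by (simp add: algebra_simps)
      then show ?thesis unfolding T Suc by (simp only: br_simps funpow.simps o_apply)
    qed
    also have "(d + real (Suc k) * c) + (real (Suc k) * d + c * (real (Suc k) * real k / 2))
        = real (Suc (Suc k)) * d + c * (real (Suc (Suc k)) * real (Suc k) / 2)"
      by (simp add: field_simps)
    finally show ?case .
  qed
  have "(br E ^^ k) x \<noteq> 0" for k
  proof (induction k)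
    case (Suc k)
    then have "br E' ((br E ^^ Suc k) x) \<noteq> 0" unfolding low using nz[of k] by simp
    then show ?case by (metis bilinear_rzero[OF bilinear_br])
  qed (simp add: \<open>x \<noteq> 0\<close>)
  then show False using ad_power_eventually_zero[OF E x(1) H] by blast
qed

lemma coroot_ad:
  assumes "\<beta> \<in> roots br \<hh>" "x \<in> weight_space \<delta>"
  shows "br (coroot \<beta>) x = \<delta> (coroot \<beta>) *\<^sub>R x"
  by (rule weight_spaceD[OF assms(2) coroot_cartan[OF assms(1)]])

text \<open>
  Otherwise \<open>e \<beta>\<close>, \<open>e (- \<beta>)\<close> and the coroot \<open>T\<close> satisfy the Heisenberg relations. On a weight vector
  on which \<open>T\<close> acts by a nonzero scalar, lowering as far as possible gives a lowest weight vector and a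
  contradiction. So \<open>T\<close> acts as \<open>0\<close> on all of them and is central, hence orthogonal to everything,
  although \<open>\<kappa> T H = \<beta> H\<close> is nonzero for some \<open>H\<close>.
\<close>

lemma root_coroot_nonzero:
  assumes \<beta>: "\<beta> \<in> roots br \<hh>" shows "\<beta> (coroot \<beta>) \<noteq> 0"
proof
  assume iso: "\<beta> (coroot \<beta>) = 0"
  let ?E = "e \<beta>" and ?F = "e (neg_root \<beta>)" and ?T = "coroot \<beta>"
  obtain H where H: "H \<in> \<hh>" "\<beta> H \<noteq> 0" using rootsD[OF \<beta>] by blast
  note E = root_vectors[OF \<beta>] and F = root_vectors[OF neg_root_root[OF \<beta>]]
  have FE: "br ?F ?E = - ?T" by (simp add: coroot_def br_skew[of ?F ?E])
  have TE: "br ?T ?E = 0 *\<^sub>R ?E" using coroot_ad[OF \<beta> E] iso by simp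
  have weights: "\<delta> ?T *\<^sub>R x = 0" if x: "x \<in> weight_space \<delta>" for \<delta> x
  proof (rule ccontr)
    assume nz: "\<delta> ?T *\<^sub>R x \<noteq> 0"
    have "\<exists>k. (br ?F ^^ k) x = 0"
      by (rule ad_power_eventually_zero[OF F x H(1)]) (simp add: neg_root_def H)
    \<comment> \<open>The last nonzero vector of the lowering chain is a lowest weight vector; T still acts on it by the
      same scalar because the root vanishes at T.\<close>
    define m where "m = (LEAST k. (br ?F ^^ k) x = 0)"
    have m0: "(br ?F ^^ m) x = 0" unfolding m_def by (rule LeastI_ex) fact
    have "m \<noteq> 0" using m0 nz by (intro notI) simp
    then obtain k where k: "m = Suc k" by (cases m) auto
    have k0: "(br ?F ^^ k) x \<noteq> 0" using not_less_Least[of k "\<lambda>k. (br ?F ^^ k) x = 0"] k by (simp add: m_def)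
    let ?y = "(br ?F ^^ k) x"
    have y: "?y \<in> weight_space (\<lambda>H. real k * neg_root \<beta> H + \<delta> H)"
      by (rule ad_power_weight[OF F x])
    have Ty: "br ?T ?y = \<delta> ?T *\<^sub>R ?y" using coroot_ad[OF \<beta> y] iso by (simp add: neg_root_def)
    have "?y = 0"
    proof (rule lowest_weight_vector_zero[OF E FE TE H y _ Ty])
      show "br ?F ?y = 0" using m0 k by simp
    qed (use nz in \<open>simp add: add_nonneg_eq_0_iff del: of_nat_Suc\<close>)
    then show False using k0 by simp
  qed
  have "br ?T y = 0" for y
  proof -
    have "subspace {y. br ?T y = 0}" by (auto simp: subspace_def br_simps)
    moreover have "{x. \<exists>\<beta>. x \<in> weight_space \<beta>} \<subseteq> {y. br ?T y = 0}"
      using weights coroot_ad[OF \<beta>] by auto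
    ultimately show ?thesis using span_minimal weight_vectors_span by blast
  qed
  then have "\<kappa> ?T H = 0" using kappa killing_central by (metis mult_zero_right)
  then show False using kappa_coroot[OF \<beta> H(1)] H(2) by simp
qed

text \<open>
  The part \<open>y\<close> of \<open>x\<close> orthogonal to \<open>e (- \<beta>)\<close> is killed by \<open>e (- \<beta>)\<close>: the bracket lies in \<open>\<hh>\<close> and is
  orthogonal to \<open>\<hh>\<close>. So \<open>y\<close> is a lowest weight vector whose weight under the coroot is that of a
  raising operator, which forces \<open>y = 0\<close>.
\<close>

lemma root_space_one_dimensional:
  assumes \<beta>: "\<beta> \<in> roots br \<hh>" and x: "x \<in> weight_space \<beta>"
  shows "x = \<kappa> x (e (neg_root \<beta>)) *\<^sub>R e \<beta>"
proof -
  let ?E = "e \<beta>" and ?F = "e (neg_root \<beta>)" and ?T = "coroot \<beta>"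
  obtain H where H: "H \<in> \<hh>" "\<beta> H \<noteq> 0" using rootsD[OF \<beta>] by blast
  note E = root_vectors[OF \<beta>] and F = root_vectors[OF neg_root_root[OF \<beta>]]
  define y where "y = x - \<kappa> x ?F *\<^sub>R ?E"
  have y: "y \<in> weight_space \<beta>"
    using x E by (auto simp: y_def root_space_def br_simps algebra_simps)
  have yF: "\<kappa> y ?F = 0" using kappa_root_vector[OF \<beta>] by (simp add: y_def kappa_simps)
  have "br ?F y = 0"
  proof (rule cartan_kappa_nondegenerate)
    show "br ?F y \<in> \<hh>"
      by (rule weight_space_zero[OF weight_space_br[OF F y]]) (simp add: neg_root_def)
    fix H' assume H': "H' \<in> \<hh>"
    have "\<kappa> (br ?F y) H' = \<kappa> ?F (br y H')" by (rule kappa_invariant)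
    also have "br y H' = - (\<beta> H' *\<^sub>R y)" using br_skew[of y H'] weight_spaceD[OF y H'] by simp
    finally show "\<kappa> (br ?F y) H' = 0" using yF kappa_sym[of ?F y] by (simp add: kappa_simps)
  qed
  have FE: "br ?F ?E = - ?T" by (simp add: coroot_def br_skew[of ?F ?E])
  have "y = 0"
  proof (rule lowest_weight_vector_zero[OF E FE coroot_ad[OF \<beta> E] H y \<open>br ?F y = 0\<close> coroot_ad[OF \<beta> y]])
    fix k
    have "real (Suc k) * \<beta> ?T + \<beta> ?T * (real (Suc k) * real k / 2)
        = \<beta> ?T * (real (Suc k) * (1 + real k / 2))" by (simp add: algebra_simps)
    moreover have "real (Suc k) * (1 + real k / 2) > 0" by (intro mult_pos_pos) (auto simp: add_pos_nonneg)
    ultimately show "real (Suc k) * \<beta> ?T + \<beta> ?T * (real (Suc k) * real k / 2) \<noteq> 0"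
      using root_coroot_nonzero[OF \<beta>] by simp
  qed
  then show ?thesis by (simp add: y_def)
qed

end

section \<open>Triangular decomposition\<close>

context split_simple_lie
begin

lemma simple_root: "i \<in> {1..n} \<Longrightarrow> \<alpha> i \<in> roots br \<hh>"
  using simple_roots by (simp add: simple_roots_def)

lemma simple_roots_independent:
  "(\<And>H. H \<in> \<hh> \<Longrightarrow> (\<Sum>i=1..n. c i * \<alpha> i H) = 0) \<Longrightarrow> i \<in> {1..n} \<Longrightarrow> c i = 0"
  using simple_roots unfolding simple_roots_def by blast

lemma root_sign:
  "\<beta> \<in> roots br \<hh> \<Longrightarrow> nonneg_combination \<hh> n \<alpha> \<beta> \<or> nonneg_combination \<hh> n \<alpha> (neg_root \<beta>)"
  using simple_roots by (simp add: simple_roots_def)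

abbreviation simple_coroot :: "nat \<Rightarrow> 'g" where "simple_coroot i \<equiv> coroot (\<alpha> i)"

lemma simple_coroot_cartan: "i \<in> {1..n} \<Longrightarrow> simple_coroot i \<in> \<hh>"
  and kappa_simple_coroot: "i \<in> {1..n} \<Longrightarrow> H \<in> \<hh> \<Longrightarrow> \<kappa> (simple_coroot i) H = \<alpha> i H"
  using simple_root by (simp_all add: coroot_cartan kappa_coroot)

lemma simple_coroots_scalars_zero:
  assumes "(\<Sum>i=1..n. c i *\<^sub>R simple_coroot i) = 0" "i \<in> {1..n}" shows "c i = 0"
proof (rule simple_roots_independent[OF _ assms(2)])
  fix H assume H: "H \<in> \<hh>"
  have "(\<Sum>i=1..n. c i * \<alpha> i H) = \<kappa> (\<Sum>i=1..n. c i *\<^sub>R simple_coroot i) H"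
    using H by (simp add: kappa_sym[of _ H] linear_sum[OF linear_kappa] kappa_simps
        kappa_simple_coroot[OF _ H, symmetric])
  then show "(\<Sum>i=1..n. c i * \<alpha> i H) = 0" using assms(1) by (simp add: kappa_simps)
qed

lemma simple_coroots_inj: "inj_on simple_coroot {1..n}"
proof (rule inj_onI, rule ccontr)
  fix i j assume ij: "i \<in> {1..n}" "j \<in> {1..n}" "simple_coroot i = simple_coroot j" "i \<noteq> j"
  \<comment> \<open>A coincidence would be a linear relation.\<close>
  let ?c = "\<lambda>k. if k = i then 1 else if k = j then - 1 else (0::real)"
  have "(\<Sum>k=1..n. ?c k *\<^sub>R simple_coroot k) = (\<Sum>k\<in>{i, j}. ?c k *\<^sub>R simple_coroot k)"
    using ij by (intro sum.mono_neutral_right) auto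
  also have "\<dots> = 0" using ij by simp
  finally show False using simple_coroots_scalars_zero[of ?c i] ij(1) by simp
qed

lemma simple_coroots_span: "span (simple_coroot ` {1..n}) = \<hh>"
proof -
  have "independent (simple_coroot ` {1..n})"
  proof (rule independent_if_scalars_zero)
    fix g v assume s: "(\<Sum>v\<in>simple_coroot ` {1..n}. g v *\<^sub>R v) = 0" and v: "v \<in> simple_coroot ` {1..n}"
    then obtain i where i: "i \<in> {1..n}" "v = simple_coroot i" by auto
    have "(\<Sum>i=1..n. g (simple_coroot i) *\<^sub>R simple_coroot i) = 0"
      using s by (simp only: sum.reindex[OF simple_coroots_inj] o_def)
    then show "g v = 0" using simple_coroots_scalars_zero[of "\<lambda>i. g (simple_coroot i)" i] i by simp
  qed simp
  moreover have "simple_coroot ` {1..n} \<subseteq> \<hh>" using simple_coroot_cartan by auto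
  moreover have "dim \<hh> \<le> card (simple_coroot ` {1..n})"
    using simple_coroots_inj rank by (simp add: card_image)
  ultimately have "\<hh> \<subseteq> span (simple_coroot ` {1..n})"
    by (intro card_ge_dim_independent) auto
  then show ?thesis
    using span_minimal[OF \<open>simple_coroot ` {1..n} \<subseteq> \<hh>\<close> subspace_cartan] by blast
qed

text \<open>
  The endomorphism \<open>\<Phi>\<close> of \<open>\<hh>\<close> is injective since the simple coroots span \<open>\<hh>\<close> and the form is
  nondegenerate there. A preimage of a simple coroot under \<open>\<Phi>\<close> is the required dual basis vector.
\<close>

lemma fundamental_coweights_exist:
  "\<exists>w. \<forall>i\<in>{1..n}. w i \<in> \<hh> \<and> (\<forall>j\<in>{1..n}. \<alpha> j (w i) = (if i = j then 1 else 0))"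
proof -
  define \<Phi> where "\<Phi> H = (\<Sum>j=1..n. \<kappa> (simple_coroot j) H *\<^sub>R simple_coroot j)" for H
  have lin: "linear \<Phi>"
    by (rule linearI) (simp_all add: \<Phi>_def kappa_simps sum.distrib scaleR_add_left scaleR_sum_right)
  have sub: "\<Phi> ` \<hh> \<subseteq> \<hh>"
    unfolding \<Phi>_def using simple_coroot_cartan
    by (auto intro!: subspace_sum subspace_scale subspace_cartan)
  have inj: "inj_on \<Phi> \<hh>"
  proof (rule linear_inj_on_iff_eq_0[OF lin subspace_cartan, THEN iffD2], safe)
    fix H assume H: "H \<in> \<hh>" "\<Phi> H = 0"
    have c0: "\<kappa> H (simple_coroot j) = 0" if "j \<in> {1..n}" for j
      using simple_coroots_scalars_zero[of "\<lambda>j. \<kappa> (simple_coroot j) H" j] H(2) that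
      by (simp add: \<Phi>_def kappa_sym[of H])
    have "subspace {y. \<kappa> H y = 0}" by (auto simp: subspace_def kappa_simps)
    then have "span (simple_coroot ` {1..n}) \<subseteq> {y. \<kappa> H y = 0}"
      using c0 by (intro span_minimal) auto
    then have "\<hh> \<subseteq> {y. \<kappa> H y = 0}" by (simp only: simple_coroots_span)
    then show "H = 0" using cartan_kappa_nondegenerate[OF H(1)] by blast
  qed
  have "dim (\<Phi> ` \<hh>) = dim \<hh>"
    by (rule dim_image_eq[OF lin]) (use inj subspace_cartan in \<open>simp add: span_eq_iff[THEN iffD2]\<close>)
  then have surj: "\<Phi> ` \<hh> = \<hh>"
    by (intro subspace_dim_equal linear_subspace_image[OF lin] subspace_cartan sub) simp
  have "\<exists>w. w \<in> \<hh> \<and> (\<forall>j\<in>{1..n}. \<alpha> j w = (if i = j then 1 else 0))" if i: "i \<in> {1..n}" for i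
  proof -
    have "simple_coroot i \<in> \<Phi> ` \<hh>" by (simp only: surj simple_coroot_cartan[OF i])
    then obtain w where w: "w \<in> \<hh>" "\<Phi> w = simple_coroot i" by (metis imageE)
    have "(\<Sum>j=1..n. (\<kappa> (simple_coroot j) w - (if i = j then 1 else 0)) *\<^sub>R simple_coroot j)
        = \<Phi> w - (\<Sum>j=1..n. (if i = j then 1 else 0) *\<^sub>R simple_coroot j)"
      by (simp add: \<Phi>_def scaleR_left_diff_distrib sum_subtractf)
    also have "(\<Sum>j=1..n. (if i = j then 1 else 0) *\<^sub>R simple_coroot j) = simple_coroot i"
      using i by (simp add: if_distrib[of "\<lambda>c. c *\<^sub>R _"] sum.delta cong: if_cong)
    finally have "(\<Sum>j=1..n. (\<kappa> (simple_coroot j) w - (if i = j then 1 else 0)) *\<^sub>R simple_coroot j) = 0"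
      using w(2) by simp
    then have "\<alpha> j w = (if i = j then 1 else 0)" if "j \<in> {1..n}" for j
      using simple_coroots_scalars_zero[of "\<lambda>j. \<kappa> (simple_coroot j) w - (if i = j then 1 else 0)" j]
        that kappa_simple_coroot[OF that w(1)] by simp
    then show ?thesis using w(1) by blast
  qed
  then show ?thesis by metis
qed

definition coweight :: "nat \<Rightarrow> 'g" where
  "coweight = (SOME w. \<forall>i\<in>{1..n}. w i \<in> \<hh> \<and> (\<forall>j\<in>{1..n}. \<alpha> j (w i) = (if i = j then 1 else 0)))"

lemma coweight_cartan: "i \<in> {1..n} \<Longrightarrow> coweight i \<in> \<hh>"
  and simple_root_coweight:
    "i \<in> {1..n} \<Longrightarrow> j \<in> {1..n} \<Longrightarrow> \<alpha> j (coweight i) = (if i = j then 1 else 0)"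
  using someI_ex[OF fundamental_coweights_exist] unfolding coweight_def by blast+

text \<open>
  Evaluating a root at this element gives its height.
\<close>

definition grading_element :: 'g where "grading_element = (\<Sum>i=1..n. coweight i)"

lemma grading_element_cartan: "grading_element \<in> \<hh>"
  unfolding grading_element_def by (intro subspace_sum subspace_cartan coweight_cartan)

lemma simple_root_grading: "i \<in> {1..n} \<Longrightarrow> \<alpha> i grading_element = 1"
proof -
  assume i: "i \<in> {1..n}"
  have "\<alpha> i grading_element = \<kappa> (simple_coroot i) grading_element"
    using kappa_simple_coroot[OF i grading_element_cartan] by simp
  also have "\<dots> = (\<Sum>j=1..n. \<alpha> i (coweight j))"
    unfolding grading_element_def linear_sum[OF linear_kappa]
    by (rule sum.cong) (auto simp: kappa_simple_coroot[OF i coweight_cartan])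
  also have "\<dots> = 1" using i by (simp add: simple_root_coweight)
  finally show ?thesis .
qed

lemma nonneg_combination_height:
  assumes "\<beta> \<in> roots br \<hh>" "nonneg_combination \<hh> n \<alpha> \<beta>"
  shows "\<beta> grading_element \<ge> 1"
proof -
  obtain m :: "nat \<Rightarrow> nat" where m: "\<And>H. H \<in> \<hh> \<Longrightarrow> \<beta> H = (\<Sum>i=1..n. real (m i) * \<alpha> i H)"
    using assms(2) unfolding nonneg_combination_def by blast
  have ht: "\<beta> grading_element = real (\<Sum>i=1..n. m i)"
    using m[OF grading_element_cartan] by (simp add: simple_root_grading)
  have "(\<Sum>i=1..n. m i) \<noteq> 0"
  proof
    assume "(\<Sum>i=1..n. m i) = 0"
    then have "\<beta> H = 0" if "H \<in> \<hh>" for H using m[OF that] by simp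
    then show False using rootsD[OF assms(1)] by blast
  qed
  then have "1 \<le> (\<Sum>i=1..n. m i)" by linarith
  then show ?thesis unfolding ht by (metis of_nat_1 of_nat_le_iff)
qed

definition nilp :: "'g set" where "nilp = span (e ` positive_roots br \<hh> n \<alpha>)"
definition niln :: "'g set" where "niln = span ((\<lambda>\<beta>. e (neg_root \<beta>)) ` positive_roots br \<hh> n \<alpha>)"
definition borelp :: "'g set" where "borelp = {x + y | x y. x \<in> \<hh> \<and> y \<in> nilp}"
definition boreln :: "'g set" where "boreln = {x + y | x y. x \<in> \<hh> \<and> y \<in> niln}"

lemma positive_root: "\<beta> \<in> positive_roots br \<hh> n \<alpha> \<Longrightarrow> \<beta> \<in> roots br \<hh>"
  and positive_root_height: "\<beta> \<in> positive_roots br \<hh> n \<alpha> \<Longrightarrow> \<beta> grading_element \<ge> 1"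
  using nonneg_combination_height by (auto simp: positive_roots_def)

lemma simple_root_positive: "i \<in> {1..n} \<Longrightarrow> \<alpha> i \<in> positive_roots br \<hh> n \<alpha>"
  unfolding positive_roots_def nonneg_combination_def
  by (auto simp: simple_root intro!: exI[of _ "\<lambda>j. if j = i then 1 else 0"])
    (simp add: if_distrib[of real] if_distrib[of "\<lambda>c. c * _"] sum.delta cong: if_cong)

lemma root_positive_or_negative:
  assumes "\<beta> \<in> roots br \<hh>"
  shows "\<beta> \<in> positive_roots br \<hh> n \<alpha> \<or> neg_root \<beta> \<in> positive_roots br \<hh> n \<alpha>"
  using root_sign[OF assms] assms neg_root_root by (auto simp: positive_roots_def)

lemma root_vector_side:
  assumes \<beta>: "\<beta> \<in> roots br \<hh>" and x: "x \<in> weight_space \<beta>"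
  shows "\<beta> grading_element \<ge> 1 \<and> x \<in> nilp \<or> \<beta> grading_element \<le> - 1 \<and> x \<in> niln"
  using root_positive_or_negative[OF \<beta>]
proof
  assume "\<beta> \<in> positive_roots br \<hh> n \<alpha>"
  then show ?thesis
    using positive_root_height root_space_one_dimensional[OF \<beta> x] unfolding nilp_def
    by (metis image_eqI span_base span_scale)
next
  assume p: "neg_root \<beta> \<in> positive_roots br \<hh> n \<alpha>"
  then have "e \<beta> \<in> niln" unfolding niln_def by (intro span_base image_eqI[of _ _ "neg_root \<beta>"]) auto
  then have "x \<in> niln"
    using root_space_one_dimensional[OF \<beta> x] unfolding niln_def by (metis span_scale)
  moreover have "\<beta> grading_element \<le> - 1"
    using positive_root_height[OF p] by (simp add: neg_root_def)
  ultimately show ?thesis by simp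
qed

text \<open>
  A weight vector lies in \<open>\<nn>\<close>, in \<open>\<hh>\<close> or in the opposite nilradical according to the sign of its
  height. All inclusions between brackets of these subalgebras below are obtained by adding heights.
\<close>

lemma weight_vector_side:
  assumes x: "x \<in> weight_space \<delta>"
  shows "\<delta> grading_element > 0 \<Longrightarrow> x \<in> nilp"
    and "\<delta> grading_element < 0 \<Longrightarrow> x \<in> niln"
    and "\<delta> grading_element = 0 \<Longrightarrow> x \<noteq> 0 \<Longrightarrow> H \<in> \<hh> \<Longrightarrow> \<delta> H = 0"
proof -
  let ?d = "\<lambda>H. if H \<in> \<hh> then \<delta> H else 0"
  have xd: "x \<in> weight_space ?d" using x by (simp add: root_space_def)
  have 0: "0 \<in> nilp" "0 \<in> niln" by (simp_all add: nilp_def niln_def span_zero)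
  have side: "\<delta> grading_element \<ge> 1 \<and> x \<in> nilp \<or> \<delta> grading_element \<le> - 1 \<and> x \<in> niln"
    if "x \<noteq> 0" "H \<in> \<hh>" "\<delta> H \<noteq> 0" for H
    using root_vector_side[OF weight_space_root[OF x that] xd] grading_element_cartan by simp
  note sideg = side[OF _ grading_element_cartan]
  show "x \<in> nilp" if "\<delta> grading_element > 0" using sideg that 0 by (cases "x = 0") auto
  show "x \<in> niln" if "\<delta> grading_element < 0" using sideg that 0 by (cases "x = 0") auto
  show "\<delta> H = 0" if "\<delta> grading_element = 0" "x \<noteq> 0" "H \<in> \<hh>"
    using side[OF that(2,3)] that(1) by auto
qed

lemma subspace_nilp: "subspace nilp" and subspace_niln: "subspace niln"
  by (simp_all add: nilp_def niln_def)

lemma subspace_borelp: "subspace borelp" and subspace_boreln: "subspace boreln"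
  unfolding borelp_def boreln_def
  by (intro subspace_sums subspace_cartan subspace_nilp subspace_niln)+

lemma cartan_borel: "x \<in> \<hh> \<Longrightarrow> x \<in> borelp" "x \<in> \<hh> \<Longrightarrow> x \<in> boreln"
  and nil_borel: "y \<in> nilp \<Longrightarrow> y \<in> borelp" "y \<in> niln \<Longrightarrow> y \<in> boreln"
  using subspace_0[OF subspace_cartan] subspace_0[OF subspace_nilp] subspace_0[OF subspace_niln]
  unfolding borelp_def boreln_def by force+

lemma nilp_induct:
  assumes "y \<in> nilp" "subspace {y. P y}"
    "\<And>\<beta>. \<beta> \<in> positive_roots br \<hh> n \<alpha> \<Longrightarrow> P (e \<beta>)"
  shows "P y"
proof -
  have "nilp \<subseteq> {y. P y}" unfolding nilp_def by (rule span_minimal) (use assms in auto)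
  then show ?thesis using assms(1) by blast
qed

lemma niln_induct:
  assumes "y \<in> niln" "subspace {y. P y}"
    "\<And>\<beta>. \<beta> \<in> positive_roots br \<hh> n \<alpha> \<Longrightarrow> P (e (neg_root \<beta>))"
  shows "P y"
proof -
  have "niln \<subseteq> {y. P y}" unfolding niln_def by (rule span_minimal) (use assms in auto)
  then show ?thesis using assms(1) by blast
qed

lemma borelp_induct:
  assumes "y \<in> borelp" "subspace {y. P y}" "\<And>H. H \<in> \<hh> \<Longrightarrow> P H"
    "\<And>\<beta>. \<beta> \<in> positive_roots br \<hh> n \<alpha> \<Longrightarrow> P (e \<beta>)"
  shows "P y"
  using assms(1,3) nilp_induct[OF _ assms(2,4)] subspace_add[OF assms(2)]
  unfolding borelp_def by auto

lemma boreln_induct: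
  assumes "y \<in> boreln" "subspace {y. P y}" "\<And>H. H \<in> \<hh> \<Longrightarrow> P H"
    "\<And>\<beta>. \<beta> \<in> positive_roots br \<hh> n \<alpha> \<Longrightarrow> P (e (neg_root \<beta>))"
  shows "P y"
  using assms(1,3) niln_induct[OF _ assms(2,4)] subspace_add[OF assms(2)]
  unfolding boreln_def by auto

lemma triangular_decomposition:
  "\<exists>u\<in>borelp. \<exists>v\<in>niln. x = u + v"
  and triangular_decomposition_neg: "\<exists>u\<in>boreln. \<exists>v\<in>nilp. x = u + v"
proof -
  have sub: "subspace {u + v | u v. u \<in> borelp \<and> v \<in> niln}"
    "subspace {u + v | u v. u \<in> boreln \<and> v \<in> nilp}"
    by (intro subspace_sums subspace_borelp subspace_boreln subspace_nilp subspace_niln)+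
  have wt: "x \<in> {u + v | u v. u \<in> borelp \<and> v \<in> niln} \<and> x \<in> {u + v | u v. u \<in> boreln \<and> v \<in> nilp}"
    if x: "x \<in> weight_space \<delta>" for x \<delta>
  proof -
    have "x \<in> \<hh> \<or> x \<in> nilp \<or> x \<in> niln"
    proof (cases "x = 0 \<or> \<delta> grading_element = 0")
      case True
      then show ?thesis
        using weight_space_zero[OF x] weight_vector_side(3)[OF x] subspace_0[OF subspace_cartan] by blast
    next
      case False
      then show ?thesis using weight_vector_side(1,2)[OF x] by linarith
    qed
    then show ?thesis
      using cartan_borel[of x] nil_borel[of x] subspace_0[OF subspace_nilp] subspace_0[OF subspace_niln]
        subspace_0[OF subspace_borelp] subspace_0[OF subspace_boreln]
      by (metis (mono_tags, lifting) add.left_neutral add.right_neutral mem_Collect_eq)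
  qed
  have "span {x. \<exists>\<beta>. x \<in> weight_space \<beta>} \<subseteq> {u + v | u v. u \<in> borelp \<and> v \<in> niln}"
    "span {x. \<exists>\<beta>. x \<in> weight_space \<beta>} \<subseteq> {u + v | u v. u \<in> boreln \<and> v \<in> nilp}"
    by (intro span_minimal sub; use wt in blast)+
  then have "x \<in> {u + v | u v. u \<in> borelp \<and> v \<in> niln}" "x \<in> {u + v | u v. u \<in> boreln \<and> v \<in> nilp}"
    unfolding weight_vectors_span by blast+
  then show "\<exists>u\<in>borelp. \<exists>v\<in>niln. x = u + v" "\<exists>u\<in>boreln. \<exists>v\<in>nilp. x = u + v" by blast+
qed

lemma subspace_kappa_orth: "subspace {x. \<kappa> x y = 0}" "subspace {y. \<kappa> x y = 0}"
  by (auto simp: subspace_def kappa_simps)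

lemma positive_root_weight:
  assumes "\<beta> \<in> positive_roots br \<hh> n \<alpha>"
  shows "e \<beta> \<in> weight_space \<beta>" "e (neg_root \<beta>) \<in> weight_space (neg_root \<beta>)"
  using root_vectors neg_root_root positive_root[OF assms] by blast+

lemma kappa_nilp_borelp: "x \<in> nilp \<Longrightarrow> y \<in> borelp \<Longrightarrow> \<kappa> x y = 0"
proof (erule nilp_induct[where P = "\<lambda>x. \<kappa> x y = 0"], rule subspace_kappa_orth)
  fix \<beta> assume \<beta>: "\<beta> \<in> positive_roots br \<hh> n \<alpha>" and y: "y \<in> borelp"
  note pr = positive_root_weight[OF \<beta>] and ht = positive_root_height[OF \<beta>]
  show "\<kappa> (e \<beta>) y = 0"
    using y
  proof (rule borelp_induct, intro subspace_kappa_orth)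
    fix H assume "H \<in> \<hh>"
    show "\<kappa> (e \<beta>) H = 0"
      by (rule kappa_weight_orthogonal[OF pr(1) cartan_weight[OF \<open>H \<in> \<hh>\<close>] grading_element_cartan])
        (use ht in simp)
  next
    fix \<delta> assume \<delta>: "\<delta> \<in> positive_roots br \<hh> n \<alpha>"
    show "\<kappa> (e \<beta>) (e \<delta>) = 0"
      by (rule kappa_weight_orthogonal[OF pr(1) positive_root_weight(1)[OF \<delta>] grading_element_cartan])
        (use ht positive_root_height[OF \<delta>] in simp)
  qed
qed

lemma kappa_niln_boreln: "x \<in> niln \<Longrightarrow> y \<in> boreln \<Longrightarrow> \<kappa> x y = 0"
proof (erule niln_induct[where P = "\<lambda>x. \<kappa> x y = 0"], rule subspace_kappa_orth)
  fix \<beta> assume \<beta>: "\<beta> \<in> positive_roots br \<hh> n \<alpha>" and y: "y \<in> boreln"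
  note pr = positive_root_weight[OF \<beta>] and ht = positive_root_height[OF \<beta>]
  show "\<kappa> (e (neg_root \<beta>)) y = 0"
    using y
  proof (rule boreln_induct, intro subspace_kappa_orth)
    fix H assume "H \<in> \<hh>"
    show "\<kappa> (e (neg_root \<beta>)) H = 0"
      by (rule kappa_weight_orthogonal[OF pr(2) cartan_weight[OF \<open>H \<in> \<hh>\<close>] grading_element_cartan])
        (use ht in \<open>simp add: neg_root_def\<close>)
  next
    fix \<delta> assume \<delta>: "\<delta> \<in> positive_roots br \<hh> n \<alpha>"
    show "\<kappa> (e (neg_root \<beta>)) (e (neg_root \<delta>)) = 0"
      by (rule kappa_weight_orthogonal[OF pr(2) positive_root_weight(2)[OF \<delta>] grading_element_cartan])
        (use ht positive_root_height[OF \<delta>] in \<open>simp add: neg_root_def\<close>)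
  qed
qed

lemma subspace_ad_preimage: "subspace S \<Longrightarrow> subspace {x. br x y \<in> S}" "subspace S \<Longrightarrow> subspace {y. br x y \<in> S}"
  by (auto simp: subspace_def br_simps)

lemma boreln_niln: "x \<in> boreln \<Longrightarrow> y \<in> niln \<Longrightarrow> br x y \<in> niln"
proof (erule boreln_induct[where P = "\<lambda>x. br x y \<in> niln"], rule subspace_ad_preimage, rule subspace_niln)
  fix H assume H: "H \<in> \<hh>" and y: "y \<in> niln"
  show "br H y \<in> niln"
    using y
  proof (rule niln_induct, intro subspace_ad_preimage subspace_niln)
    fix \<delta> assume \<delta>: "\<delta> \<in> positive_roots br \<hh> n \<alpha>"
    show "br H (e (neg_root \<delta>)) \<in> niln"
      by (rule weight_vector_side(2)[OF weight_space_br[OF cartan_weight[OF H] positive_root_weight(2)[OF \<delta>]]])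
        (use positive_root_height[OF \<delta>] in \<open>simp add: neg_root_def\<close>)
  qed
next
  fix \<beta> assume \<beta>: "\<beta> \<in> positive_roots br \<hh> n \<alpha>" and y: "y \<in> niln"
  show "br (e (neg_root \<beta>)) y \<in> niln"
    using y
  proof (rule niln_induct, intro subspace_ad_preimage subspace_niln)
    fix \<delta> assume \<delta>: "\<delta> \<in> positive_roots br \<hh> n \<alpha>"
    show "br (e (neg_root \<beta>)) (e (neg_root \<delta>)) \<in> niln"
      by (rule weight_vector_side(2)[OF weight_space_br[OF positive_root_weight(2)[OF \<beta>] positive_root_weight(2)[OF \<delta>]]])
        (use positive_root_height[OF \<delta>] positive_root_height[OF \<beta>] in \<open>simp add: neg_root_def\<close>)
  qed
qed

lemma borelp_nilp: "x \<in> borelp \<Longrightarrow> y \<in> nilp \<Longrightarrow> br x y \<in> nilp"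
proof (erule borelp_induct[where P = "\<lambda>x. br x y \<in> nilp"], rule subspace_ad_preimage, rule subspace_nilp)
  fix H assume H: "H \<in> \<hh>" and y: "y \<in> nilp"
  show "br H y \<in> nilp"
    using y
  proof (rule nilp_induct, intro subspace_ad_preimage subspace_nilp)
    fix \<delta> assume \<delta>: "\<delta> \<in> positive_roots br \<hh> n \<alpha>"
    show "br H (e \<delta>) \<in> nilp"
      by (rule weight_vector_side(1)[OF weight_space_br[OF cartan_weight[OF H] positive_root_weight(1)[OF \<delta>]]])
        (use positive_root_height[OF \<delta>] in simp)
  qed
next
  fix \<beta> assume \<beta>: "\<beta> \<in> positive_roots br \<hh> n \<alpha>" and y: "y \<in> nilp"
  show "br (e \<beta>) y \<in> nilp"
    using y
  proof (rule nilp_induct, intro subspace_ad_preimage subspace_nilp)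
    fix \<delta> assume \<delta>: "\<delta> \<in> positive_roots br \<hh> n \<alpha>"
    show "br (e \<beta>) (e \<delta>) \<in> nilp"
      by (rule weight_vector_side(1)[OF weight_space_br[OF positive_root_weight(1)[OF \<beta>] positive_root_weight(1)[OF \<delta>]]])
        (use positive_root_height[OF \<delta>] positive_root_height[OF \<beta>] in simp)
  qed
qed

text \<open>
  Subtracting a simple root lowers the height by one, so at worst the result is in \<open>\<hh>\<close>.
\<close>

lemma simple_negative_nilp:
  assumes i: "i \<in> {1..n}" shows "y \<in> nilp \<Longrightarrow> br (e (neg_root (\<alpha> i))) y \<in> borelp"
proof (erule nilp_induct, intro subspace_ad_preimage subspace_borelp)
  fix \<beta> assume \<beta>: "\<beta> \<in> positive_roots br \<hh> n \<alpha>"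
  let ?x = "br (e (neg_root (\<alpha> i))) (e \<beta>)"
  have x: "?x \<in> weight_space (\<lambda>H. neg_root (\<alpha> i) H + \<beta> H)"
    by (intro weight_space_br positive_root_weight simple_root_positive i \<beta>)
  show "?x \<in> borelp"
  proof (cases "\<beta> grading_element = 1 \<and> ?x \<noteq> 0")
    case True
    then have "?x \<in> \<hh>"
      using weight_vector_side(3)[OF x] simple_root_grading[OF i]
      by (intro weight_space_zero[OF x]) (simp add: neg_root_def)
    then show ?thesis by (rule cartan_borel)
  next
    case False
    then show ?thesis
      using weight_vector_side(1)[OF x] simple_root_grading[OF i] positive_root_height[OF \<beta>]
        nil_borel(1)[of ?x] subspace_0[OF subspace_borelp] by (force simp: neg_root_def)
  qed
qed

lemma boreln_simple_coroot:
  assumes i: "i \<in> {1..n}" shows "x \<in> boreln \<Longrightarrow> br x (simple_coroot i) \<in> niln"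
proof (erule boreln_induct, intro subspace_ad_preimage subspace_niln)
  fix H assume "H \<in> \<hh>"
  then show "br H (simple_coroot i) \<in> niln"
    using cartan_abelian[OF _ simple_coroot_cartan[OF i]] subspace_0[OF subspace_niln] by simp
next
  fix \<beta> assume \<beta>: "\<beta> \<in> positive_roots br \<hh> n \<alpha>"
  show "br (e (neg_root \<beta>)) (simple_coroot i) \<in> niln"
    by (rule weight_vector_side(2)[OF weight_space_br[OF positive_root_weight(2)[OF \<beta>]
            cartan_weight[OF simple_coroot_cartan[OF i]]]])
      (use positive_root_height[OF \<beta>] in \<open>simp add: neg_root_def\<close>)
qed

text \<open>
  The action of the opposite Borel subalgebra on a simple root vector, modulo the opposite nilradical.
  For a positive root \<open>\<beta> \<noteq> \<alpha>_i\<close> the weight \<open>\<alpha>_i - \<beta>\<close> is nonzero of height at most \<open>0\<close>, so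
  \<open>[e_(-\<beta>), e_(\<alpha>_i)]\<close> contributes nothing; only \<open>\<hh>\<close> and \<open>e_(-\<alpha>_i)\<close> remain.
\<close>

lemma boreln_simple_root_vector:
  assumes i: "i \<in> {1..n}"
  shows "x \<in> boreln \<Longrightarrow> br x (e (\<alpha> i)) -
    (\<kappa> (simple_coroot i) x *\<^sub>R e (\<alpha> i) - \<kappa> (e (\<alpha> i)) x *\<^sub>R simple_coroot i) \<in> niln"
proof (erule boreln_induct)
  let ?D = "\<lambda>x. br x (e (\<alpha> i)) -
    (\<kappa> (simple_coroot i) x *\<^sub>R e (\<alpha> i) - \<kappa> (e (\<alpha> i)) x *\<^sub>R simple_coroot i)"
  have "linear ?D"
    by (rule linearI) (simp_all add: br_simps kappa_simps algebra_simps)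
  then show "subspace {x. ?D x \<in> niln}"
    using linear_subspace_vimage[OF _ subspace_niln] by (simp add: vimage_def)
  note ei = positive_root_weight(1)[OF simple_root_positive[OF i]]
  {
    fix H assume H: "H \<in> \<hh>"
    have "\<kappa> (e (\<alpha> i)) H = 0"
      by (rule kappa_weight_orthogonal[OF ei cartan_weight[OF H] grading_element_cartan])
        (simp add: simple_root_grading[OF i])
    then show "?D H \<in> niln"
      using weight_spaceD[OF ei H] kappa_simple_coroot[OF i H] subspace_0[OF subspace_niln] by simp
  next
    fix \<beta> assume \<beta>: "\<beta> \<in> positive_roots br \<hh> n \<alpha>"
    note eb = positive_root_weight(2)[OF \<beta>]
    have c0: "\<kappa> (simple_coroot i) (e (neg_root \<beta>)) = 0"
      by (rule kappa_weight_orthogonal[OF cartan_weight[OF simple_coroot_cartan[OF i]] eb grading_element_cartan])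
        (use positive_root_height[OF \<beta>] in \<open>simp add: neg_root_def\<close>)
    show "?D (e (neg_root \<beta>)) \<in> niln"
    proof (cases "\<beta> = \<alpha> i")
      case True
      then have "?D (e (neg_root \<beta>)) = 0"
        using c0 kappa_root_vector[OF simple_root[OF i]] br_skew[of "e (neg_root \<beta>)" "e (\<alpha> i)"]
        by (simp add: coroot_def)
      then show ?thesis using subspace_0[OF subspace_niln] by metis
    next
      case False
      have "\<kappa> (e (\<alpha> i)) (e (neg_root \<beta>)) = 0"
        using root_vectors_kappa[OF simple_root[OF i] neg_root_root[OF positive_root[OF \<beta>]]] False by simp
      then have D: "?D (e (neg_root \<beta>)) = br (e (neg_root \<beta>)) (e (\<alpha> i))" using c0 by simp
      note w = weight_space_br[OF eb ei]
      have nz: "\<exists>H\<in>\<hh>. neg_root \<beta> H + \<alpha> i H \<noteq> 0"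
      proof (rule ccontr)
        assume "\<not> ?thesis"
        then have "\<beta> H = \<alpha> i H" for H
          using rootsD(1)[OF positive_root[OF \<beta>], of H] rootsD(1)[OF simple_root[OF i], of H]
          by (cases "H \<in> \<hh>") (auto simp: neg_root_def)
        then show False using False by auto
      qed
      have ht: "neg_root \<beta> grading_element + \<alpha> i grading_element \<le> 0"
        using positive_root_height[OF \<beta>] simple_root_grading[OF i] by (simp add: neg_root_def)
      show ?thesis
      proof (cases "br (e (neg_root \<beta>)) (e (\<alpha> i)) = 0")
        case True
        then show ?thesis using D subspace_0[OF subspace_niln] by metis
      next
        case False
        then have "neg_root \<beta> grading_element + \<alpha> i grading_element \<noteq> 0"
          using nz weight_vector_side(3)[OF w] by blast
        then show ?thesis using weight_vector_side(2)[OF w] ht D by simp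
      qed
    qed
  }
qed

lemma kappa_simple_root_vectors:
  assumes "i \<in> {1..n}" "j \<in> {1..n}"
  shows "\<kappa> (e (\<alpha> i)) (e (neg_root (\<alpha> j))) = (if i = j then 1 else 0)"
proof -
  have "i = j" if "\<alpha> i = \<alpha> j"
    using simple_root_coweight[OF assms(1,1)] simple_root_coweight[OF assms] that by (auto split: if_splits)
  then have "(\<alpha> i = \<alpha> j) = (i = j)" by auto
  then show ?thesis
    using root_vectors_kappa[OF simple_root[OF assms(1)] neg_root_root[OF simple_root[OF assms(2)]]] by simp
qed

lemma kappa_simple_coroot_coweight:
  assumes "i \<in> {1..n}" "j \<in> {1..n}"
  shows "\<kappa> (simple_coroot i) (coweight j) = (if i = j then 1 else 0)"
  using kappa_simple_coroot[OF assms(1) coweight_cartan[OF assms(2)]] simple_root_coweight[OF assms(2,1)]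
  by auto

end

section \<open>Projections along a complement\<close>

locale complementary =
  fixes A N :: "'v::euclidean_space set"
  assumes subspaces: "subspace A" "subspace N"
    and disjoint: "\<And>x. x \<in> A \<Longrightarrow> x \<in> N \<Longrightarrow> x = 0"
    and spanning: "\<And>x. \<exists>u\<in>A. \<exists>v\<in>N. x = u + v"
begin

lemma component_unique: "u \<in> A \<Longrightarrow> x - u \<in> N \<Longrightarrow> component A N x = u"
proof -
  assume u: "u \<in> A" "x - u \<in> N"
  have eq: "z = u" if "z \<in> A" "x - z \<in> N" for z
    using disjoint[of "z - u"] subspace_diff[OF subspaces(1) that(1) u(1)]
      subspace_diff[OF subspaces(2) u(2) that(2)] by simp
  show ?thesis unfolding component_def by (rule the_equality) (use u eq in blast)+
qed

lemma component_mem: "component A N x \<in> A" and component_diff: "x - component A N x \<in> N"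
proof -
  obtain u v where "u \<in> A" "v \<in> N" "x = u + v" using spanning by blast
  then have "u \<in> A" "x - u \<in> N" by auto
  then show "component A N x \<in> A" "x - component A N x \<in> N" using component_unique by auto
qed

lemma component_self: "x \<in> A \<Longrightarrow> component A N x = x"
  using subspace_0[OF subspaces(1)] subspace_0[OF subspaces(2)] by (auto intro!: component_unique)

lemma linear_component: "linear (component A N)"
proof (rule linearI)
  fix x y :: 'v and c :: real
  show "component A N (x + y) = component A N x + component A N y"
  proof (rule component_unique)
    have "x + y - (component A N x + component A N y) = (x - component A N x) + (y - component A N y)"
      by simp
    then show "x + y - (component A N x + component A N y) \<in> N"
      by (simp only: subspace_add[OF subspaces(2) component_diff component_diff])
  qed (intro subspace_add subspaces component_mem)
  show "component A N (c *\<^sub>R x) = c *\<^sub>R component A N x"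
  proof (rule component_unique)
    have "c *\<^sub>R x - c *\<^sub>R component A N x = c *\<^sub>R (x - component A N x)" by (simp add: algebra_simps)
    then show "c *\<^sub>R x - c *\<^sub>R component A N x \<in> N"
      by (simp only: subspace_scale[OF subspaces(2) component_diff])
  qed (intro subspace_scale subspaces component_mem)
qed

text \<open>
  Since the base point is taken from \<open>N\<close>, projecting onto the affine space is the linear projection
  followed by the translation.
\<close>

lemma component_translate:
  assumes "f \<in> N" shows "component ((\<lambda>x. f + x) ` A) N y = f + component A N y"
  unfolding component_def[of "(\<lambda>x. f + x) ` A"]
proof (rule the_equality)
  have "y - (f + component A N y) = (y - component A N y) - f" by simp
  then have "y - (f + component A N y) \<in> N"
    by (simp only: subspace_diff[OF subspaces(2) component_diff assms])
  then show "f + component A N y \<in> (\<lambda>x. f + x) ` A \<and> y - (f + component A N y) \<in> N"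
    using component_mem by simp
  fix z assume z: "z \<in> (\<lambda>x. f + x) ` A \<and> y - z \<in> N"
  then obtain x where x: "x \<in> A" "z = f + x" by auto
  have "y - x = (y - z) + f" using x by simp
  then have "y - x \<in> N" using subspace_add[OF subspaces(2) _ assms, of "y - z"] z by (simp only:)
  then show "z = f + component A N y" using component_unique[OF x(1)] x(2) by simp
qed

end

section \<open>The exponential of a linear map\<close>

context
  fixes br :: "'v::euclidean_space \<Rightarrow> 'v \<Rightarrow> 'v"
  assumes bil: "bilinear br"
begin

lemma ad_linear: "linear (br x)"
  using bil by (simp add: bilinear_def)

lemma exp_ad_summable: "summable (\<lambda>k. ((br x ^^ k) y) /\<^sub>R fact k)"
proof -
  obtain B where B: "B > 0" "\<And>y. norm (br x y) \<le> B * norm y"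
    using linear_bounded_pos[OF ad_linear] by blast
  have "norm ((br x ^^ k) y) \<le> B ^ k * norm y" for k
  proof (induction k)
    case (Suc k)
    have "norm ((br x ^^ Suc k) y) \<le> B * norm ((br x ^^ k) y)" using B(2) by simp
    also have "\<dots> \<le> B * (B ^ k * norm y)" using Suc B(1) by simp
    finally show ?case by (simp add: mult.assoc)
  qed simp
  then have "norm (((br x ^^ k) y) /\<^sub>R fact k) \<le> inverse (fact k) * B ^ k * norm y" for k
    by (simp add: mult.assoc mult_left_mono)
  moreover have "summable (\<lambda>k. inverse (fact k) * B ^ k * norm y)"
    by (intro summable_mult2 summable_exp)
  ultimately show ?thesis by (rule summable_comparison_test'[of _ 0, rotated])
qed

lemma exp_ad_functional:
  fixes \<phi> :: "'v \<Rightarrow> real"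
  assumes "linear \<phi>"
  shows "summable (\<lambda>k. \<phi> ((br x ^^ k) y) / fact k)"
    and "\<phi> (exp_ad br x y) = (\<Sum>k. \<phi> ((br x ^^ k) y) / fact k)"
proof -
  have bl: "bounded_linear \<phi>" using assms by (rule linear_conv_bounded_linear[THEN iffD1])
  have eq: "\<phi> (((br x ^^ k) y) /\<^sub>R fact k) = \<phi> ((br x ^^ k) y) / fact k" for k
    by (simp add: linear_scale[OF assms] divide_inverse)
  show "summable (\<lambda>k. \<phi> ((br x ^^ k) y) / fact k)"
    using bounded_linear.summable[OF bl exp_ad_summable[of x y]] by (simp add: eq)
  show "\<phi> (exp_ad br x y) = (\<Sum>k. \<phi> ((br x ^^ k) y) / fact k)"
    unfolding exp_ad_def using bounded_linear.suminf[OF bl exp_ad_summable[of x y]] by (simp add: eq)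
qed

lemma exp_ad_invariant_subspace:
  assumes S: "subspace S" and inv: "\<And>z. z \<in> S \<Longrightarrow> br x z \<in> S" and y: "y \<in> S"
  shows "exp_ad br x y \<in> S"
proof -
  have "(br x ^^ k) y \<in> S" for k by (induction k) (use inv y in auto)
  then have "(\<Sum>k<m. ((br x ^^ k) y) /\<^sub>R fact k) \<in> S" for m
    by (intro subspace_sum subspace_scale S)
  then show ?thesis
    unfolding exp_ad_def
    by (rule closed_sequentially[OF closed_subspace[OF S] _ summable_LIMSEQ[OF exp_ad_summable]])
qed

text \<open>
  Every coordinate of the exponential is an everywhere convergent power series in \<open>s\<close>.
\<close>

lemma exp_ad_scale_has_derivative:
  "((\<lambda>s. exp_ad br (s *\<^sub>R x) y) has_vector_derivative br x y) (at 0)"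
proof -
  have pow: "(br (s *\<^sub>R x) ^^ k) y = s ^ k *\<^sub>R (br x ^^ k) y" for s k
    by (induction k) (simp_all add: bilinear_lmul[OF bil] bilinear_rmul[OF bil] mult.commute)
  have comp: "((\<lambda>s. exp_ad br (s *\<^sub>R x) y \<bullet> b) has_field_derivative br x y \<bullet> b) (at 0)" for b
  proof -
    have lin: "linear (\<lambda>z. z \<bullet> b)" by (rule linearI) (simp_all add: inner_add_left)
    let ?c = "\<lambda>k. ((br x ^^ k) y \<bullet> b) / fact k"
    have eq: "exp_ad br (s *\<^sub>R x) y \<bullet> b = (\<Sum>k. ?c k * s ^ k)" for s
      using exp_ad_functional(2)[OF lin, of "s *\<^sub>R x" y] by (simp add: pow mult.commute)
    have sm: "summable (\<lambda>k. ?c k * s ^ k)" for s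
      using exp_ad_functional(1)[OF lin, of "s *\<^sub>R x" y] by (simp add: pow mult.commute)
    have "((\<lambda>s. \<Sum>k. ?c k * s ^ k) has_field_derivative (\<Sum>k. diffs ?c k * 0 ^ k)) (at 0)"
      by (rule termdiffs_strong_converges_everywhere) (rule sm)
    moreover have "(\<Sum>k. diffs ?c k * 0 ^ k) = br x y \<bullet> b"
      by (subst powser_zero) (simp add: diffs_def)
    ultimately show ?thesis by (simp add: eq)
  qed
  show ?thesis
    unfolding has_vector_derivative_def
    by (subst has_derivative_componentwise_within)
      (use comp in \<open>auto simp: has_field_derivative_def mult_commute_abs\<close>)
qed

end

section \<open>Smooth functions\<close>

text \<open>
  Only the values on the line through \<open>y\<close> in direction \<open>v\<close> count, so \<open>\<phi>\<close> may be exchanged for a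
  function \<open>\<psi>\<close> that is differentiable on the ambient space.
\<close>

lemma differential_eqI:
  assumes "(\<psi> has_derivative D) (at y)" and "\<forall>\<^sub>F s in nhds 0. \<phi> (y + s *\<^sub>R v) = \<psi> (y + s *\<^sub>R v)"
  shows "differential \<phi> y v = D v"
proof -
  have "((\<lambda>s. y + s *\<^sub>R v) has_derivative (\<lambda>s. s *\<^sub>R v)) (at (0::real))"
    by (auto intro!: derivative_eq_intros)
  moreover have "(\<psi> has_derivative D) (at (y + 0 *\<^sub>R v))" using assms(1) by simp
  ultimately have "((\<lambda>s. \<psi> (y + s *\<^sub>R v)) has_derivative (\<lambda>s. D (s *\<^sub>R v))) (at 0)"
    by (rule has_derivative_compose)
  then have "((\<lambda>s. \<psi> (y + s *\<^sub>R v)) has_field_derivative D v) (at 0)"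
    unfolding has_field_derivative_def
    using linear_scale[OF has_derivative_linear[OF assms(1)]] by (simp add: mult_commute_abs)
  then have "deriv (\<lambda>s. \<psi> (y + s *\<^sub>R v)) 0 = D v" by (rule DERIV_imp_deriv)
  moreover have "deriv (\<lambda>s. \<phi> (y + s *\<^sub>R v)) 0 = deriv (\<lambda>s. \<psi> (y + s *\<^sub>R v)) 0"
    by (rule deriv_cong_ev[OF assms(2) refl])
  ultimately show ?thesis by (simp add: differential_def)
qed

text \<open>
  A class of functions that contains the coefficients of the symplectic form and is closed under
  directional derivatives. Closure is what makes an induction on the order of differentiability go
  through.
\<close>

inductive rational_on :: "'v::real_normed_vector set \<Rightarrow> ('v \<Rightarrow> real) \<Rightarrow> bool" for Z where
  const: "rational_on Z (\<lambda>_. c)"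
| linear: "bounded_linear L \<Longrightarrow> rational_on Z L"
| add: "rational_on Z \<phi> \<Longrightarrow> rational_on Z \<psi> \<Longrightarrow> rational_on Z (\<lambda>y. \<phi> y + \<psi> y)"
| mult: "rational_on Z \<phi> \<Longrightarrow> rational_on Z \<psi> \<Longrightarrow> rational_on Z (\<lambda>y. \<phi> y * \<psi> y)"
| inverse: "rational_on Z \<phi> \<Longrightarrow> (\<And>y. y \<in> Z \<Longrightarrow> \<phi> y \<noteq> 0) \<Longrightarrow> rational_on Z (\<lambda>y. inverse (\<phi> y))"

lemma rational_on_uminus: "rational_on Z \<phi> \<Longrightarrow> rational_on Z (\<lambda>y. - \<phi> y)"
  using rational_on.mult[OF rational_on.const[of Z "-1"]] by simp

lemma rational_on_sum:
  "(\<And>i. i \<in> I \<Longrightarrow> rational_on Z (\<phi> i)) \<Longrightarrow> rational_on Z (\<lambda>y. \<Sum>i\<in>I. \<phi> i y)"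
  by (induction I rule: infinite_finite_induct) (auto intro: rational_on.intros)

lemma rational_on_has_derivative:
  assumes "rational_on Z \<phi>"
  shows "\<exists>\<phi>'. (\<forall>v. rational_on Z (\<lambda>y. \<phi>' y v)) \<and> (\<forall>y\<in>Z. (\<phi> has_derivative \<phi>' y) (at y))"
  using assms
proof induction
  case (const c)
  show ?case by (rule exI[of _ "\<lambda>_ _. 0"]) (auto intro: rational_on.intros)
next
  case (linear L)
  then show ?case
    by (intro exI[of _ "\<lambda>_. L"]) (auto intro: rational_on.intros bounded_linear_imp_has_derivative)
next
  case (add \<phi> \<psi>)
  obtain \<phi>' \<psi>' where d: "\<forall>v. rational_on Z (\<lambda>y. \<phi>' y v)" "\<forall>y\<in>Z. (\<phi> has_derivative \<phi>' y) (at y)"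
    "\<forall>v. rational_on Z (\<lambda>y. \<psi>' y v)" "\<forall>y\<in>Z. (\<psi> has_derivative \<psi>' y) (at y)"
    using add.IH by blast
  show ?case
    by (rule exI[of _ "\<lambda>y v. \<phi>' y v + \<psi>' y v"]) (use d in \<open>auto intro!: rational_on.add has_derivative_add\<close>)
next
  case (mult \<phi> \<psi>)
  obtain \<phi>' \<psi>' where d: "\<forall>v. rational_on Z (\<lambda>y. \<phi>' y v)" "\<forall>y\<in>Z. (\<phi> has_derivative \<phi>' y) (at y)"
    "\<forall>v. rational_on Z (\<lambda>y. \<psi>' y v)" "\<forall>y\<in>Z. (\<psi> has_derivative \<psi>' y) (at y)"
    using mult.IH by blast
  show ?case
    by (rule exI[of _ "\<lambda>y v. \<phi> y * \<psi>' y v + \<phi>' y v * \<psi> y"])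
      (use d mult.hyps in \<open>auto intro!: rational_on.intros(3,4) has_derivative_mult\<close>)
next
  case (inverse \<phi>)
  obtain \<phi>' where d: "\<forall>v. rational_on Z (\<lambda>y. \<phi>' y v)" "\<forall>y\<in>Z. (\<phi> has_derivative \<phi>' y) (at y)"
    using inverse.IH by blast
  show ?case
    by (rule exI[of _ "\<lambda>y v. - (inverse (\<phi> y) * \<phi>' y v * inverse (\<phi> y))"])
      (use d inverse.hyps in \<open>auto intro!: rational_on_uminus rational_on.intros(4,5) has_derivative_inverse\<close>)
qed

lemma rational_on_Ck:
  assumes line: "\<And>y v. y \<in> Z \<Longrightarrow> v \<in> V \<Longrightarrow> \<forall>\<^sub>F s in nhds 0. y + s *\<^sub>R v \<in> Z"
    and "rational_on Z \<psi>" and "\<And>y. y \<in> Z \<Longrightarrow> \<phi> y = \<psi> y"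
  shows "Ck_on k V Z \<phi>"
  using assms(2,3)
proof (induction k arbitrary: \<phi> \<psi>)
  case 0
  obtain \<psi>' where d: "\<forall>y\<in>Z. (\<psi> has_derivative \<psi>' y) (at y)"
    using rational_on_has_derivative[OF 0(1)] by blast
  have "continuous_on Z \<psi>"
    by (rule continuous_at_imp_continuous_on) (use d has_derivative_continuous in blast)
  then show ?case using 0(2) by (simp add: continuous_on_eq)
next
  case (Suc k)
  obtain \<psi>' where d: "\<And>v. rational_on Z (\<lambda>y. \<psi>' y v)" "\<And>y. y \<in> Z \<Longrightarrow> (\<psi> has_derivative \<psi>' y) (at y)"
    using rational_on_has_derivative[OF Suc(2)] by blast
  have "\<phi> differentiable_on Z"
    unfolding differentiable_on_def differentiable_def
    using has_derivative_transform[OF _ Suc(3) has_derivative_at_withinI[OF d(2)]] by blast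
  moreover have "Ck_on k V Z (\<lambda>y. differential \<phi> y v)" if v: "v \<in> V" for v
  proof (rule Suc.IH[OF d(1)[of v]])
    fix y assume y: "y \<in> Z"
    show "differential \<phi> y v = \<psi>' y v"
      by (rule differential_eqI[OF d(2)[OF y] eventually_mono[OF line[OF y v]]]) (rule Suc(3))
  qed
  ultimately show ?case by simp
qed

section \<open>Truncated current algebras\<close>

lemma subspace_current: "subspace S \<Longrightarrow> subspace (current_subspace S)"
  unfolding current_subspace_def subspace_def by auto

lemma complementary_current:
  assumes "complementary A N"
  shows "complementary (current_subspace A) (current_subspace N :: ('g::euclidean_space ^ 'k::finite) set)"
proof -
  interpret complementary A N by fact
  show ?thesis
  proof
    fix X :: "'g ^ 'k"
    show "\<exists>U\<in>current_subspace A. \<exists>W\<in>current_subspace N. X = U + W"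
      by (rule bexI[of _ "\<chi> k. component A N (X $ k)"], rule bexI[of _ "\<chi> k. X $ k - component A N (X $ k)"])
        (auto simp: current_subspace_def component_mem component_diff vec_eq_iff)
    assume "X \<in> current_subspace A" "X \<in> current_subspace N"
    then show "X = 0" using disjoint by (auto simp: current_subspace_def vec_eq_iff)
  qed (intro subspace_current subspaces)+
qed

locale truncation =
  fixes deg :: "'k::finite \<Rightarrow> nat" and l :: nat
  assumes deg_bij: "bij_betw deg UNIV {0..l}"
begin

definition idx :: "nat \<Rightarrow> 'k" where "idx = inv_into UNIV deg"

lemma deg_le [simp]: "deg k \<le> l"
  using deg_bij by (metis UNIV_I atLeastAtMost_iff bij_betwE)

lemma deg_idx [simp]: "j \<le> l \<Longrightarrow> deg (idx j) = j"
  unfolding idx_def using deg_bij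
  by (metis atLeast0AtMost atMost_iff bij_betw_imp_surj_on f_inv_into_f)

lemma idx_deg [simp]: "idx (deg k) = k"
  unfolding idx_def using deg_bij by (simp add: bij_betw_def)

definition agree :: "real fps \<Rightarrow> real fps \<Rightarrow> bool" where
  "agree p q \<longleftrightarrow> (\<forall>j\<le>l. fps_nth p j = fps_nth q j)"

lemma agreeI: "(\<And>j. j \<le> l \<Longrightarrow> fps_nth p j = fps_nth q j) \<Longrightarrow> agree p q"
  and agreeD: "agree p q \<Longrightarrow> j \<le> l \<Longrightarrow> fps_nth p j = fps_nth q j"
  by (simp_all add: agree_def)

lemma agree_refl [simp]: "agree p p"
  and agree_sym: "agree p q \<Longrightarrow> agree q p"
  and agree_trans [trans]: "agree p q \<Longrightarrow> agree q r \<Longrightarrow> agree p r"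
  and agree_add: "agree p q \<Longrightarrow> agree p' q' \<Longrightarrow> agree (p + p') (q + q')"
  and agree_diff: "agree p q \<Longrightarrow> agree p' q' \<Longrightarrow> agree (p - p') (q - q')"
  and agree_minus: "agree p q \<Longrightarrow> agree (- p) (- q)"
  by (simp_all add: agree_def)

lemma agree_mult: "agree p q \<Longrightarrow> agree p' q' \<Longrightarrow> agree (p * p') (q * q')"
  by (auto simp: agree_def fps_mult_nth intro!: sum.cong)

lemma agree_sum: "(\<And>i. i \<in> I \<Longrightarrow> agree (p i) (q i)) \<Longrightarrow> agree (sum p I) (sum q I)"
  by (auto simp: agree_def fps_sum_nth intro!: sum.cong)

lemma sum_degree_pairs:
  assumes "m \<le> l"
  shows "(\<Sum>(a, b)\<in>{(a, b). deg a + deg b = m}. F a b) = (\<Sum>i=0..m. F (idx i) (idx (m - i)))"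
  by (rule sum.reindex_bij_witness[where i = "\<lambda>i. (idx i, idx (m - i))" and j = "\<lambda>(a, b). deg a"])
    (use assms in auto)

text \<open>
  \<open>tens p x\<close> is \<open>x \<otimes> p(t)\<close>. Formal power series serve as representatives of elements of
  \<open>\<real>[t]/(t^(l+1))\<close>: only their coefficients up to \<open>t^l\<close> matter, which is the relation \<open>agree\<close>.
\<close>

definition tens :: "real fps \<Rightarrow> 'g::euclidean_space \<Rightarrow> 'g ^ 'k" where
  "tens p x = (\<chi> k. fps_nth p (deg k) *\<^sub>R x)"

definition ser :: "('g::euclidean_space \<Rightarrow> real) \<Rightarrow> 'g ^ 'k \<Rightarrow> real fps" where
  "ser \<phi> X = Abs_fps (\<lambda>j. if j \<le> l then \<phi> (X $ idx j) else 0)"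

lemma tens_cong: "agree p q \<Longrightarrow> tens p x = tens q x"
  by (simp add: tens_def agree_def vec_eq_iff)

lemma tens_simps:
  "tens (p + q) x = tens p x + tens q x" "tens (p - q) x = tens p x - tens q x"
  "tens (- p) x = - tens p x" "tens 0 x = 0" "tens p 0 = 0"
  "tens (fps_const c * p) x = c *\<^sub>R tens p x"
  by (simp_all add: tens_def vec_eq_iff algebra_simps)

lemma tens_current: "subspace S \<Longrightarrow> x \<in> S \<Longrightarrow> tens p x \<in> current_subspace S"
  by (simp add: tens_def current_subspace_def subspace_scale)

lemma monomial_tens: "(\<Sum>j=0..l. r j *\<^sub>R monomial deg x j) = tens (Abs_fps r) x"
proof -
  have "(\<Sum>j=0..l. r j *\<^sub>R monomial deg x j) $ k = r (deg k) *\<^sub>R x" for k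
  proof -
    have "(\<Sum>j=0..l. r j *\<^sub>R monomial deg x j) $ k = (\<Sum>j=0..l. if j = deg k then r j *\<^sub>R x else 0)"
      unfolding sum_component by (rule sum.cong) (auto simp: monomial_def)
    then show ?thesis by simp
  qed
  then show ?thesis by (simp add: tens_def vec_eq_iff)
qed

lemma ser_nth: "fps_nth (ser \<phi> X) j = (if j \<le> l then \<phi> (X $ idx j) else 0)"
  by (simp add: ser_def)

lemma ser_tens: "linear \<phi> \<Longrightarrow> agree (ser \<phi> (tens p x)) (fps_const (\<phi> x) * p)"
  by (rule agreeI) (simp add: ser_nth tens_def linear_scale)

lemma ser_add: "linear \<phi> \<Longrightarrow> ser \<phi> (X + Y) = ser \<phi> X + ser \<phi> Y"
  and ser_diff: "linear \<phi> \<Longrightarrow> ser \<phi> (X - Y) = ser \<phi> X - ser \<phi> Y"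
  and ser_scale: "linear \<phi> \<Longrightarrow> ser \<phi> (c *\<^sub>R X) = fps_const c * ser \<phi> X"
  by (rule fps_ext, simp add: ser_nth linear_add linear_diff linear_scale)+

lemma ser_zero: "(\<And>x. x \<in> S \<Longrightarrow> \<phi> x = 0) \<Longrightarrow> X \<in> current_subspace S \<Longrightarrow> ser \<phi> X = 0"
  by (rule fps_ext) (simp add: ser_nth current_subspace_def)

lemma ser_sum: "linear \<phi> \<Longrightarrow> ser \<phi> (\<Sum>i\<in>I. X i) = (\<Sum>i\<in>I. ser \<phi> (X i))"
  by (rule fps_ext) (simp add: ser_nth linear_sum fps_sum_nth)

lemma bounded_linear_ser_nth:
  assumes "linear \<phi>" shows "bounded_linear (\<lambda>X. fps_nth (ser \<phi> X) j)"
  unfolding linear_conv_bounded_linear[symmetric]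
  by (rule linearI) (simp_all add: ser_add[OF assms] ser_scale[OF assms])

lemma ser_mult_nth:
  assumes "m \<le> l"
  shows "fps_nth (ser \<phi> X * p) m = (\<Sum>(a, b)\<in>{(a, b). deg a + deg b = m}. \<phi> (X $ a) * fps_nth p (deg b))"
  using assms by (auto simp: sum_degree_pairs fps_mult_nth ser_nth intro!: sum.cong)

lemma current_bracket_bilinear:
  assumes "bilinear br" shows "bilinear (current_bracket deg br)"
  unfolding bilinear_def
  by (intro conjI allI linearI)
    (simp_all add: current_bracket_def vec_eq_iff bilinear_ladd[OF assms] bilinear_radd[OF assms]
      bilinear_lmul[OF assms] bilinear_rmul[OF assms] sum.distrib scaleR_sum_right case_prod_unfold)

lemma current_bracket_skew:
  assumes "\<And>x y. br x y = - br y x"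
  shows "current_bracket deg br X Y = - current_bracket deg br Y X"
proof -
  have "(\<Sum>(a, b)\<in>{(a, b). deg a + deg b = deg m}. br (X $ a) (Y $ b)) =
      - (\<Sum>(a, b)\<in>{(a, b). deg a + deg b = deg m}. br (Y $ a) (X $ b))" for m
    unfolding sum_negf[symmetric]
    by (rule sum.reindex_bij_witness[where i = prod.swap and j = prod.swap])
      (auto simp: add.commute intro: assms[symmetric])
  then show ?thesis by (simp add: current_bracket_def vec_eq_iff)
qed

lemma current_bracket_mem:
  assumes "subspace T" and "\<And>x y. x \<in> S \<Longrightarrow> y \<in> S' \<Longrightarrow> br x y \<in> T"
    and "X \<in> current_subspace S" "Y \<in> current_subspace S'"
  shows "current_bracket deg br X Y \<in> current_subspace T"
  using assms(2-4) by (auto simp: current_subspace_def current_bracket_def intro!: subspace_sum[OF assms(1)])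

lemma current_bracket_tens:
  assumes "bilinear br"
  shows "current_bracket deg br X (tens p x) $ k =
    (\<Sum>(a, b)\<in>{(a, b). deg a + deg b = deg k}. fps_nth p (deg b) *\<^sub>R br (X $ a) x)"
  by (simp add: current_bracket_def tens_def bilinear_rmul[OF assms])

lemma current_form_bilinear:
  assumes "bilinear \<kappa>" shows "bilinear (current_form deg l \<kappa>)"
  unfolding bilinear_def
  by (intro conjI allI linearI)
    (simp_all add: current_form_def bilinear_ladd[OF assms] bilinear_radd[OF assms]
      bilinear_lmul[OF assms] bilinear_rmul[OF assms] sum.distrib sum_distrib_left case_prod_unfold)

lemma current_form_sym:
  assumes "\<And>x y. \<kappa> x y = \<kappa> y x"
  shows "current_form deg l \<kappa> X Y = current_form deg l \<kappa> Y X"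
  unfolding current_form_def
  by (rule sum.reindex_bij_witness[where i = prod.swap and j = prod.swap])
    (use assms in \<open>auto simp: add.commute\<close>)

lemma current_form_zero:
  assumes "\<And>x y. x \<in> S \<Longrightarrow> y \<in> T \<Longrightarrow> \<kappa> x y = 0"
    and "X \<in> current_subspace S" "Y \<in> current_subspace T"
  shows "current_form deg l \<kappa> X Y = 0"
  using assms by (auto simp: current_form_def current_subspace_def intro!: sum.neutral)

lemma current_form_tens:
  assumes "bilinear \<kappa>"
  shows "current_form deg l \<kappa> (tens p x) Y = fps_nth (p * ser (\<kappa> x) Y) l"
  by (auto simp: current_form_def sum_degree_pairs fps_mult_nth ser_nth tens_def
      bilinear_lmul[OF assms] intro!: sum.cong)

lemma current_form_nondegenerate:
  assumes "bilinear \<kappa>" "\<And>x y. \<kappa> x y = \<kappa> y x" "\<And>y. (\<And>x. \<kappa> x y = 0) \<Longrightarrow> y = 0"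
    and "\<And>X. current_form deg l \<kappa> X Y = 0"
  shows "Y = 0"
proof -
  have "\<kappa> x (Y $ k) = 0" for x k
  proof -
    have "fps_nth (fps_X ^ (l - deg k) * ser (\<kappa> x) Y) l = 0"
      using current_form_tens[OF assms(1)] assms(4) by metis
    then show ?thesis by (simp add: fps_X_power_mult_nth ser_nth not_less split: if_splits)
  qed
  then show ?thesis using assms(3) by (simp add: vec_eq_iff)
qed

text \<open>
  Both sides are the sum of \<open>\<kappa> (X_a) [Y_b, Z_c]\<close> over all triples of total degree \<open>l\<close>; the
  intermediate degrees \<open>deg a + deg b\<close> and \<open>deg b + deg c\<close> are at most \<open>l\<close>, hence are degrees of
  indices.
\<close>

lemma current_form_invariant:
  assumes "bilinear \<kappa>" and "\<And>x y z. \<kappa> (br x y) z = \<kappa> x (br y z)"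
  shows "current_form deg l \<kappa> (current_bracket deg br X Y) Z =
    current_form deg l \<kappa> X (current_bracket deg br Y Z)"
proof -
  have lin: "linear (\<kappa> x)" "linear (\<lambda>x. \<kappa> x y)" for x y using assms(1) by (simp_all add: bilinear_def)
  let ?T = "\<Sum>(a, b, c)\<in>{(a, b, c). deg a + deg b + deg c = l}. \<kappa> (X $ a) (br (Y $ b) (Z $ c))"
  have "current_form deg l \<kappa> (current_bracket deg br X Y) Z =
    (\<Sum>(m, c)\<in>{(m, c). deg m + deg c = l}. \<Sum>(a, b)\<in>{(a, b). deg a + deg b = deg m}.
      \<kappa> (X $ a) (br (Y $ b) (Z $ c)))"
    by (simp add: current_form_def current_bracket_def linear_sum[OF lin(2)] case_prod_unfold assms(2))
  also have "\<dots> = (\<Sum>(p, q)\<in>(SIGMA p:{(m, c). deg m + deg c = l}. {(a, b). deg a + deg b = deg (fst p)}).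
      \<kappa> (X $ fst q) (br (Y $ snd q) (Z $ snd p)))"
    by (subst sum.Sigma[symmetric]) (auto simp: case_prod_unfold)
  also have "\<dots> = ?T"
    by (rule sum.reindex_bij_witness[where i = "\<lambda>(a, b, c). ((idx (deg a + deg b), c), (a, b))"
          and j = "\<lambda>((m, c), (a, b)). (a, b, c)"]) auto
  also have "?T = (\<Sum>(p, q)\<in>(SIGMA p:{(a, m). deg a + deg m = l}. {(b, c). deg b + deg c = deg (snd p)}).
      \<kappa> (X $ fst p) (br (Y $ fst q) (Z $ snd q)))"
    by (rule sum.reindex_bij_witness[where j = "\<lambda>(a, b, c). ((a, idx (deg b + deg c)), (b, c))"
          and i = "\<lambda>((a, m), (b, c)). (a, b, c)"]) (auto simp: add.assoc)
  also have "\<dots> = (\<Sum>(a, m)\<in>{(a, m). deg a + deg m = l}. \<Sum>(b, c)\<in>{(b, c). deg b + deg c = deg m}.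
      \<kappa> (X $ a) (br (Y $ b) (Z $ c)))"
    by (subst sum.Sigma[symmetric]) (auto simp: case_prod_unfold)
  also have "\<dots> = current_form deg l \<kappa> X (current_bracket deg br Y Z)"
    by (simp add: current_form_def current_bracket_def linear_sum[OF lin(1)] case_prod_unfold)
  finally show ?thesis .
qed

end

section \<open>Normalized Jacobi elements\<close>

text \<open>
  The series \<open>C i\<close> hold the coefficients of \<open>e_(-\<alpha>_i)\<close> in the base point \<open>f\<close>. Because \<open>f\<close> lies in
  \<open>Nbar\<close>, which \<open>Bbar\<close> preserves, the action of \<open>Bbar\<close> on \<open>f + Bl\<close> is the translate of its action on
  the quotient by \<open>Nbar\<close>.
\<close>

locale jacobi_setting =
  split_simple_lie br \<kappa> \<hh> n \<alpha> e + truncation deg l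
  for br :: "'g::euclidean_space \<Rightarrow> 'g \<Rightarrow> 'g" and \<kappa> :: "'g \<Rightarrow> 'g \<Rightarrow> real"
    and \<hh> :: "'g set" and n :: nat and \<alpha> :: "nat \<Rightarrow> 'g \<Rightarrow> real" and e :: "('g \<Rightarrow> real) \<Rightarrow> 'g"
    and deg :: "'k::finite \<Rightarrow> nat" and l :: nat +
  fixes C :: "nat \<Rightarrow> real fps"
begin

abbreviation brl :: "'g ^ 'k \<Rightarrow> 'g ^ 'k \<Rightarrow> 'g ^ 'k" where "brl \<equiv> current_bracket deg br"
abbreviation Q :: "'g ^ 'k \<Rightarrow> 'g ^ 'k \<Rightarrow> real" where "Q \<equiv> current_form deg l \<kappa>"
abbreviation Nl :: "('g ^ 'k) set" where "Nl \<equiv> current_subspace nilp"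
abbreviation Nbar :: "('g ^ 'k) set" where "Nbar \<equiv> current_subspace niln"
abbreviation Bl :: "('g ^ 'k) set" where "Bl \<equiv> current_subspace borelp"
abbreviation Bbar :: "('g ^ 'k) set" where "Bbar \<equiv> current_subspace boreln"

abbreviation ep :: "nat \<Rightarrow> 'g" where "ep i \<equiv> e (\<alpha> i)"
abbreviation en :: "nat \<Rightarrow> 'g" where "en i \<equiv> e (neg_root (\<alpha> i))"

definition f :: "'g ^ 'k" where "f = (\<Sum>i=1..n. tens (C i) (en i))"
definition F :: "('g ^ 'k) set" where "F = (\<lambda>x. f + x) ` Bl"

text \<open>
  The tangent vector with coordinate series \<open>r\<close> and \<open>g\<close>.
\<close>

definition J :: "(nat \<Rightarrow> real fps) \<Rightarrow> (nat \<Rightarrow> real fps) \<Rightarrow> 'g ^ 'k" where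
  "J r g = (\<Sum>i=1..n. tens (r i) (simple_coroot i)) + (\<Sum>i=1..n. tens (g i) (ep i))"

definition V :: "('g ^ 'k) set" where "V = range (\<lambda>(r, g). J r g)"
definition Z :: "('g ^ 'k) set" where "Z = {f + J r g | r g. \<forall>i\<in>{1..n}. fps_nth (g i) 0 > 0}"

lemma complementary_borels: "complementary borelp niln" "complementary boreln nilp"
proof -
  have 1: "x = 0" if x: "x \<in> borelp" "x \<in> niln" for x
  proof (rule kappa_nondegenerate)
    fix y
    obtain u v where "u \<in> boreln" "v \<in> nilp" "y = u + v" using triangular_decomposition_neg by blast
    then show "\<kappa> x y = 0"
      using kappa_niln_boreln[OF x(2)] kappa_nilp_borelp[OF _ x(1)] kappa_sym[of x] by (simp add: kappa_simps)
  qed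
  have 2: "x = 0" if x: "x \<in> boreln" "x \<in> nilp" for x
  proof (rule kappa_nondegenerate)
    fix y
    obtain u v where "u \<in> borelp" "v \<in> niln" "y = u + v" using triangular_decomposition by blast
    then show "\<kappa> x y = 0"
      using kappa_nilp_borelp[OF x(2)] kappa_niln_boreln[OF _ x(1)] kappa_sym[of x] by (simp add: kappa_simps)
  qed
  show "complementary borelp niln" "complementary boreln nilp"
    using 1 2 triangular_decomposition triangular_decomposition_neg subspace_borelp subspace_boreln subspace_nilp subspace_niln
    by unfold_locales blast+
qed

sublocale pos: complementary Bl Nbar
  by (rule complementary_current[OF complementary_borels(1)])

sublocale neg: complementary Bbar Nl
  by (rule complementary_current[OF complementary_borels(2)])

lemma bilinear_brl: "bilinear brl" by (rule current_bracket_bilinear[OF bilinear_br])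
lemma bilinear_Q: "bilinear Q" by (rule current_form_bilinear[OF bilinear_kappa])
lemma brl_skew: "brl x y = - brl y x" by (rule current_bracket_skew) (rule br_skew)
lemma Q_sym: "Q x y = Q y x" by (rule current_form_sym) (rule kappa_sym)
lemma Q_invariant: "Q (brl x y) z = Q x (brl y z)"
  by (rule current_form_invariant[OF bilinear_kappa kappa_invariant])

lemma Q_nondegenerate: "(\<And>y. Q x y = 0) \<Longrightarrow> x = 0"
  by (rule current_form_nondegenerate[OF bilinear_kappa kappa_sym kappa_nondegenerate])
    (simp_all add: kappa_sym[of _ "_ :: 'g"] Q_sym[of _ x])

lemma Q_Nbar_Bbar: "x \<in> Nbar \<Longrightarrow> y \<in> Bbar \<Longrightarrow> Q x y = 0"
  and Q_Nl_Bl: "x \<in> Nl \<Longrightarrow> y \<in> Bl \<Longrightarrow> Q x y = 0"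
  by (rule current_form_zero[of niln boreln] current_form_zero[of nilp borelp];
      auto intro: kappa_niln_boreln kappa_nilp_borelp)+

lemmas brl_simps = bilinear_ladd[OF bilinear_brl] bilinear_radd[OF bilinear_brl]
  bilinear_lmul[OF bilinear_brl] bilinear_rmul[OF bilinear_brl]
  bilinear_lneg[OF bilinear_brl] bilinear_rneg[OF bilinear_brl]
  bilinear_lsub[OF bilinear_brl] bilinear_rsub[OF bilinear_brl]
  bilinear_lzero[OF bilinear_brl] bilinear_rzero[OF bilinear_brl]

lemmas Q_simps = bilinear_ladd[OF bilinear_Q] bilinear_radd[OF bilinear_Q]
  bilinear_lmul[OF bilinear_Q] bilinear_rmul[OF bilinear_Q]
  bilinear_lneg[OF bilinear_Q] bilinear_rneg[OF bilinear_Q]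
  bilinear_lsub[OF bilinear_Q] bilinear_rsub[OF bilinear_Q]
  bilinear_lzero[OF bilinear_Q] bilinear_rzero[OF bilinear_Q]

lemma sub_Bl: "subspace Bl" and sub_Nbar: "subspace Nbar" and sub_Bbar: "subspace Bbar"
  using pos.subspaces neg.subspaces by auto

lemma brl_Bbar_Nbar: "u \<in> Bbar \<Longrightarrow> z \<in> Nbar \<Longrightarrow> brl u z \<in> Nbar"
  by (rule current_bracket_mem[OF subspace_niln boreln_niln])

lemma en_niln: "i \<in> {1..n} \<Longrightarrow> en i \<in> niln"
  unfolding niln_def by (rule span_base) (use simple_root_positive in blast)

lemma ep_nilp: "i \<in> {1..n} \<Longrightarrow> ep i \<in> nilp"
  unfolding nilp_def by (rule span_base) (use simple_root_positive in blast)

lemma f_Nbar: "f \<in> Nbar"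
  unfolding f_def by (intro subspace_sum sub_Nbar tens_current subspace_niln en_niln)

lemma J_Bl: "J r g \<in> Bl"
  unfolding J_def
  by (intro subspace_add subspace_sum sub_Bl tens_current subspace_borelp cartan_borel nil_borel
      simple_coroot_cartan ep_nilp)

lemma V_Bl: "v \<in> V \<Longrightarrow> v \<in> Bl" by (auto simp: V_def J_Bl)

text \<open>
  The coordinates of a point of the orbit, and the pairings that determine how an element of
  \<open>Bbar\<close> acts: \<open>tor i u\<close> is \<open>\<alpha>_i\<close> of its Cartan part and \<open>low i u\<close> is its coefficient along
  \<open>e_(-\<alpha>_i)\<close>, both as elements of \<open>\<real>[t]/(t^(l+1))\<close>.
\<close>

definition rho :: "nat \<Rightarrow> 'g ^ 'k \<Rightarrow> real fps" where "rho i = ser (\<kappa> (coweight i))"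
definition gam :: "nat \<Rightarrow> 'g ^ 'k \<Rightarrow> real fps" where "gam i = ser (\<kappa> (en i))"
definition tor :: "nat \<Rightarrow> 'g ^ 'k \<Rightarrow> real fps" where "tor i = ser (\<kappa> (simple_coroot i))"
definition low :: "nat \<Rightarrow> 'g ^ 'k \<Rightarrow> real fps" where "low i = ser (\<kappa> (ep i))"

lemma kappa_cartan_nil:
  assumes "H \<in> \<hh>" shows "x \<in> nilp \<Longrightarrow> \<kappa> H x = 0" "x \<in> niln \<Longrightarrow> \<kappa> H x = 0"
  using kappa_nilp_borelp[of x H] kappa_niln_boreln[of x H] cartan_borel[OF assms] kappa_sym[of H x]
  by auto

lemma coordinate_pairings:
  assumes "i \<in> {1..n}" "j \<in> {1..n}"
  shows "\<kappa> (coweight i) (simple_coroot j) = (if i = j then 1 else 0)" "\<kappa> (coweight i) (ep j) = 0"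
    "\<kappa> (en i) (simple_coroot j) = 0" "\<kappa> (en i) (ep j) = (if i = j then 1 else 0)"
    "\<kappa> (simple_coroot i) (coweight j) = (if i = j then 1 else 0)" "\<kappa> (simple_coroot i) (en j) = 0"
    "\<kappa> (ep i) (coweight j) = 0" "\<kappa> (ep i) (en j) = (if i = j then 1 else 0)"
  using kappa_simple_coroot_coweight[OF assms] kappa_simple_coroot_coweight[OF assms(2,1)]
    kappa_simple_root_vectors[OF assms] kappa_simple_root_vectors[OF assms(2,1)]
    kappa_sym[of "coweight i"] kappa_sym[of "en i" "ep j"]
    kappa_cartan_nil[OF coweight_cartan[OF assms(1)]] kappa_cartan_nil[OF coweight_cartan[OF assms(2)]]
    kappa_cartan_nil[OF simple_coroot_cartan[OF assms(1)]] kappa_cartan_nil[OF simple_coroot_cartan[OF assms(2)]]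
    kappa_sym[of "en i" "simple_coroot j"] kappa_sym[of "ep i" "coweight j"]
    en_niln[OF assms(1)] en_niln[OF assms(2)] ep_nilp[OF assms(1)] ep_nilp[OF assms(2)]
  by (auto split: if_splits)

lemma coordinates_Nbar:
  assumes "i \<in> {1..n}" "z \<in> Nbar" shows "rho i z = 0" "gam i z = 0"
  unfolding rho_def gam_def
  using kappa_cartan_nil(2)[OF coweight_cartan[OF assms(1)]] kappa_niln_boreln[OF en_niln[OF assms(1)]]
    nil_borel(2)
  by (auto intro!: ser_zero[OF _ assms(2)])

lemma agree_sum_delta:
  assumes "i \<in> {1..n}" "\<And>j. j \<in> {1..n} \<Longrightarrow> agree (p j) (fps_const (if i = j then 1 else 0) * q j)"
  shows "agree (\<Sum>j=1..n. p j) (q i)"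
proof -
  have "agree (\<Sum>j=1..n. p j) (\<Sum>j=1..n. fps_const (if i = j then 1 else 0) * q j)"
    by (rule agree_sum) (rule assms(2))
  also have "(\<Sum>j=1..n. fps_const (if i = j then 1 else 0) * q j) = (\<Sum>j=1..n. if i = j then q j else 0)"
    by (intro sum.cong) auto
  also have "\<dots> = q i" using assms(1) by simp
  finally show ?thesis .
qed

lemma agree_sum_zero: "(\<And>j. j \<in> I \<Longrightarrow> agree (p j) 0) \<Longrightarrow> agree (\<Sum>j\<in>I. p j) 0"
  using agree_sum[of I p "\<lambda>_. 0"] by simp

lemma ser_kappa_tens: "agree (ser (\<kappa> x) (tens p y)) (fps_const (\<kappa> x y) * p)"
  by (rule ser_tens[OF linear_kappa])

lemma ser_kappa_dual:
  assumes i: "i \<in> {1..n}" and "\<And>j. j \<in> {1..n} \<Longrightarrow> \<kappa> x (y j) = (if i = j then 1 else 0)"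
    and "\<And>j. j \<in> {1..n} \<Longrightarrow> \<kappa> x (z j) = 0"
  shows "agree (ser (\<kappa> x) ((\<Sum>j=1..n. tens (p j) (y j)) + (\<Sum>j=1..n. tens (q j) (z j)))) (p i)"
proof -
  have "agree (\<Sum>j=1..n. ser (\<kappa> x) (tens (p j) (y j))) (p i)"
    by (rule agree_sum_delta[OF i]) (use ser_kappa_tens assms(2) in metis)
  moreover have "agree (\<Sum>j=1..n. ser (\<kappa> x) (tens (q j) (z j))) 0"
  proof (rule agree_sum_zero)
    fix j assume "j \<in> {1..n}"
    then show "agree (ser (\<kappa> x) (tens (q j) (z j))) 0"
      using ser_kappa_tens[of x "q j" "z j"] assms(3) by simp
  qed
  ultimately show ?thesis
    using agree_add by (fastforce simp: ser_add[OF linear_kappa] ser_sum[OF linear_kappa])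
qed

lemma coordinates_J:
  assumes "i \<in> {1..n}" shows "agree (rho i (J r g)) (r i)" "agree (gam i (J r g)) (g i)"
proof -
  show "agree (rho i (J r g)) (r i)"
    unfolding rho_def J_def by (rule ser_kappa_dual) (use assms in \<open>simp_all only: coordinate_pairings\<close>)
  show "agree (gam i (J r g)) (g i)"
    unfolding gam_def J_def
    by (subst add.commute, rule ser_kappa_dual) (use assms in \<open>simp_all only: coordinate_pairings\<close>)
qed

text \<open>
  The element of \<open>Bbar\<close> with prescribed pairings \<open>tor\<close> and \<open>low\<close>; it realizes every motion of the orbit.
\<close>

definition K :: "(nat \<Rightarrow> real fps) \<Rightarrow> (nat \<Rightarrow> real fps) \<Rightarrow> 'g ^ 'k" where
  "K a x = (\<Sum>i=1..n. tens (a i) (coweight i)) + (\<Sum>i=1..n. tens (x i) (en i))"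

lemma K_Bbar: "K a x \<in> Bbar"
  unfolding K_def
  by (intro subspace_add subspace_sum sub_Bbar tens_current subspace_boreln cartan_borel nil_borel
      coweight_cartan en_niln)

lemma tor_low_K:
  assumes "i \<in> {1..n}" shows "agree (tor i (K a x)) (a i)" "agree (low i (K a x)) (x i)"
proof -
  show "agree (tor i (K a x)) (a i)"
    unfolding tor_def K_def by (rule ser_kappa_dual) (use assms in \<open>simp_all only: coordinate_pairings\<close>)
  show "agree (low i (K a x)) (x i)"
    unfolding low_def K_def
    by (subst add.commute, rule ser_kappa_dual) (use assms in \<open>simp_all only: coordinate_pairings\<close>)
qed

lemma J_cong:
  assumes "\<And>i. i \<in> {1..n} \<Longrightarrow> agree (r i) (r' i)" "\<And>i. i \<in> {1..n} \<Longrightarrow> agree (g i) (g' i)"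
  shows "J r g = J r' g'"
  unfolding J_def using assms by (auto intro!: arg_cong2[of _ _ _ _ "(+)"] sum.cong tens_cong)

lemma J_linear: "J r g + J r' g' = J (\<lambda>i. r i + r' i) (\<lambda>i. g i + g' i)"
  "c *\<^sub>R J r g = J (\<lambda>i. fps_const c * r i) (\<lambda>i. fps_const c * g i)"
  by (simp_all add: J_def tens_simps sum.distrib scaleR_add_right scaleR_sum_right)

lemma subspace_V: "subspace V"
proof -
  have "J (\<lambda>_. 0) (\<lambda>_. 0) = 0" by (simp add: J_def tens_simps)
  then show ?thesis unfolding subspace_def V_def by (auto simp: J_linear) (metis rangeI case_prod_conv)+
qed

lemma V_coordinates: "v \<in> V \<Longrightarrow> J (\<lambda>i. rho i v) (\<lambda>i. gam i v) = v"
  using coordinates_J by (auto simp: V_def intro!: J_cong)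

lemma J_mem_V [simp]: "J r g \<in> V" by (auto simp: V_def)

text \<open>
  The whole geometry of the orbit is contained in this formula: modulo \<open>Nbar\<close> the vector
  \<open>(r_i, g_i)\<close> is sent to \<open>(- low_i g_i, tor_i g_i)\<close>, where products are those of
  \<open>\<real>[t]/(t^(l+1))\<close> and different \<open>i\<close> do not interact.
\<close>

lemma brl_J_mod_Nbar:
  assumes u: "u \<in> Bbar"
  shows "brl u (J r g) - J (\<lambda>i. - (low i u * g i)) (\<lambda>i. tor i u * g i) \<in> Nbar"
proof -
  have lin: "linear (brl u)" using bilinear_brl by (simp add: bilinear_def)
  have 1: "brl u (tens (r i) (simple_coroot i)) \<in> Nbar" if i: "i \<in> {1..n}" for i
    unfolding current_subspace_def mem_Collect_eq current_bracket_tens[OF bilinear_br]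
    using u boreln_simple_coroot[OF i]
    by (auto intro!: subspace_sum subspace_scale subspace_niln simp: current_subspace_def)
  have 2: "brl u (tens (g i) (ep i)) -
      (tens (tor i u * g i) (ep i) - tens (low i u * g i) (simple_coroot i)) \<in> Nbar"
    if i: "i \<in> {1..n}" for i
    unfolding current_subspace_def mem_Collect_eq
  proof
    fix k
    let ?P = "{(a, b). deg a + deg b = deg k}"
    have "(tens (tor i u * g i) (ep i) - tens (low i u * g i) (simple_coroot i)) $ k =
      (\<Sum>(a, b)\<in>?P. fps_nth (g i) (deg b) *\<^sub>R
        (\<kappa> (simple_coroot i) (u $ a) *\<^sub>R ep i - \<kappa> (ep i) (u $ a) *\<^sub>R simple_coroot i))"
      by (simp add: tens_def tor_def low_def ser_mult_nth scaleR_sum_left sum_subtractf[symmetric]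
          case_prod_unfold scaleR_diff_right mult.commute[of "fps_nth (g i) _"])
    then have "(brl u (tens (g i) (ep i)) -
        (tens (tor i u * g i) (ep i) - tens (low i u * g i) (simple_coroot i))) $ k =
      (\<Sum>(a, b)\<in>?P. fps_nth (g i) (deg b) *\<^sub>R (br (u $ a) (ep i) -
        (\<kappa> (simple_coroot i) (u $ a) *\<^sub>R ep i - \<kappa> (ep i) (u $ a) *\<^sub>R simple_coroot i)))"
      by (simp add: current_bracket_tens[OF bilinear_br] sum_subtractf[symmetric] case_prod_unfold
          scaleR_diff_right del: vector_minus_component)
        (simp add: current_bracket_tens[OF bilinear_br] sum_subtractf case_prod_unfold scaleR_diff_right)
    also have "\<dots> \<in> niln"
      using u boreln_simple_root_vector[OF i]
      by (auto intro!: subspace_sum subspace_scale subspace_niln simp: current_subspace_def)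
    finally show "(brl u (tens (g i) (ep i)) -
        (tens (tor i u * g i) (ep i) - tens (low i u * g i) (simple_coroot i))) $ k \<in> niln" .
  qed
  have "brl u (J r g) - J (\<lambda>i. - (low i u * g i)) (\<lambda>i. tor i u * g i) =
    (\<Sum>i=1..n. brl u (tens (r i) (simple_coroot i))) + (\<Sum>i=1..n. brl u (tens (g i) (ep i)) -
      (tens (tor i u * g i) (ep i) - tens (low i u * g i) (simple_coroot i)))"
    unfolding J_def linear_add[OF lin] linear_sum[OF lin]
    by (simp add: tens_simps sum_subtractf sum_negf sum.distrib algebra_simps)
  also have "\<dots> \<in> Nbar" by (intro subspace_add subspace_sum sub_Nbar 1 2)
  finally show ?thesis .
qed

subsection \<open>The orbit\<close>

text \<open>
  The points whose projection is \<open>f\<close> plus a tangent vector. It is stable under \<open>Bbar\<close>, so group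
  elements can be followed inside \<open>S\<close> and projected once at the end.
\<close>

definition S :: "('g ^ 'k) set" where "S = {v + z | v z. v \<in> V \<and> z \<in> Nbar}"

lemma subspace_S: "subspace S"
  unfolding S_def by (intro subspace_sums subspace_V sub_Nbar)

lemma S_coordinates:
  assumes "z \<in> S" shows "z - J (\<lambda>i. rho i z) (\<lambda>i. gam i z) \<in> Nbar"
proof -
  obtain v w where vw: "v \<in> V" "w \<in> Nbar" "z = v + w" using assms by (auto simp: S_def)
  have "rho i z = rho i v" "gam i z = gam i v" if "i \<in> {1..n}" for i
    using coordinates_Nbar[OF that vw(2)] vw(3)
    by (simp_all add: rho_def gam_def ser_add[OF linear_kappa])
  then have "J (\<lambda>i. rho i z) (\<lambda>i. gam i z) = J (\<lambda>i. rho i v) (\<lambda>i. gam i v)"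
    by (intro J_cong) auto
  then show ?thesis using V_coordinates[OF vw(1)] vw by simp
qed

lemma component_S: "z \<in> S \<Longrightarrow> component Bl Nbar z = J (\<lambda>i. rho i z) (\<lambda>i. gam i z)"
  by (rule pos.component_unique[OF J_Bl S_coordinates])

lemma ad_S:
  assumes u: "u \<in> Bbar" and z: "z \<in> S"
  shows "brl u z \<in> S"
    and "brl u z - J (\<lambda>i. - (low i u * gam i z)) (\<lambda>i. tor i u * gam i z) \<in> Nbar"
    and "i \<in> {1..n} \<Longrightarrow> agree (rho i (brl u z)) (- (low i u * gam i z))"
    and "i \<in> {1..n} \<Longrightarrow> agree (gam i (brl u z)) (tor i u * gam i z)"
proof -
  let ?r = "\<lambda>i. - (low i u * gam i z)" and ?g = "\<lambda>i. tor i u * gam i z"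
  let ?z = "J (\<lambda>i. rho i z) (\<lambda>i. gam i z)"
  have "brl u (z - ?z) + (brl u ?z - J ?r ?g) \<in> Nbar"
    by (intro subspace_add sub_Nbar brl_Bbar_Nbar u S_coordinates z brl_J_mod_Nbar)
  then show N: "brl u z - J ?r ?g \<in> Nbar" by (simp add: brl_simps)
  have "brl u z = J ?r ?g + (brl u z - J ?r ?g)" by simp
  then show "brl u z \<in> S" unfolding S_def using N J_mem_V by blast
  assume i: "i \<in> {1..n}"
  have "rho i (brl u z) = rho i (J ?r ?g)" "gam i (brl u z) = gam i (J ?r ?g)"
    using coordinates_Nbar[OF i N] by (simp_all add: rho_def gam_def ser_diff[OF linear_kappa])
  then show "agree (rho i (brl u z)) (?r i)" "agree (gam i (brl u z)) (?g i)"
    using coordinates_J[OF i, of ?r ?g] by simp_all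
qed

lemma ad_power_S:
  assumes u: "u \<in> Bbar" and z: "z \<in> S"
  shows "(brl u ^^ k) z \<in> S"
    and "i \<in> {1..n} \<Longrightarrow> agree (gam i ((brl u ^^ k) z)) (tor i u ^ k * gam i z)"
    and "i \<in> {1..n} \<Longrightarrow> agree (rho i ((brl u ^^ Suc k) z)) (- (low i u * (tor i u ^ k * gam i z)))"
proof -
  show S: "(brl u ^^ k) z \<in> S" for k by (induction k) (use ad_S(1)[OF u] z in auto)
  assume i: "i \<in> {1..n}"
  show g: "agree (gam i ((brl u ^^ k) z)) (tor i u ^ k * gam i z)" for k
  proof (induction k)
    case (Suc k)
    have "agree (gam i (brl u ((brl u ^^ k) z))) (tor i u * gam i ((brl u ^^ k) z))"
      by (rule ad_S(4)[OF u S i])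
    also have "agree \<dots> (tor i u * (tor i u ^ k * gam i z))" by (rule agree_mult[OF agree_refl Suc])
    finally show ?case by (simp add: mult.assoc)
  qed simp
  have "agree (rho i (brl u ((brl u ^^ k) z))) (- (low i u * gam i ((brl u ^^ k) z)))"
    by (rule ad_S(3)[OF u S i])
  also have "agree \<dots> (- (low i u * (tor i u ^ k * gam i z)))"
    by (rule agree_minus[OF agree_mult[OF agree_refl g]])
  finally show "agree (rho i ((brl u ^^ Suc k) z)) (- (low i u * (tor i u ^ k * gam i z)))" by simp
qed

lemma exp_S:
  assumes u: "u \<in> Bbar" and z: "z \<in> S"
  shows "exp_ad brl u z \<in> S"
    and "i \<in> {1..n} \<Longrightarrow> j \<le> l \<Longrightarrow>
      fps_nth (gam i (exp_ad brl u z)) j = (\<Sum>k. fps_nth (tor i u ^ k * gam i z) j / fact k)"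
proof -
  show "exp_ad brl u z \<in> S"
    by (rule exp_ad_invariant_subspace[OF bilinear_brl subspace_S ad_S(1)[OF u] z])
  assume ij: "i \<in> {1..n}" "j \<le> l"
  have lin: "linear (\<lambda>X. fps_nth (gam i X) j)"
    unfolding gam_def linear_conv_bounded_linear by (rule bounded_linear_ser_nth[OF linear_kappa])
  show "fps_nth (gam i (exp_ad brl u z)) j = (\<Sum>k. fps_nth (tor i u ^ k * gam i z) j / fact k)"
    unfolding exp_ad_functional(2)[OF bilinear_brl lin]
    using agreeD[OF ad_power_S(2)[OF u z ij(1)] ij(2)] by simp
qed

text \<open>
  The action on \<open>gam i\<close> is multiplication by \<open>exp (s_i t^d)\<close>. For \<open>d > 0\<close> this leaves the coefficients
  below \<open>t^d\<close> alone and shifts that of \<open>t^d\<close> by \<open>s_i\<close> times the leading one.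
\<close>

lemma exp_torus:
  fixes s :: "nat \<Rightarrow> real"
  assumes z: "z \<in> S" and i: "i \<in> {1..n}" and d: "d \<le> l"
  defines "z' \<equiv> exp_ad brl (K (\<lambda>i. fps_const (s i) * fps_X ^ d) (\<lambda>_. 0)) z"
  shows "j < d \<Longrightarrow> fps_nth (gam i z') j = fps_nth (gam i z) j"
    and "d = 0 \<Longrightarrow> fps_nth (gam i z') 0 = exp (s i) * fps_nth (gam i z) 0"
    and "d \<noteq> 0 \<Longrightarrow> fps_nth (gam i z') d = fps_nth (gam i z) d + s i * fps_nth (gam i z) 0"
proof -
  let ?u = "K (\<lambda>i. fps_const (s i) * fps_X ^ d) (\<lambda>_. 0)"
  have t: "agree (tor i ?u) (fps_const (s i) * fps_X ^ d)" by (rule tor_low_K(1)[OF i])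
  have pow: "agree (tor i ?u ^ k) ((fps_const (s i) * fps_X ^ d) ^ k)" for k
    by (induction k) (auto intro: agree_mult[OF t])
  have pw: "(fps_const (s i) * fps_X ^ d) ^ k * gam i z = fps_const (s i ^ k) * (fps_X ^ (d * k) * gam i z)" for k
    by (simp add: power_mult_distrib fps_const_power power_mult mult.assoc)
  have co: "fps_nth (tor i ?u ^ k * gam i z) j =
      (if j < d * k then 0 else s i ^ k * fps_nth (gam i z) (j - d * k))" if "j \<le> l" for j k
    using agreeD[OF agree_mult[OF pow agree_refl] that] by (simp add: pw fps_X_power_mult_nth)
  have ex: "fps_nth (gam i z') j =
      (\<Sum>k. (if j < d * k then 0 else s i ^ k * fps_nth (gam i z) (j - d * k)) / fact k)" if "j \<le> l" for j
    unfolding z'_def exp_S(2)[OF K_Bbar z i that] using co[OF that] by simp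
  show "fps_nth (gam i z') j = fps_nth (gam i z) j" if j: "j < d"
  proof -
    have "fps_nth (gam i z') j = (\<Sum>k\<in>{0}. (if j < d * k then 0 else s i ^ k * fps_nth (gam i z) (j - d * k)) / fact k)"
    proof (subst ex)
      show "j \<le> l" using j d by simp
      show "(\<Sum>k. (if j < d * k then 0 else s i ^ k * fps_nth (gam i z) (j - d * k)) / fact k) =
        (\<Sum>k\<in>{0}. (if j < d * k then 0 else s i ^ k * fps_nth (gam i z) (j - d * k)) / fact k)"
      proof (rule suminf_finite)
        fix k :: nat assume "k \<notin> {0}"
        then have "j < d * k" using j by (cases k) auto
        then show "(if j < d * k then 0 else s i ^ k * fps_nth (gam i z) (j - d * k)) / fact k = 0"
          by simp
      qed simp
    qed
    then show ?thesis by simp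
  qed
  show "fps_nth (gam i z') 0 = exp (s i) * fps_nth (gam i z) 0" if "d = 0"
  proof -
    have "fps_nth (gam i z') 0 = (\<Sum>k. (s i ^ k /\<^sub>R fact k) * fps_nth (gam i z) 0)"
      using ex[of 0] that by (simp add: field_simps)
    also have "\<dots> = exp (s i) * fps_nth (gam i z) 0"
      unfolding exp_def by (rule suminf_mult2[symmetric]) (rule summable_exp_generic)
    finally show ?thesis .
  qed
  show "fps_nth (gam i z') d = fps_nth (gam i z) d + s i * fps_nth (gam i z) 0" if d0: "d \<noteq> 0"
  proof -
    have "fps_nth (gam i z') d =
      (\<Sum>k\<in>{0, 1}. (if d < d * k then 0 else s i ^ k * fps_nth (gam i z) (d - d * k)) / fact k)"
      unfolding ex[OF d]
    proof (rule suminf_finite)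
      fix k :: nat assume "k \<notin> {0, 1}"
      then have "d * 2 \<le> d * k" by (intro mult_le_mono) auto
      then show "(if d < d * k then 0 else s i ^ k * fps_nth (gam i z) (d - d * k)) / fact k = 0"
        using d0 by simp
    qed simp
    then show ?thesis by simp
  qed
qed

text \<open>
  The square of \<open>ad\<close> of such an element vanishes modulo \<open>Nbar\<close>, so the exponential stops after its
  linear term.
\<close>

lemma exp_lower:
  fixes x :: "nat \<Rightarrow> real fps"
  assumes z: "z \<in> S" and i: "i \<in> {1..n}"
  defines "z' \<equiv> exp_ad brl (K (\<lambda>_. 0) x) z"
  shows "agree (gam i z') (gam i z)" and "agree (rho i z') (rho i z - x i * gam i z)"
proof -
  let ?u = "K (\<lambda>_. 0) x"
  have t: "agree (tor i ?u) 0" by (rule tor_low_K(1)[OF i])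
  have t': "agree (tor i ?u ^ k) (if k = 0 then 1 else 0)" for k
    using agree_mult[OF t agree_refl] by (cases k) auto
  have co: "fps_nth (tor i ?u ^ k * gam i z) j = (if k = 0 then fps_nth (gam i z) j else 0)" if "j \<le> l" for j k
    using agreeD[OF agree_mult[OF t'[of k] agree_refl[of "gam i z"]] that] by auto
  show "agree (gam i z') (gam i z)"
  proof (rule agreeI)
    fix j assume j: "j \<le> l"
    have "fps_nth (gam i z') j = (\<Sum>k\<in>{0}. fps_nth (tor i ?u ^ k * gam i z) j / fact k)"
      unfolding z'_def exp_S(2)[OF K_Bbar z i j] by (rule suminf_finite) (auto simp: co[OF j])
    then show "fps_nth (gam i z') j = fps_nth (gam i z) j" by simp
  qed
  have lo: "agree (low i ?u) (x i)" by (rule tor_low_K(2)[OF i])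
  have ro: "agree (rho i ((brl ?u ^^ Suc k) z)) (if k = 0 then - (x i * gam i z) else 0)" for k
  proof -
    have "agree (rho i ((brl ?u ^^ Suc k) z)) (- (low i ?u * (tor i ?u ^ k * gam i z)))"
      by (rule ad_power_S(3)[OF K_Bbar z i])
    also have "agree \<dots> (- (x i * ((if k = 0 then 1 else 0) * gam i z)))"
      by (intro agree_minus agree_mult lo t' agree_refl)
    finally show ?thesis by (auto split: if_splits)
  qed
  show "agree (rho i z') (rho i z - x i * gam i z)"
  proof (rule agreeI)
    fix j assume j: "j \<le> l"
    have lin: "linear (\<lambda>X. fps_nth (rho i X) j)"
      unfolding rho_def linear_conv_bounded_linear by (rule bounded_linear_ser_nth[OF linear_kappa])
    have "fps_nth (rho i z') j = (\<Sum>k\<in>{0, 1}. fps_nth (rho i ((brl ?u ^^ k) z)) j / fact k)"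
      unfolding z'_def exp_ad_functional(2)[OF bilinear_brl lin]
    proof (rule suminf_finite)
      fix k :: nat assume "k \<notin> {0, 1}"
      then obtain m where "k = Suc (Suc m)" by (metis insertCI not0_implies_Suc One_nat_def)
      then show "fps_nth (rho i ((brl ?u ^^ k) z)) j / fact k = 0"
        using agreeD[OF ro[of "Suc m"] j] by simp
    qed simp
    then show "fps_nth (rho i z') j = fps_nth (rho i z - x i * gam i z) j"
      using agreeD[OF ro[of 0] j] by simp
  qed
qed

lemma component_F: "component F Nbar z = f + component Bl Nbar z"
  unfolding F_def by (rule pos.component_translate[OF f_Nbar])

definition base :: "'g ^ 'k" where "base = f + J (\<lambda>_. 0) (\<lambda>_. 1)"

lemma f_J_S: "f + J r g \<in> S"
  unfolding S_def using f_Nbar J_mem_V add.commute[of f] by blast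

lemma coordinates_f_J:
  assumes "i \<in> {1..n}" shows "agree (rho i (f + J r g)) (r i)" "agree (gam i (f + J r g)) (g i)"
  using coordinates_J[OF assms, of r g] coordinates_Nbar[OF assms f_Nbar]
  by (simp_all add: rho_def gam_def ser_add[OF linear_kappa])

text \<open>
  An exponential multiplies the leading coefficient of each \<open>gam i\<close> by a positive number.
\<close>

lemma group_base:
  assumes "a \<in> adjoint_group brl Bbar"
  shows "a base \<in> S \<and> (\<forall>i\<in>{1..n}. fps_nth (gam i (a base)) 0 > 0)"
  using assms
proof induction
  case one
  have "fps_nth (gam i base) 0 = 1" if "i \<in> {1..n}" for i
    unfolding base_def using agreeD[OF coordinates_f_J(2)[OF that]] by simp
  then show ?case using f_J_S by (simp add: base_def)
next
  case (step a u)
  then have S: "a base \<in> S" by blast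
  have "fps_nth (gam i (exp_ad brl u (a base))) 0 > 0" if i: "i \<in> {1..n}" for i
  proof -
    let ?c = "fps_nth (tor i u) 0" and ?g = "fps_nth (gam i (a base)) 0"
    have "fps_nth (gam i (exp_ad brl u (a base))) 0 = (\<Sum>k. (?c ^ k /\<^sub>R fact k) * ?g)"
      using exp_S(2)[OF step(2) S i, of 0] by (simp add: fps_power_zeroth field_simps)
    also have "\<dots> = exp ?c * ?g"
      unfolding exp_def by (rule suminf_mult2[symmetric]) (rule summable_exp_generic)
    finally show ?thesis using step.IH i by simp
  qed
  then show ?case using exp_S(1)[OF step(2) S] by simp
qed

text \<open>
  Elements of the Cartan part adjust the coefficients of the \<open>gam i\<close> in increasing degree. After that a
  combination of the \<open>e_(-\<alpha>_i)\<close> moves the \<open>rho i\<close> to their targets without disturbing the \<open>gam i\<close>;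
  solving for its coefficients uses that each \<open>gam i\<close> is a unit.
\<close>

lemma group_reaches:
  assumes pos: "\<And>i. i \<in> {1..n} \<Longrightarrow> fps_nth (g i) 0 > 0"
  shows "\<exists>a\<in>adjoint_group brl Bbar. \<forall>i\<in>{1..n}. agree (rho i (a base)) (r i) \<and> agree (gam i (a base)) (g i)"
proof -
  have "\<exists>a\<in>adjoint_group brl Bbar. \<forall>i\<in>{1..n}. \<forall>j<d. fps_nth (gam i (a base)) j = fps_nth (g i) j"
    if "d \<le> Suc l" for d
    using that
  proof (induction d)
    case 0
    show ?case using adjoint_group.one by auto
  next
    case (Suc d)
    then obtain a where a: "a \<in> adjoint_group brl Bbar"
      "\<And>i j. i \<in> {1..n} \<Longrightarrow> j < d \<Longrightarrow> fps_nth (gam i (a base)) j = fps_nth (g i) j" by auto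
    have z: "a base \<in> S" "\<And>i. i \<in> {1..n} \<Longrightarrow> fps_nth (gam i (a base)) 0 > 0"
      using group_base[OF a(1)] by auto
    \<comment> \<open>The exponent that corrects the coefficient of t^d: it acts multiplicatively for d = 0
      and additively for d > 0.\<close>
    define s where "s i = (if d = 0 then ln (fps_nth (g i) 0 / fps_nth (gam i (a base)) 0)
      else (fps_nth (g i) d - fps_nth (gam i (a base)) d) / fps_nth (gam i (a base)) 0)" for i
    let ?u = "K (\<lambda>i. fps_const (s i) * fps_X ^ d) (\<lambda>_. 0)"
    have "fps_nth (gam i (exp_ad brl ?u (a base))) j = fps_nth (g i) j"
      if i: "i \<in> {1..n}" and j: "j < Suc d" for i j
    proof -
      have dl: "d \<le> l" using Suc.prems by simp
      note ex = exp_torus[OF z(1) i dl, where s = s]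
      consider "j < d" | "j = d" "d = 0" | "j = d" "d \<noteq> 0" using j by linarith
      then show ?thesis
      proof cases
        case 1 then show ?thesis using ex(1)[OF 1] a(2)[OF i 1] by simp
      next
        case 2 then show ?thesis using ex(2) z(2)[OF i] pos[OF i] by (simp add: s_def exp_ln)
      next
        case 3 then show ?thesis using ex(3) z(2)[OF i] by (simp add: s_def)
      qed
    qed
    then show ?case
      using adjoint_group.step[OF a(1) K_Bbar[of "\<lambda>i. fps_const (s i) * fps_X ^ d" "\<lambda>_. 0"]]
      by (intro bexI[of _ "exp_ad brl ?u \<circ> a"]) auto
  qed
  from this[of "Suc l"] obtain a where a: "a \<in> adjoint_group brl Bbar"
    "\<And>i. i \<in> {1..n} \<Longrightarrow> agree (gam i (a base)) (g i)" by (auto simp: agree_def less_Suc_eq_le)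
  \<comment> \<open>By exp_lower this changes rho i by r i - rho i.\<close>
  define x where "x i = (rho i (a base) - r i) * inverse (g i)" for i
  let ?u = "K (\<lambda>_. 0) x"
  have S: "a base \<in> S" using group_base[OF a(1)] by blast
  have "agree (rho i (exp_ad brl ?u (a base))) (r i) \<and> agree (gam i (exp_ad brl ?u (a base))) (g i)"
    if i: "i \<in> {1..n}" for i
  proof
    show "agree (gam i (exp_ad brl ?u (a base))) (g i)"
      using exp_lower(1)[OF S i] a(2)[OF i] by (rule agree_trans)
    have "agree (rho i (exp_ad brl ?u (a base))) (rho i (a base) - x i * gam i (a base))"
      by (rule exp_lower(2)[OF S i])
    also have "agree \<dots> (rho i (a base) - x i * g i)"
      by (intro agree_diff agree_mult agree_refl a(2) i)
    also have "x i * g i = (rho i (a base) - r i)"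
      unfolding x_def mult.assoc using pos[OF i] by (simp add: inverse_mult_eq_1)
    finally show "agree (rho i (exp_ad brl ?u (a base))) (r i)" by simp
  qed
  then show ?thesis
    using adjoint_group.step[OF a(1) K_Bbar[of "\<lambda>_. 0" x]]
    by (intro bexI[of _ "exp_ad brl ?u \<circ> a"]) auto
qed

lemma Z_orbit: "Z = proj_orbit F Nbar (adjoint_group brl Bbar) base"
proof -
  have act: "proj_action F Nbar a base = f + J (\<lambda>i. rho i (a base)) (\<lambda>i. gam i (a base))"
    if "a \<in> adjoint_group brl Bbar" for a
    using component_S group_base[OF that] by (simp add: proj_action_def component_F)
  show ?thesis
  proof (intro subset_antisym subsetI)
    fix y assume "y \<in> Z"
    then obtain r g where rg: "y = f + J r g" "\<And>i. i \<in> {1..n} \<Longrightarrow> fps_nth (g i) 0 > 0"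
      unfolding Z_def by blast
    obtain a where a: "a \<in> adjoint_group brl Bbar"
      "\<forall>i\<in>{1..n}. agree (rho i (a base)) (r i) \<and> agree (gam i (a base)) (g i)"
      using group_reaches[of g r] rg(2) by blast
    have "y = proj_action F Nbar a base"
      unfolding act[OF a(1)] rg(1) using a(2) by (auto intro!: J_cong intro: agree_sym)
    then show "y \<in> proj_orbit F Nbar (adjoint_group brl Bbar) base"
      using a(1) unfolding proj_orbit_def by blast
  next
    fix y assume "y \<in> proj_orbit F Nbar (adjoint_group brl Bbar) base"
    then obtain a where "a \<in> adjoint_group brl Bbar" "y = proj_action F Nbar a base"
      unfolding proj_orbit_def by blast
    then show "y \<in> Z" using act group_base unfolding Z_def by blast
  qed
qed

lemma base_F: "base \<in> F"
  unfolding base_def F_def using J_Bl by blast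

end

context jacobi_setting
begin

section \<open>The symplectic form\<close>

lemma infinitesimal_component:
  "infinitesimal_action brl F Nbar u y = component Bl Nbar (brl u y)"
proof -
  have bl: "bounded_linear (component Bl Nbar)"
    using pos.linear_component by (rule linear_conv_bounded_linear[THEN iffD1])
  have "((\<lambda>s. f + component Bl Nbar (exp_ad brl (s *\<^sub>R u) y)) has_vector_derivative
      0 + component Bl Nbar (brl u y)) (at 0)"
    by (intro has_vector_derivative_add has_vector_derivative_const
        bounded_linear.has_vector_derivative[OF bl] exp_ad_scale_has_derivative bilinear_brl)
  then show ?thesis
    unfolding infinitesimal_action_def proj_action_def component_F
    by (simp add: vector_derivative_at)
qed

abbreviation xi :: "'g ^ 'k \<Rightarrow> 'g ^ 'k \<Rightarrow> 'g ^ 'k" where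
  "xi u y \<equiv> infinitesimal_action brl F Nbar u y"

lemma xi_S: "u \<in> Bbar \<Longrightarrow> z \<in> S \<Longrightarrow> xi u z = J (\<lambda>i. - (low i u * gam i z)) (\<lambda>i. tor i u * gam i z)"
  unfolding infinitesimal_component by (intro pos.component_unique J_Bl ad_S)

lemma xi_V: "u \<in> Bbar \<Longrightarrow> z \<in> S \<Longrightarrow> xi u z \<in> V"
  by (simp add: xi_S)

lemma xi_coordinates:
  assumes "u \<in> Bbar" "z \<in> S" "i \<in> {1..n}"
  shows "agree (rho i (xi u z)) (- (low i u * gam i z))" "agree (gam i (xi u z)) (tor i u * gam i z)"
  unfolding xi_S[OF assms(1,2)] by (rule coordinates_J[OF assms(3)])+

lemma brl_xi: "u \<in> Bbar \<Longrightarrow> z \<in> S \<Longrightarrow> brl u z - xi u z \<in> Nbar"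
  unfolding infinitesimal_component by (rule pos.component_diff)

lemma Z_S: "y \<in> Z \<Longrightarrow> y \<in> S"
  using f_J_S by (auto simp: Z_def)

lemma Z_unit: "y \<in> Z \<Longrightarrow> i \<in> {1..n} \<Longrightarrow> fps_nth (gam i y) 0 > 0"
  using agreeD[OF coordinates_f_J(2)] by (auto simp: Z_def)

lemma Z_inverse: "y \<in> Z \<Longrightarrow> i \<in> {1..n} \<Longrightarrow> inverse (gam i y) * gam i y = 1"
  using Z_unit[of y i] by (simp add: inverse_mult_eq_1)

lemma Z_line:
  assumes "y \<in> Z" "v \<in> V" shows "\<forall>\<^sub>F s in nhds 0. y + s *\<^sub>R v \<in> Z"
proof -
  obtain r g r' g' where y: "y = f + J r g" "\<And>i. i \<in> {1..n} \<Longrightarrow> fps_nth (g i) 0 > 0"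
    and v: "v = J r' g'" using assms by (auto simp: Z_def V_def)
  have "\<forall>\<^sub>F s in nhds 0. \<forall>i\<in>{1..n}. fps_nth (g i) 0 + s * fps_nth (g' i) 0 > 0"
  proof (rule eventually_ball_finite, simp, rule ballI)
    fix i assume "i \<in> {1..n}"
    have "((\<lambda>s. fps_nth (g i) 0 + s * fps_nth (g' i) 0) \<longlongrightarrow> fps_nth (g i) 0 + 0 * fps_nth (g' i) 0) (nhds 0)"
      by (intro tendsto_intros filterlim_ident)
    then show "\<forall>\<^sub>F s in nhds 0. fps_nth (g i) 0 + s * fps_nth (g' i) 0 > 0"
      using y(2)[OF \<open>i \<in> {1..n}\<close>] by (intro order_tendstoD(1)) auto
  qed
  then show ?thesis
  proof eventually_elim
    case (elim s)
    have "y + s *\<^sub>R v = f + J (\<lambda>i. r i + fps_const s * r' i) (\<lambda>i. g i + fps_const s * g' i)"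
      by (simp add: y v J_linear add.assoc)
    then show ?case unfolding Z_def using elim by fastforce
  qed
qed

text \<open>The infinitesimal action at a point of \<open>Z\<close> is onto because each \<open>gam i y\<close> is a unit.\<close>

lemma xi_surj:
  assumes y: "y \<in> Z" and v: "v \<in> V"
  shows "\<exists>u\<in>Bbar. xi u y = v"
proof -
  define a where "a i = inverse (gam i y) * gam i v" for i
  define x where "x i = - (inverse (gam i y) * rho i v)" for i
  have "xi (K a x) y = J (\<lambda>i. rho i v) (\<lambda>i. gam i v)"
    unfolding xi_S[OF K_Bbar Z_S[OF y]]
  proof (rule J_cong)
    fix i assume i: "i \<in> {1..n}"
    have "agree (- (low i (K a x) * gam i y)) (- (x i * gam i y))"
      by (intro agree_minus agree_mult tor_low_K i agree_refl)
    also have "- (x i * gam i y) = (inverse (gam i y) * gam i y) * rho i v"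
      by (simp add: x_def algebra_simps)
    finally show "agree (- (low i (K a x) * gam i y)) (rho i v)" by (simp add: Z_inverse[OF y i])
    have "agree (tor i (K a x) * gam i y) (a i * gam i y)"
      by (intro agree_mult tor_low_K i agree_refl)
    also have "a i * gam i y = (inverse (gam i y) * gam i y) * gam i v"
      by (simp add: a_def algebra_simps)
    finally show "agree (tor i (K a x) * gam i y) (gam i v)" by (simp add: Z_inverse[OF y i])
  qed
  then show ?thesis using V_coordinates[OF v] K_Bbar by metis
qed

lemma orbit_tangent_V: "y \<in> Z \<Longrightarrow> orbit_tangent brl F Nbar Bbar y = V"
  unfolding orbit_tangent_def using xi_surj xi_V Z_S by fast

text \<open>
  The candidate for the form in coordinates: the sum over \<open>i\<close> of the coefficient of \<open>t^l\<close> in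
  \<open>\<gamma>_i^(-1) d\<rho>_i \<and> d\<gamma>_i\<close>.
\<close>

definition W :: "'g ^ 'k \<Rightarrow> 'g ^ 'k \<Rightarrow> 'g ^ 'k \<Rightarrow> real" where
  "W y v w = (\<Sum>i=1..n. fps_nth (inverse (gam i y) * (rho i v * gam i w - rho i w * gam i v)) l)"

lemma Q_J: "Q (J r g) u = (\<Sum>i=1..n. fps_nth (r i * tor i u + g i * low i u) l)"
proof -
  have lin: "linear (\<lambda>x. Q x u)" using bilinear_Q by (simp add: bilinear_def)
  show ?thesis
    unfolding J_def linear_add[OF lin] linear_sum[OF lin]
    by (simp add: current_form_tens[OF bilinear_kappa] tor_def low_def sum.distrib)
qed

lemma Q_xi: "u \<in> Bbar \<Longrightarrow> u' \<in> Bbar \<Longrightarrow> y \<in> S \<Longrightarrow> Q (xi u y) u' = - Q y (brl u u')"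
proof -
  assume u: "u \<in> Bbar" "u' \<in> Bbar" and y: "y \<in> S"
  have "Q y (brl u u') = Q (brl y u) u'" by (rule Q_invariant[symmetric])
  also have "\<dots> = - Q (brl u y) u'" using brl_skew[of y u] by (simp add: Q_simps)
  also have "Q (brl u y) u' = Q (xi u y) u'"
    using Q_Nbar_Bbar[OF brl_xi[OF u(1) y] u(2)] by (simp add: Q_simps)
  finally show ?thesis by simp
qed

text \<open>
  Pairing with \<open>u\<close> only sees \<open>tor i u\<close> and \<open>low i u\<close>, and these are recovered from the coordinates of
  \<open>xi u y\<close> after division by \<open>gam i y\<close>.
\<close>

lemma Q_eq_W:
  assumes y: "y \<in> Z" and v: "v \<in> V" and u: "u \<in> Bbar"
  shows "Q v u = W y v (xi u y)"
proof -
  have "Q v u = (\<Sum>i=1..n. fps_nth (rho i v * tor i u + gam i v * low i u) l)"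
    by (metis Q_J V_coordinates[OF v])
  also have "\<dots> = W y v (xi u y)"
    unfolding W_def
  proof (rule sum.cong[OF refl])
    fix i assume i: "i \<in> {1..n}"
    note xc = xi_coordinates[OF u Z_S[OF y] i]
    have "agree (inverse (gam i y) * (rho i v * gam i (xi u y) - rho i (xi u y) * gam i v))
      (inverse (gam i y) * (rho i v * (tor i u * gam i y) - (- (low i u * gam i y)) * gam i v))"
      by (intro agree_mult agree_diff agree_refl xc)
    also have "inverse (gam i y) * (rho i v * (tor i u * gam i y) - (- (low i u * gam i y)) * gam i v)
      = (inverse (gam i y) * gam i y) * (rho i v * tor i u + gam i v * low i u)"
      by (simp add: algebra_simps)
    finally show "fps_nth (rho i v * tor i u + gam i v * low i u) l =
      fps_nth (inverse (gam i y) * (rho i v * gam i (xi u y) - rho i (xi u y) * gam i v)) l"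
      using agreeD[of _ _ l] by (simp add: Z_inverse[OF y i])
  qed
  finally show ?thesis .
qed

definition omega :: "'g ^ 'k \<Rightarrow> 'g ^ 'k \<Rightarrow> 'g ^ 'k \<Rightarrow> real" where
  "omega = kks_form brl Q F Nbar Bbar"

text \<open>
  The description of the form through generators of tangent vectors is independent of their choice,
  since it agrees with \<open>W\<close>, which is a function of the tangent vectors.
\<close>

lemma omega_eq_W:
  assumes y: "y \<in> Z" and v: "v \<in> V" and w: "w \<in> V" shows "omega y v w = W y v w"
  unfolding omega_def kks_form_def
proof (rule the_equality)
  have val: "- Q y (brl u u') = W y (xi u y) (xi u' y)" if "u \<in> Bbar" "u' \<in> Bbar" for u u'
    using Q_xi[OF that Z_S[OF y]] Q_eq_W[OF y xi_V[OF that(1) Z_S[OF y]] that(2)] by simp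
  obtain u u' where "u \<in> Bbar" "u' \<in> Bbar" "xi u y = v" "xi u' y = w"
    using xi_surj[OF y v] xi_surj[OF y w] by blast
  then show "\<exists>u\<in>Bbar. \<exists>u'\<in>Bbar. xi u y = v \<and> xi u' y = w \<and> W y v w = - Q y (brl u u')"
    using val by fastforce
  show "r = W y v w" if "\<exists>u\<in>Bbar. \<exists>u'\<in>Bbar. xi u y = v \<and> xi u' y = w \<and> r = - Q y (brl u u')" for r
    using that val by auto
qed

lemma omega_xi:
  "y \<in> Z \<Longrightarrow> v \<in> V \<Longrightarrow> u \<in> Bbar \<Longrightarrow> omega y v (xi u y) = Q v u"
  using omega_eq_W Q_eq_W xi_V Z_S by simp

lemma coordinates_linear:
  "rho i (v + w) = rho i v + rho i w" "gam i (v + w) = gam i v + gam i w"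
  "rho i (c *\<^sub>R v) = fps_const c * rho i v" "gam i (c *\<^sub>R v) = fps_const c * gam i v"
  by (simp_all add: rho_def gam_def ser_add[OF linear_kappa] ser_scale[OF linear_kappa])

lemma W_add: "W y (u + v) w = W y u w + W y v w"
  by (simp add: W_def coordinates_linear sum.distrib[symmetric] fps_add_nth[symmetric] algebra_simps
      del: fps_add_nth)

lemma W_scale: "W y (c *\<^sub>R v) w = c * W y v w"
proof -
  have eq: "inverse (gam i y) * (rho i (c *\<^sub>R v) * gam i w - rho i w * gam i (c *\<^sub>R v)) =
    fps_const c * (inverse (gam i y) * (rho i v * gam i w - rho i w * gam i v))" for i
    by (simp add: coordinates_linear algebra_simps)
  show ?thesis by (simp only: W_def eq fps_mult_left_const_nth sum_distrib_left)
qed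

lemma W_skew: "W y v w = - W y w v"
proof -
  have "inverse (gam i y) * (rho i v * gam i w - rho i w * gam i v) =
    - (inverse (gam i y) * (rho i w * gam i v - rho i v * gam i w))" for i
    by (simp add: algebra_simps)
  then show ?thesis by (simp add: W_def sum_negf)
qed

lemma Q_Bbar_zero:
  assumes v: "v \<in> V" and 0: "\<And>u. u \<in> Bbar \<Longrightarrow> Q v u = 0" shows "v = 0"
proof (rule Q_nondegenerate)
  fix y
  obtain u w where uw: "u \<in> Bbar" "w \<in> Nl" "y = u + w" using neg.spanning by blast
  then show "Q v y = 0" using 0 Q_Nl_Bl[OF uw(2) V_Bl[OF v]] Q_sym[of v w] by (simp add: Q_simps)
qed

text \<open>
  A tangent vector in the kernel is orthogonal to \<open>Bbar\<close>; lying in \<open>Bl\<close> it is also orthogonal to \<open>Nl\<close>.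
\<close>

lemma omega_nondegenerate:
  assumes y: "y \<in> Z" and v: "v \<in> V" and 0: "\<And>w. w \<in> V \<Longrightarrow> omega y v w = 0" shows "v = 0"
  using 0 omega_xi[OF y v] xi_V[OF _ Z_S[OF y]] by (intro Q_Bbar_zero[OF v]) metis

lemma bounded_linear_gam: "bounded_linear (\<lambda>z. fps_nth (gam i z) m)"
  unfolding gam_def by (rule bounded_linear_ser_nth[OF linear_kappa])

lemma bounded_linear_rho: "bounded_linear (\<lambda>z. fps_nth (rho i z) m)"
  unfolding rho_def by (rule bounded_linear_ser_nth[OF linear_kappa])

text \<open>
  The recursion for the coefficients of a reciprocal divides only by the leading coefficient, which is
  positive on \<open>Z\<close>.
\<close>

lemma rational_inverse_gam:
  assumes i: "i \<in> {1..n}"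
  shows "rational_on Z (\<lambda>z. fps_nth (inverse (gam i z)) m)"
proof (induction m rule: less_induct)
  case (less m)
  have nz: "fps_nth (gam i z) 0 \<noteq> 0" if "z \<in> Z" for z using Z_unit[OF that i] by simp
  have inv0: "rational_on Z (\<lambda>z. inverse (fps_nth (gam i z) 0))"
    by (rule rational_on.inverse[OF rational_on.linear[OF bounded_linear_gam] nz])
  show ?case
  proof (cases m)
    case 0
    then show ?thesis using inv0 by simp
  next
    case (Suc k)
    have eq: "fps_nth (inverse (gam i z)) m =
        - (inverse (fps_nth (gam i z) 0) * (\<Sum>j=1..m. fps_nth (gam i z) j * fps_nth (inverse (gam i z)) (m - j)))" for z
      using Suc by (simp add: fps_inverse_def)
    show ?thesis
      unfolding eq
      by (rule rational_on_uminus[OF rational_on.mult[OF inv0 rational_on_sum[OF rational_on.mult[OF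
              rational_on.linear[OF bounded_linear_gam] less]]]]) (use Suc in auto)
  qed
qed

lemma smooth_omega:
  assumes v: "v \<in> V" and w: "w \<in> V" shows "Ck_on k V Z (\<lambda>y. omega y v w)"
proof (rule rational_on_Ck)
  show "rational_on Z (\<lambda>y. W y v w)"
    unfolding W_def fps_mult_nth[of "inverse _"]
    by (intro rational_on_sum rational_on.mult rational_inverse_gam rational_on.const)
qed (use Z_line omega_eq_W v w in auto)

text \<open>
  Differentiating \<open>gam i y * inverse (gam i y) = 1\<close> coefficient by coefficient along \<open>V\<close>.
\<close>

lemma inverse_gam_derivative:
  assumes i: "i \<in> {1..n}" and y: "y \<in> Z"
  shows "\<exists>D. (\<forall>m. ((\<lambda>z. fps_nth (inverse (gam i z)) m) has_derivative D m) (at y)) \<and>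
    (\<forall>u\<in>V. Abs_fps (\<lambda>m. D m u) = - (inverse (gam i y) ^ 2 * gam i u))"
proof -
  have "\<exists>D. ((\<lambda>z. fps_nth (inverse (gam i z)) m) has_derivative D) (at y)" for m
    using rational_on_has_derivative[OF rational_inverse_gam[OF i, of m]] y by blast
  then obtain D where D: "\<And>m. ((\<lambda>z. fps_nth (inverse (gam i z)) m) has_derivative D m) (at y)"
    by metis
  have "Abs_fps (\<lambda>m. D m u) = - (inverse (gam i y) ^ 2 * gam i u)" if u: "u \<in> V" for u
  proof -
    let ?D = "Abs_fps (\<lambda>m. D m u)"
    have "gam i y * ?D + gam i u * inverse (gam i y) = 0"
    proof (rule fps_ext)
      fix m
      let ?\<phi> = "\<lambda>z. \<Sum>j=0..m. fps_nth (gam i z) j * fps_nth (inverse (gam i z)) (m - j)"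
      let ?D' = "\<lambda>v. \<Sum>j=0..m. fps_nth (gam i y) j * D (m - j) v +
        fps_nth (gam i v) j * fps_nth (inverse (gam i y)) (m - j)"
      have der: "(?\<phi> has_derivative ?D') (at y)"
        by (intro has_derivative_sum has_derivative_mult D bounded_linear_imp_has_derivative bounded_linear_gam)
      have "differential ?\<phi> y u = ?D' u"
        by (rule differential_eqI[OF der]) simp
      moreover have "differential ?\<phi> y u = (\<lambda>_. 0) u"
      proof (rule differential_eqI[where \<psi> = "\<lambda>_. fps_nth 1 m"])
        show "((\<lambda>_. fps_nth 1 m :: real) has_derivative (\<lambda>_. 0)) (at y)" by (rule has_derivative_const)
        show "\<forall>\<^sub>F s in nhds 0. ?\<phi> (y + s *\<^sub>R u) = fps_nth 1 m"
          using Z_line[OF y u]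
        proof eventually_elim
          case (elim s)
          have "?\<phi> (y + s *\<^sub>R u) = fps_nth (gam i (y + s *\<^sub>R u) * inverse (gam i (y + s *\<^sub>R u))) m"
            by (rule fps_mult_nth[symmetric])
          then show ?case using Z_inverse[OF elim i] by (simp only: mult.commute[of "gam i _"])
        qed
      qed
      ultimately show "fps_nth (gam i y * ?D + gam i u * inverse (gam i y)) m = fps_nth 0 m"
        by (simp add: fps_mult_nth sum.distrib)
    qed
    then have "inverse (gam i y) * (gam i y * ?D + gam i u * inverse (gam i y)) = 0" by simp
    then have "(inverse (gam i y) * gam i y) * ?D + inverse (gam i y) ^ 2 * gam i u = 0"
      by (simp add: algebra_simps power2_eq_square)
    then show ?thesis unfolding Z_inverse[OF y i] by (simp add: eq_neg_iff_add_eq_0)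
  qed
  then show ?thesis using D by blast
qed

lemma differential_omega:
  assumes y: "y \<in> Z" and u: "u \<in> V" and v: "v \<in> V" and w: "w \<in> V"
  shows "differential (\<lambda>z. omega z v w) y u =
    (\<Sum>i=1..n. fps_nth (- (inverse (gam i y) ^ 2 * gam i u) * (rho i v * gam i w - rho i w * gam i v)) l)"
proof -
  obtain D where D: "\<And>i m. i \<in> {1..n} \<Longrightarrow> ((\<lambda>z. fps_nth (inverse (gam i z)) m) has_derivative D i m) (at y)"
    "\<And>i u. i \<in> {1..n} \<Longrightarrow> u \<in> V \<Longrightarrow> Abs_fps (\<lambda>m. D i m u) = - (inverse (gam i y) ^ 2 * gam i u)"
    using inverse_gam_derivative[OF _ y] by metis
  let ?c = "\<lambda>i. rho i v * gam i w - rho i w * gam i v"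
  have "((\<lambda>z. \<Sum>i=1..n. \<Sum>m=0..l. fps_nth (inverse (gam i z)) m * fps_nth (?c i) (l - m)) has_derivative
    (\<lambda>u. \<Sum>i=1..n. \<Sum>m=0..l. D i m u * fps_nth (?c i) (l - m))) (at y)"
    by (intro has_derivative_sum has_derivative_mult_left D(1))
  then have der: "((\<lambda>z. W z v w) has_derivative (\<lambda>u. \<Sum>i=1..n. \<Sum>m=0..l. D i m u * fps_nth (?c i) (l - m))) (at y)"
    unfolding W_def fps_mult_nth[of "inverse _"] .
  have "differential (\<lambda>z. omega z v w) y u = (\<Sum>i=1..n. \<Sum>m=0..l. D i m u * fps_nth (?c i) (l - m))"
    by (rule differential_eqI[OF der eventually_mono[OF Z_line[OF y u]]]) (rule omega_eq_W[OF _ v w])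
  also have "\<dots> = (\<Sum>i=1..n. fps_nth (Abs_fps (\<lambda>m. D i m u) * ?c i) l)"
    by (simp add: fps_mult_nth)
  also have "\<dots> = (\<Sum>i=1..n. fps_nth (- (inverse (gam i y) ^ 2 * gam i u) * ?c i) l)"
    by (intro sum.cong) (simp_all add: D(2) u)
  finally show ?thesis .
qed

text \<open>
  The derivative of \<open>\<gamma>^(-1)\<close> is \<open>- \<gamma>^(-2) d\<gamma>\<close>, and \<open>d\<gamma> \<and> d\<rho> \<and> d\<gamma> = 0\<close> in the commutative ring of series.
\<close>

lemma omega_closed:
  assumes y: "y \<in> Z" and u: "u \<in> V" and v: "v \<in> V" and w: "w \<in> V"
  shows "differential (\<lambda>z. omega z v w) y u + differential (\<lambda>z. omega z w u) y v +
        differential (\<lambda>z. omega z u v) y w = 0"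
proof -
  have "- (p * gu) * (rv * gw - rw * gv) + - (p * gv) * (rw * gu - ru * gw) +
    - (p * gw) * (ru * gv - rv * gu) = 0" for p gu gv gw ru rv rw :: "real fps"
    by (simp add: algebra_simps)
  then show ?thesis
    unfolding differential_omega[OF y u v w] differential_omega[OF y v w u] differential_omega[OF y w u v]
      sum.distrib[symmetric] fps_add_nth[symmetric] by simp
qed

lemma symplectic_omega: "symplectic_form V Z omega"
  unfolding symplectic_form_def
proof (intro conjI ballI allI)
  fix y u v w c assume y: "y \<in> Z" and u: "u \<in> V" and v: "v \<in> V" and w: "w \<in> V"
  note V = u v w subspace_add[OF subspace_V] subspace_scale[OF subspace_V]
  show "omega y (u + v) w = omega y u w + omega y v w" using V y by (simp add: omega_eq_W W_add)
  show "omega y (c *\<^sub>R v) w = c * omega y v w" using V y by (simp add: omega_eq_W W_scale)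
  show "omega y v w = - omega y w v"
    unfolding omega_eq_W[OF y v w] omega_eq_W[OF y w v] by (rule W_skew)
  show "differential (\<lambda>z. omega z v w) y u + differential (\<lambda>z. omega z w u) y v +
        differential (\<lambda>z. omega z u v) y w = 0" by (rule omega_closed[OF y u v w])
next
  fix y v assume "y \<in> Z" "v \<in> V"
  then show "(\<forall>w\<in>V. omega y v w = 0) \<longrightarrow> v = 0" using omega_nondegenerate by blast
qed (rule smooth_omega)

section \<open>Hamiltonian vector fields of invariants\<close>

text \<open>
  The Riesz representation of functionals, transported from the inner product to the nondegenerate
  form \<open>Q\<close>.
\<close>

lemma Q_represents:
  assumes "linear D" shows "\<exists>!X. D = (\<lambda>w. Q X w)"
proof (rule ex_ex1I)
  define T where "T X = (\<Sum>b\<in>Basis. Q X b *\<^sub>R b)" for X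
  have lQ: "linear (Q X)" for X using bilinear_Q by (simp add: bilinear_def)
  have rep: "D' w = (\<Sum>b\<in>Basis. D' b *\<^sub>R b) \<bullet> w" if "linear D'" for D' :: "'g ^ 'k \<Rightarrow> real" and w
  proof -
    have "D' w = D' (\<Sum>b\<in>Basis. (w \<bullet> b) *\<^sub>R b)" by (simp add: euclidean_representation)
    also have "\<dots> = (\<Sum>b\<in>Basis. (w \<bullet> b) * D' b)" by (simp add: linear_sum[OF that] linear_scale[OF that])
    finally show ?thesis by (simp add: inner_sum_left inner_commute[of w] mult.commute)
  qed
  have lin: "linear T"
    by (rule linearI) (simp_all add: T_def Q_simps scaleR_add_left sum.distrib scaleR_sum_right)
  have "inj T"
    unfolding linear_injective_0[OF lin]
  proof (intro allI impI)
    fix X assume "T X = 0"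
    then have "Q X w = 0" for w unfolding rep[OF lQ[of X], of w] T_def by (simp only: inner_zero_left)
    then show "X = 0" by (rule Q_nondegenerate)
  qed
  then have "surj T" by (rule linear_injective_imp_surjective[OF lin _ refl])
  then obtain X where X: "T X = (\<Sum>b\<in>Basis. D b *\<^sub>R b)" by (metis surjD)
  have "D w = Q X w" for w
    unfolding rep[OF assms, of w] rep[OF lQ[of X], of w] X[symmetric] by (simp only: T_def)
  then show "\<exists>X. D = (\<lambda>w. Q X w)" by (intro exI[of _ X] ext)
  fix X Y assume XY: "D = (\<lambda>w. Q X w)" "D = (\<lambda>w. Q Y w)"
  have "Q X w = Q Y w" for w using XY by metis
  then have "X - Y = 0" by (intro Q_nondegenerate) (simp add: Q_simps)
  then show "X = Y" by simp
qed

lemma gradient_derivative: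
  assumes "I differentiable (at y)"
  shows "(I has_derivative (\<lambda>w. Q (gradient Q I y) w)) (at y)"
proof -
  obtain D where D: "(I has_derivative D) (at y)" using assms by (auto simp: differentiable_def)
  have ex1: "\<exists>!X. D = (\<lambda>w. Q X w)" by (rule Q_represents[OF has_derivative_linear[OF D]])
  have "\<exists>!X. (I has_derivative (\<lambda>w. Q X w)) (at y)"
    using ex1 D has_derivative_unique by metis
  then show ?thesis unfolding gradient_def by (rule theI')
qed

lemma exp_ad_zero: "exp_ad brl (0 *\<^sub>R x) y = y"
proof -
  have pow: "(brl 0 ^^ k) y = (if k = 0 then y else 0)" for k
    by (cases k) (simp_all add: brl_simps)
  have "exp_ad brl (0 *\<^sub>R x) y = (\<Sum>k\<in>{0}. ((brl (0 *\<^sub>R x) ^^ k) y) /\<^sub>R fact k)"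
    unfolding exp_ad_def by (rule suminf_finite) (simp_all add: pow)
  then show ?thesis by simp
qed

text \<open>
  The derivative of an invariant vanishes along the adjoint orbit, and \<open>Q\<close> turns this into
  commutation of the gradient with the base point.
\<close>

lemma gradient_commutes:
  assumes I: "invariant_polynomial brl I" shows "brl y (gradient Q I y) = 0"
proof (rule Q_nondegenerate)
  fix x
  let ?X = "gradient Q I y"
  have "I differentiable (at y)"
    using I differentiable_at_real_polynomial_function by (auto simp: invariant_polynomial_def)
  then have DI: "(I has_derivative (\<lambda>w. Q ?X w)) (at (exp_ad brl (0 *\<^sub>R x) y))"
    unfolding exp_ad_zero by (rule gradient_derivative)
  have "((\<lambda>s. exp_ad brl (s *\<^sub>R x) y) has_derivative (\<lambda>s. s *\<^sub>R brl x y)) (at 0)"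
    using exp_ad_scale_has_derivative[OF bilinear_brl] by (simp add: has_vector_derivative_def)
  from has_derivative_compose[OF this DI]
  have "((\<lambda>s. I (exp_ad brl (s *\<^sub>R x) y)) has_derivative (\<lambda>s. Q ?X (s *\<^sub>R brl x y))) (at 0)" .
  moreover have "I (exp_ad brl (s *\<^sub>R x) y) = I y" for s
  proof -
    have "exp_ad brl (s *\<^sub>R x) \<circ> id \<in> adjoint_group brl UNIV"
      by (intro adjoint_group.intros) simp
    then show ?thesis using I unfolding invariant_polynomial_def by fastforce
  qed
  ultimately have "((\<lambda>s. I y) has_derivative (\<lambda>s. Q ?X (s *\<^sub>R brl x y))) (at (0::real))" by simp
  then have "(\<lambda>s::real. Q ?X (s *\<^sub>R brl x y)) = (\<lambda>_. 0)"
    by (rule has_derivative_unique) (rule has_derivative_const)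
  then have "Q ?X (1 *\<^sub>R brl x y) = 0" by metis
  then have "Q (brl ?X x) y = 0" by (simp add: Q_invariant)
  then show "Q (brl y ?X) x = 0" using Q_invariant[of y ?X x] Q_sym[of y "brl ?X x"] by simp
qed

text \<open>
  The base point involves only simple negative roots, which cannot push \<open>Nl\<close> below degree \<open>0\<close> of the
  height grading.
\<close>

lemma brl_Z_Nl:
  assumes y: "y \<in> Z" and x: "x \<in> Nl" shows "brl y x \<in> Bl"
proof -
  obtain r g where rg: "y = f + J r g" using y by (auto simp: Z_def)
  let ?T = "span (en ` {1..n})"
  have fT: "f \<in> current_subspace ?T"
    unfolding f_def by (intro subspace_sum subspace_current tens_current subspace_span span_base imageI)
  have T: "br z w \<in> borelp" if "z \<in> ?T" "w \<in> nilp" for z w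
    using that(1)
  proof (rule span_induct)
    show "subspace {z. br z w \<in> borelp}" by (intro subspace_ad_preimage subspace_borelp)
  qed (use that(2) simple_negative_nilp in auto)
  have "brl f x \<in> Bl" by (rule current_bracket_mem[OF subspace_borelp T fT x])
  moreover have "brl (J r g) x \<in> Bl"
    by (rule current_bracket_mem[OF subspace_borelp nil_borel(1)[OF borelp_nilp] J_Bl x])
  ultimately show ?thesis using subspace_add[OF sub_Bl] by (simp add: rg brl_simps)
qed

text \<open>
  Let \<open>X\<close> be the component of the gradient in \<open>Bbar\<close>. The gradient commutes with \<open>y\<close>, so \<open>[y, X]\<close> is
  minus the bracket of \<open>y\<close> with an element of \<open>Nl\<close> and lies in \<open>Bl\<close>. Hence nothing is lost on
  projection, and \<open>[y, X]\<close> is the tangent vector of the orbit generated by \<open>- X\<close>; invariance of \<open>Q\<close>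
  identifies its contraction with the form as the differential of the invariant.
\<close>

lemma hamiltonian_invariant:
  assumes I: "invariant_polynomial brl I" and y: "y \<in> Z"
  shows "hamiltonian_vector V omega I y v \<longleftrightarrow> v = invariant_field brl Q Bbar Nl I y"
proof -
  let ?X = "gradient Q I y"
  define X where "X = component Bbar Nl ?X"
  define vI where "vI = invariant_field brl Q Bbar Nl I y"
  have vI: "vI = brl y X" by (simp add: vI_def invariant_field_def X_def)
  have X: "X \<in> Bbar" "?X - X \<in> Nl" unfolding X_def by (rule neg.component_mem neg.component_diff)+
  have mX: "- X \<in> Bbar" by (rule subspace_neg[OF sub_Bbar X(1)])
  note S = Z_S[OF y]
  have "brl y X = - brl y (?X - X)" using gradient_commutes[OF I, of y] by (simp add: brl_simps)
  then have "vI \<in> Bl" unfolding vI by (simp only: subspace_neg[OF sub_Bl brl_Z_Nl[OF y X(2)]])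
  then have "vI = component Bl Nbar vI" by (simp add: pos.component_self)
  also have "vI = brl (- X) y" unfolding vI using brl_skew[of y X] by (simp add: brl_simps)
  finally have vIxi: "vI = xi (- X) y" by (simp add: infinitesimal_component vI brl_skew[of y X] brl_simps)
  then have vIV: "vI \<in> V" using xi_V[OF mX S] by simp
  have "I differentiable (at y)"
    using I differentiable_at_real_polynomial_function by (auto simp: invariant_polynomial_def)
  then have dI: "differential I y w = Q ?X w" for w
    by (rule differential_eqI[OF gradient_derivative]) simp
  have ham: "omega y vI (xi u y) = differential I y (xi u y)" if u: "u \<in> Bbar" for u
  proof -
    have "omega y vI (xi u y) = Q (brl y X) u" using omega_xi[OF y vIV u] vI by simp
    also have "\<dots> = Q y (brl X u)" by (rule Q_invariant)
    also have "\<dots> = Q (brl X u) y" by (rule Q_sym)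
    also have "\<dots> = Q X (brl u y)" by (rule Q_invariant)
    also have "\<dots> = Q X (xi u y)"
      using Q_Nbar_Bbar[OF brl_xi[OF u S] X(1)] Q_sym[of X] by (simp add: Q_simps)
    also have "\<dots> = Q ?X (xi u y)"
      using Q_Nl_Bl[OF X(2) V_Bl[OF xi_V[OF u S]]] by (simp add: Q_simps)
    finally show ?thesis by (simp add: dI)
  qed
  show ?thesis
    unfolding vI_def[symmetric]
  proof
    assume "v = vI"
    then show "hamiltonian_vector V omega I y v"
      unfolding hamiltonian_vector_def using vIV ham xi_surj[OF y] by blast
  next
    assume h: "hamiltonian_vector V omega I y v"
    then have v: "v \<in> V" by (simp add: hamiltonian_vector_def)
    have "Q (v - vI) u = 0" if u: "u \<in> Bbar" for u
      using h ham[OF u] omega_xi[OF y v u] omega_xi[OF y vIV u] xi_V[OF u S]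
      by (simp add: hamiltonian_vector_def Q_simps)
    then have "v - vI = 0" by (rule Q_Bbar_zero[OF subspace_diff[OF subspace_V v vIV]])
    then show "v = vI" by simp
  qed
qed

end

section \<open>The inverse of the coordinate matrix\<close>

context truncation
begin

lemma sum_deg: "(\<Sum>k\<in>UNIV. F (deg k)) = (\<Sum>i=0..l. F i)"
  using sum.reindex_bij_betw[OF deg_bij, of F] by simp

lemma sum_deg_rev: "(\<Sum>k\<in>UNIV. F (deg k)) = (\<Sum>i=0..l. F (l - i))"
  unfolding sum_deg by (rule sum.reindex_bij_witness[of _ "\<lambda>i. l - i" "\<lambda>i. l - i"]) auto

text \<open>
  Up to reversing the order of the rows or columns, both matrices are triangular Toeplitz matrices, that
  is, multiplication by \<open>G\<close> and by its inverse on \<open>\<real>[t]/(t^(l+1))\<close>.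
\<close>

lemma matrix_inv_gamma_matrix:
  assumes "fps_nth G 0 \<noteq> 0"
  shows "matrix_inv (gamma_matrix deg l (fps_nth G)) =
    (\<chi> j s. if deg j + deg s \<le> l then fps_nth (inverse G) (l - (deg j + deg s)) else 0)"
    (is "matrix_inv ?G = ?M")
proof -
  have prod: "?M ** ?G = mat 1"
    unfolding vec_eq_iff
  proof (intro allI)
    fix j m
    let ?F = "\<lambda>t. (if deg j + t \<le> l then fps_nth (inverse G) (l - (deg j + t)) else 0) *
      (if l \<le> t + deg m then fps_nth G (t + deg m - l) else 0)"
    have "(?M ** ?G) $ j $ m = (\<Sum>k\<in>UNIV. ?F (deg k))"
      by (simp add: matrix_matrix_mult_def gamma_matrix_def)
    also have "\<dots> = (\<Sum>t=0..l. ?F (l - t))" by (rule sum_deg_rev)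
    also have "\<dots> = (\<Sum>t=deg j..deg m. fps_nth (inverse G) (t - deg j) * fps_nth G (deg m - t))"
    proof (rule sum.mono_neutral_cong_right)
      show "{deg j..deg m} \<subseteq> {0..l}" using deg_le[of m] by auto
      fix t assume t: "t \<in> {deg j..deg m}"
      then have "t \<le> l" using order_trans[OF _ deg_le[of m]] by simp
      then have "deg j + (l - t) \<le> l" "l \<le> l - t + deg m" "l - (deg j + (l - t)) = t - deg j"
        "l - t + deg m - l = deg m - t" using t by auto
      then show "?F (l - t) = fps_nth (inverse G) (t - deg j) * fps_nth G (deg m - t)" by simp
    qed auto
    also have "\<dots> = (if deg j = deg m then 1 else 0)"
    proof (cases "deg j \<le> deg m")
      case True
      have "(\<Sum>t=deg j..deg m. fps_nth (inverse G) (t - deg j) * fps_nth G (deg m - t)) =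
        (\<Sum>t=0..deg m - deg j. fps_nth (inverse G) t * fps_nth G ((deg m - deg j) - t))"
        by (rule sum.reindex_bij_witness[of _ "\<lambda>t. t + deg j" "\<lambda>t. t - deg j"]) (use True in auto)
      also have "\<dots> = fps_nth (inverse G * G) (deg m - deg j)" by (rule fps_mult_nth[symmetric])
      also have "\<dots> = (if deg j = deg m then 1 else 0)" using assms True by (simp add: inverse_mult_eq_1)
      finally show ?thesis .
    qed auto
    also have "\<dots> = mat 1 $ j $ m" by (auto simp: mat_def dest: arg_cong[of _ _ idx])
    finally show "(?M ** ?G) $ j $ m = mat 1 $ j $ m" .
  qed
  then have prod': "?G ** ?M = mat 1" by (simp only: matrix_left_right_inverse)
  have inv: "?G ** matrix_inv ?G = mat 1 \<and> matrix_inv ?G ** ?G = mat 1"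
    unfolding matrix_inv_def by (rule someI[where x = ?M]) (rule conjI[OF prod' prod])
  have "matrix_inv ?G = matrix_inv ?G ** (?G ** ?M)" by (simp only: prod' matrix_mul_rid)
  also have "\<dots> = ?M" by (simp only: matrix_mul_assoc inv matrix_mul_lid)
  finally show ?thesis .
qed

lemma fps_triple_product:
  fixes H R G :: "real fps"
  shows
  "fps_nth (H * (R * G)) l = (\<Sum>(j, s)\<in>{(j, s). deg j + deg s \<le> l}.
    fps_nth H (l - (deg j + deg s)) * (fps_nth R (deg j) * fps_nth G (deg s)))"
proof -
  let ?h = "\<lambda>(j, s). fps_nth H (l - (deg j + deg s)) * (fps_nth R (deg j) * fps_nth G (deg s))"
  have RG: "fps_nth (R * G) m = (\<Sum>(j, s)\<in>{(j, s). deg j + deg s = m}. fps_nth R (deg j) * fps_nth G (deg s))"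
    if "m \<le> l" for m
    using that by (auto simp: sum_degree_pairs fps_mult_nth intro!: sum.cong)
  have "fps_nth (H * (R * G)) l = fps_nth ((R * G) * H) l" by (simp only: mult.commute[of H])
  also have "\<dots> = (\<Sum>m=0..l. fps_nth (R * G) m * fps_nth H (l - m))" by (rule fps_mult_nth)
  also have "\<dots> = (\<Sum>m=0..l. \<Sum>p\<in>{p \<in> {(j, s). deg j + deg s \<le> l}. deg (fst p) + deg (snd p) = m}. ?h p)"
  proof (rule sum.cong[OF refl])
    fix m assume m: "m \<in> {0..l}"
    have "fps_nth (R * G) m * fps_nth H (l - m) = (\<Sum>(j, s)\<in>{(j, s). deg j + deg s = m}.
        fps_nth R (deg j) * fps_nth G (deg s) * fps_nth H (l - m))"
      using m by (simp add: RG sum_distrib_right case_prod_unfold)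
    also have "\<dots> = (\<Sum>p\<in>{(j, s). deg j + deg s = m}. ?h p)"
      by (rule sum.cong) auto
    also have "{(j, s). deg j + deg s = m} = {p \<in> {(j, s). deg j + deg s \<le> l}. deg (fst p) + deg (snd p) = m}"
      using m by auto
    finally show "fps_nth (R * G) m * fps_nth H (l - m) =
      (\<Sum>p\<in>{p \<in> {(j, s). deg j + deg s \<le> l}. deg (fst p) + deg (snd p) = m}. ?h p)" .
  qed
  also have "\<dots> = (\<Sum>p\<in>{(j, s). deg j + deg s \<le> l}. ?h p)"
    by (rule sum.group) auto
  finally show ?thesis .
qed

end

context jacobi_setting
begin

lemma W_matrix:
  assumes y: "y \<in> Z"
  shows "W y v w = (\<Sum>i=1..n. \<Sum>(j, s)\<in>{(j, s). deg j + deg s \<le> l}.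
    matrix_inv (gamma_matrix deg l (fps_nth (gam i y))) $ j $ s *
      wedge (\<lambda>v. fps_nth (rho i v) (deg j)) (\<lambda>v. fps_nth (gam i v) (deg s)) v w)"
  unfolding W_def
proof (rule sum.cong[OF refl])
  fix i assume i: "i \<in> {1..n}"
  have unit: "fps_nth (gam i y) 0 \<noteq> 0" using Z_unit[OF y i] by simp
  show "fps_nth (inverse (gam i y) * (rho i v * gam i w - rho i w * gam i v)) l =
    (\<Sum>(j, s)\<in>{(j, s). deg j + deg s \<le> l}. matrix_inv (gamma_matrix deg l (fps_nth (gam i y))) $ j $ s *
      wedge (\<lambda>v. fps_nth (rho i v) (deg j)) (\<lambda>v. fps_nth (gam i v) (deg s)) v w)"
    unfolding right_diff_distrib fps_sub_nth fps_triple_product matrix_inv_gamma_matrix[OF unit]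
      sum_subtractf[symmetric]
    by (rule sum.cong) (auto simp: wedge_def right_diff_distrib)
qed

section \<open>Coordinates on the normalized Jacobi elements\<close>

context
  fixes h ea :: "nat \<Rightarrow> 'g"
  assumes h: "\<And>i. i \<in> {1..n} \<Longrightarrow> h i = simple_coroot i" and ea: "\<And>i. i \<in> {1..n} \<Longrightarrow> ea i = ep i"
begin

lemma jacobi_element_J: "jacobi_element deg n l f h ea r g = f + J (\<lambda>i. Abs_fps (r i)) (\<lambda>i. Abs_fps (g i))"
  unfolding jacobi_element_def J_def monomial_tens by (simp add: h ea add.assoc)

lemma jacobi_manifold_Z: "jacobi_manifold deg n l f h ea = Z"
proof -
  have "\<exists>r' g'. f + J r g = f + J (\<lambda>i. Abs_fps (r' i)) (\<lambda>i. Abs_fps (g' i)) \<and> (\<forall>i\<in>{1..n}. g' i 0 > 0)"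
    if "\<forall>i\<in>{1..n}. fps_nth (g i) 0 > 0" for r g
    by (rule exI[of _ "\<lambda>i. fps_nth (r i)"], rule exI[of _ "\<lambda>i. fps_nth (g i)"])
      (use that in \<open>simp add: fps_nth_inverse\<close>)
  then show ?thesis
    unfolding jacobi_manifold_def Z_def jacobi_element_J by auto (metis fps_nth_Abs_fps)
qed

lemma jacobi_tangent_V: "jacobi_tangent deg n l h ea = V"
proof -
  let ?M = "{monomial deg x j | x j. x \<in> h ` {1..n} \<union> ea ` {1..n} \<and> j \<le> l}"
  have sm: "tens p x = (\<Sum>j=0..l. fps_nth p j *\<^sub>R monomial deg x j)" for p and x :: 'g
    by (simp add: monomial_tens fps_nth_inverse)
  have "tens p (h i) \<in> span ?M \<and> tens p (ea i) \<in> span ?M" if "i \<in> {1..n}" for p i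
  proof -
    have "monomial deg x j \<in> ?M" if "x \<in> h ` {1..n} \<union> ea ` {1..n}" "j \<in> {0..l}" for x j
      using that by auto
    moreover have "h i \<in> h ` {1..n} \<union> ea ` {1..n}" "ea i \<in> h ` {1..n} \<union> ea ` {1..n}"
      using \<open>i \<in> {1..n}\<close> by auto
    ultimately show ?thesis unfolding sm by (intro conjI span_sum span_scale span_base) blast+
  qed
  then have "J r g \<in> span ?M" for r g
    unfolding J_def by (intro span_add span_sum) (simp_all add: h[symmetric] ea[symmetric])
  moreover have "?M \<subseteq> V"
  proof safe
    fix x j assume j: "j \<le> l"
    have mon: "monomial deg x j = tens (fps_X ^ j) x" for x :: 'g
      by (auto simp: monomial_def tens_def vec_eq_iff fps_X_power_nth)
    fix i assume i: "i \<in> {1..n}"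
    have "J (\<lambda>k. if k = i then fps_X ^ j else 0) (\<lambda>_. 0) = monomial deg (h i) j"
      using i by (simp add: J_def mon h tens_simps if_distrib[of "\<lambda>p. tens p _"] sum.delta cong: if_cong)
    then show "monomial deg (h i) j \<in> V" by (metis J_mem_V)
    have "J (\<lambda>_. 0) (\<lambda>k. if k = i then fps_X ^ j else 0) = monomial deg (ea i) j"
      using i by (simp add: J_def mon ea tens_simps if_distrib[of "\<lambda>p. tens p _"] sum.delta cong: if_cong)
    then show "monomial deg (ea i) j \<in> V" by (metis J_mem_V)
  qed
  ultimately show ?thesis
    unfolding jacobi_tangent_def using span_minimal[OF _ subspace_V, of ?M] by (auto simp: V_def)
qed

lemma coordinate_functions:
  assumes y: "y = f + J r g" and i: "i \<in> {1..n}" and j: "j \<le> l"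
  shows "rho_coord deg n l f h ea i j y = fps_nth (rho i y) j"
    and "gamma_coord deg n l f h ea i j y = fps_nth (gam i y) j"
proof -
  have ex: "y = jacobi_element deg n l f h ea (\<lambda>i. fps_nth (rho i y)) (\<lambda>i. fps_nth (gam i y))"
    unfolding jacobi_element_J fps_nth_inverse y
    by (auto intro!: J_cong intro: agree_sym[OF coordinates_f_J(1)] agree_sym[OF coordinates_f_J(2)])
  have un: "fps_nth (rho i y) j = r' i j \<and> fps_nth (gam i y) j = g' i j"
    if "y = jacobi_element deg n l f h ea r' g'" for r' g'
    using agreeD[OF coordinates_f_J(1)[OF i] j] agreeD[OF coordinates_f_J(2)[OF i] j]
    unfolding that jacobi_element_J by simp
  show "rho_coord deg n l f h ea i j y = fps_nth (rho i y) j"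
    unfolding rho_coord_def by (rule the_equality) (use ex un in metis)+
  show "gamma_coord deg n l f h ea i j y = fps_nth (gam i y) j"
    unfolding gamma_coord_def by (rule the_equality) (use ex un in metis)+
qed

lemma coordinate_differentials:
  assumes y: "y \<in> Z" and v: "v \<in> V" and i: "i \<in> {1..n}" and j: "j \<le> l"
  shows "differential (rho_coord deg n l f h ea i j) y v = fps_nth (rho i v) j"
    and "differential (gamma_coord deg n l f h ea i j) y v = fps_nth (gam i v) j"
proof -
  obtain r g r' g' where "y = f + J r g" "v = J r' g'" using y v by (auto simp: Z_def V_def)
  then have line: "y + s *\<^sub>R v = f + J (\<lambda>i. r i + fps_const s * r' i) (\<lambda>i. g i + fps_const s * g' i)" for s
    by (simp add: J_linear add.assoc)
  show "differential (rho_coord deg n l f h ea i j) y v = fps_nth (rho i v) j"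
    by (rule differential_eqI[OF bounded_linear_imp_has_derivative[OF bounded_linear_rho]])
      (simp add: coordinate_functions(1)[OF line i j])
  show "differential (gamma_coord deg n l f h ea i j) y v = fps_nth (gam i v) j"
    by (rule differential_eqI[OF bounded_linear_imp_has_derivative[OF bounded_linear_gam]])
      (simp add: coordinate_functions(2)[OF line i j])
qed

lemma omega_coordinates:
  assumes y: "y \<in> Z" and v: "v \<in> V" and w: "w \<in> V"
  defines "\<rho> \<equiv> rho_coord deg n l f h ea" and "\<gamma> \<equiv> gamma_coord deg n l f h ea"
  shows "omega y v w = (\<Sum>i=1..n. \<Sum>(j, s)\<in>{(j, s). deg j + deg s \<le> l}.
    matrix_inv (gamma_matrix deg l (\<lambda>m. \<gamma> i m y)) $ j $ s *
      wedge (differential (\<rho> i (deg j)) y) (differential (\<gamma> i (deg s)) y) v w)"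
  unfolding omega_eq_W[OF y v w] W_matrix[OF y] \<rho>_def \<gamma>_def
proof (rule sum.cong[OF refl], rule sum.cong[OF refl], clarify)
  fix i j s assume i: "i \<in> {1..n}"
  obtain r g where yJ: "y = f + J r g" using y by (auto simp: Z_def)
  have "gamma_matrix deg l (fps_nth (gam i y)) = gamma_matrix deg l (\<lambda>m. gamma_coord deg n l f h ea i m y)"
    unfolding gamma_matrix_def vec_eq_iff
  proof (intro allI)
    fix j s
    have "deg j + deg s - l \<le> l" using add_mono[OF deg_le[of j] deg_le[of s]] by linarith
    then show "(\<chi> j s. if l \<le> deg j + deg s then fps_nth (gam i y) (deg j + deg s - l) else 0) $ j $ s =
      (\<chi> j s. if l \<le> deg j + deg s then gamma_coord deg n l f h ea i (deg j + deg s - l) y else 0) $ j $ s"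
      by (simp add: coordinate_functions(2)[OF yJ i])
  qed
  then show "matrix_inv (gamma_matrix deg l (fps_nth (gam i y))) $ j $ s *
      wedge (\<lambda>v. fps_nth (rho i v) (deg j)) (\<lambda>v. fps_nth (gam i v) (deg s)) v w =
    matrix_inv (gamma_matrix deg l (\<lambda>m. gamma_coord deg n l f h ea i m y)) $ j $ s *
      wedge (differential (rho_coord deg n l f h ea i (deg j)) y)
        (differential (gamma_coord deg n l f h ea i (deg s)) y) v w"
    by (simp add: wedge_def coordinate_differentials[OF y _ i] v w)
qed

end

end

theorem proposition6p10:
  fixes br :: "'g::euclidean_space \<Rightarrow> 'g \<Rightarrow> 'g"
    and \<kappa> :: "'g \<Rightarrow> 'g \<Rightarrow> real"
    and \<hh> \<nn> \<nn>' \<bb> \<bb>' :: "'g set"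
    and n l :: nat
    and \<alpha> :: "nat \<Rightarrow> 'g \<Rightarrow> real"
    and e :: "('g \<Rightarrow> real) \<Rightarrow> 'g"
    and h e\<alpha> :: "nat \<Rightarrow> 'g"
    and deg :: "'k::finite \<Rightarrow> nat"
    and brl :: "'g ^ 'k \<Rightarrow> 'g ^ 'k \<Rightarrow> 'g ^ 'k"
    and Q :: "'g ^ 'k \<Rightarrow> 'g ^ 'k \<Rightarrow> real"
    and c :: "nat \<Rightarrow> nat \<Rightarrow> real"
    and f :: "'g ^ 'k"
    and F Nbar Bbar N Z V :: "('g ^ 'k) set"
    and \<rho> \<gamma> :: "nat \<Rightarrow> nat \<Rightarrow> 'g ^ 'k \<Rightarrow> real"
    and \<omega> :: "'g ^ 'k \<Rightarrow> 'g ^ 'k \<Rightarrow> 'g ^ 'k \<Rightarrow> real"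
  assumes simple: "simple_lie br"
    and kappa: "\<exists>q>0. \<forall>x y. \<kappa> x y = q * killing br x y"
    and cartan: "split_cartan br \<hh>"
    and rank: "n = dim \<hh>"
    and simple_roots: "simple_roots br \<hh> n \<alpha>"
    and root_vectors: "\<forall>\<beta>\<in>roots br \<hh>. e \<beta> \<in> root_space br \<hh> \<beta>"
    and root_vectors_kappa: "\<forall>\<beta>\<in>roots br \<hh>. \<forall>\<beta>'\<in>roots br \<hh>.
          \<kappa> (e \<beta>) (e \<beta>') = (if \<beta> = neg_root \<beta>' then 1 else 0)"
    and h: "\<forall>i\<in>{1..n}. h i = br (e (\<alpha> i)) (e (neg_root (\<alpha> i)))"
    and h_normalized: "\<forall>i\<in>{1..n}. \<kappa> (h i) (h i) = 2"
    and e\<alpha>: "\<forall>i\<in>{1..n}. e\<alpha> i = e (\<alpha> i)"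
    and nn: "\<nn> = span (e ` positive_roots br \<hh> n \<alpha>)"
    and nn': "\<nn>' = span ((\<lambda>\<beta>. e (neg_root \<beta>)) ` positive_roots br \<hh> n \<alpha>)"
    and bb: "\<bb> = {x + y | x y. x \<in> \<hh> \<and> y \<in> \<nn>}"
    and bb': "\<bb>' = {x + y | x y. x \<in> \<hh> \<and> y \<in> \<nn>'}"
    and l_pos: "l > 0"
    and deg: "bij_betw deg UNIV {0..l}"
    and brl: "brl = current_bracket deg br"
    and Q: "Q = current_form deg l \<kappa>"
    and N: "N = current_subspace \<nn>"
    and Nbar: "Nbar = current_subspace \<nn>'"
    and Bbar: "Bbar = current_subspace \<bb>'"
    and c_nonzero: "\<forall>i\<in>{1..n}. \<forall>j\<in>{0..l}. c i j \<noteq> 0"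
    and f: "f = (\<Sum>j=0..l. monomial deg (\<Sum>i=1..n. c i j *\<^sub>R e (neg_root (\<alpha> i))) j)"
    and F: "F = (\<lambda>x. f + x) ` current_subspace \<bb>"
    and Z: "Z = jacobi_manifold deg n l f h e\<alpha>"
    and V: "V = jacobi_tangent deg n l h e\<alpha>"
    and \<rho>: "\<rho> = rho_coord deg n l f h e\<alpha>"
    and \<gamma>: "\<gamma> = gamma_coord deg n l f h e\<alpha>"
    and \<omega>: "\<omega> = kks_form brl Q F Nbar Bbar"
  shows "(\<exists>y\<in>F. Z = proj_orbit F Nbar (adjoint_group brl Bbar) y)
    \<and> (\<forall>y\<in>Z. orbit_tangent brl F Nbar Bbar y = V)
    \<and> symplectic_form V Z \<omega>
    \<and> (\<forall>y\<in>Z. \<forall>v\<in>V. \<forall>w\<in>V.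
         \<omega> y v w = (\<Sum>i=1..n. \<Sum>(j, s) \<in> {(j, s). deg j + deg s \<le> l}.
           matrix_inv (gamma_matrix deg l (\<lambda>m. \<gamma> i m y)) $ j $ s *
           wedge (differential (\<rho> i (deg j)) y) (differential (\<gamma> i (deg s)) y) v w))
    \<and> (\<forall>I. invariant_polynomial brl I \<longrightarrow>
         (\<forall>y\<in>Z. \<forall>v. hamiltonian_vector V \<omega> I y v \<longleftrightarrow> v = invariant_field brl Q Bbar N I y))"
proof -
  define C where "C i = Abs_fps (c i)" for i
  interpret jacobi: jacobi_setting br \<kappa> \<hh> n \<alpha> e deg l C
  proof
    show "\<exists>x y. \<kappa> x y \<noteq> 0" if "n \<noteq> 0"
      by (rule exI[of _ "h 1"], rule exI[of _ "h 1"]) (use h_normalized that in simp)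
  qed (use simple kappa cartan rank simple_roots root_vectors root_vectors_kappa deg in blast)+
  have hi: "h i = jacobi.simple_coroot i" and ei: "e\<alpha> i = jacobi.ep i" if "i \<in> {1..n}" for i
    using that h e\<alpha> by (auto simp: jacobi.coroot_def)
  have sets: "\<nn> = jacobi.nilp" "\<nn>' = jacobi.niln" "\<bb> = jacobi.borelp" "\<bb>' = jacobi.boreln"
    by (simp_all only: nn nn' bb bb' jacobi.nilp_def jacobi.niln_def jacobi.borelp_def jacobi.boreln_def)
  have "monomial deg (\<Sum>i=1..n. c i j *\<^sub>R jacobi.en i) j = (\<Sum>i=1..n. c i j *\<^sub>R monomial deg (jacobi.en i) j)"
    for j by (auto simp: monomial_def vec_eq_iff)
  then have "f = (\<Sum>i=1..n. \<Sum>j=0..l. c i j *\<^sub>R monomial deg (jacobi.en i) j)"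
    unfolding f by (simp only: sum.swap[of _ "{0..l}"])
  then have f_eq: "f = jacobi.f" by (simp add: jacobi.f_def C_def jacobi.monomial_tens)
  have F_eq: "F = jacobi.F" by (simp only: F jacobi.F_def sets f_eq)
  have Z_eq: "Z = jacobi.Z" unfolding Z f_eq by (rule jacobi.jacobi_manifold_Z[OF hi ei])
  have V_eq: "V = jacobi.V" unfolding V by (rule jacobi.jacobi_tangent_V[OF hi ei])
  have omega_eq: "\<omega> = jacobi.omega"
    unfolding \<omega> jacobi.omega_def brl Q F_eq Nbar Bbar sets ..
  note eqs = brl Q N Nbar Bbar sets F_eq Z_eq V_eq omega_eq \<rho> \<gamma> f_eq
  show ?thesis
    unfolding eqs
    using jacobi.base_F jacobi.Z_orbit jacobi.orbit_tangent_V jacobi.symplectic_omega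
      jacobi.omega_coordinates[OF hi ei] jacobi.hamiltonian_invariant
    by blast
qed

end
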